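(* Let $p>5$ be a prime, let $\mathbf{k}=\mathbf{F}_p(x_{ij}\mid i\in\{1,2\},\,j\in\{1,2,3,4\})$ and let $\mathcal M=(x_{ij})$ be the generic $2\times 4$ matrix. With the invariants $f_1,f_2,f_3$ and the norm $N_{\mathcal M}(z)$ defined in the context, the set $\mathcal B:=\{x,f_1,f_2,f_3,N_{\mathcal M}(z)\}$ is a SAGBI basis, and hence a generating set, for $\mathbf{k}[V_{\mathcal M}]^E$. Furthermore, $\mathbf{k}[V_{\mathcal M}]^E$ is a complete intersection with generating relations coming from the subduction of the têtes-à-têtes $(f_2^p,f_1^{p+2})$ and $(f_3^p,f_2f_1^{p^2-1})$.
   Context: $E=\langle e_1,e_2,e_3,e_4\rangle\cong(\mathbf{Z}/p)^4$ acts on $\mathbf{k}[V_{\mathcal M}]=\mathbf{k}[x,y,z]$ (on the right, by algebra automorphisms) by $x\cdot e_j=x$, $y\cdot e_j=y+x_{1j}x$, $z\cdot e_j=z+2x_{1j}y+(x_{1j}^2+x_{2j})x$; $\mathbf{k}[V_{\mathcal M}]^E$ is the ring of invariants. $N_{\mathcal M}(z)$ is the product of the distinct elements of the $E$-orbit of $z$. Minors: $\Gamma$ is the $10\times4$ matrix whose row $2k+1$ is $(x_{11}^{p^k},x_{12}^{p^k},x_{13}^{p^k},x_{14}^{p^k})$ and whose row $2k+2$ is $(x_{21}^{p^k},x_{22}^{p^k},x_{23}^{p^k},x_{24}^{p^k})$, $k=0,\dots,4$; $\gamma_{ijk\ell}$ is the $4\times4$ minor of $\Gamma$ with rows $i,j,k,\ell$.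 Put $\delta:=y^2-xz$ and $$f_1:=\gamma_{1234}y^{p^2}+\gamma_{1235}\delta^px^{p^2-2p}+\gamma_{1245}x^{p^2-p}y^p+\gamma_{1345}\delta x^{p^2-2}+\gamma_{2345}x^{p^2-1}y,$$ $$f_{12346}:=-\gamma_{1234}\delta^{p^2}+\gamma_{1236}\delta^px^{2p^2-2p}+\gamma_{1246}x^{2p^2-p}y^p+\gamma_{1346}\delta x^{2p^2-2}+\gamma_{2346}x^{2p^2-1}y,$$ $$f_2:=\frac{f_1^2+\gamma_{1234}f_{12346}}{2x^{p^2-2p}},$$ $$\widetilde{f_3}:=\gamma_{1235}^pf_1^{p+2}-\gamma_{1234}^2f_2^p+\alpha_1x^{p^2-2p}f_1^pf_2+\alpha_2x^{p^2}f_1^{p+1}+\alpha_3x^{2p^2-2p}f_1^{p-1}f_2+\alpha_4x^{2p^2-p}f_1^{\frac{p-3}{2}}f_2^{\frac{p+1}{2}},$$ with $\alpha_1=-2\gamma_{1235}^p$, $\alpha_2=\gamma_{1234}\gamma_{1245}^p$, $\alpha_3=\gamma_{1234}^{p+1}\gamma_{1237}/\gamma_{1235}$, $\alpha_4=\gamma_{1234}^{p+3}\gamma_{1257}/\gamma_{1235}^{(p+3)/2}$, and $$f_3:=-\widetilde{f_3}\,\frac{\gamma_{1235}}{\gamma_{1234}^{2p+2}x^{2p^2-2}}.$$ These are elements of $\mathbf{k}[V_{\mathcal M}]^E$ with $\mathrm{LT}(f_1)=\gamma_{1234}y^{p^2}$, $\mathrm{LT}(f_2)=\gamma_{1234}\gamma_{1235}y^{p^2+2p}$,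 $\mathrm{LT}(f_3)=\gamma_{1357}y^{p^3+2}$. Conventions: graded reverse lexicographic order with $x<y<z$; $\mathrm{LM}$, $\mathrm{LT}$ denote lead monomial and lead term (with coefficient). A finite subset $\mathcal B=\{b_1,\dots,b_m\}$ of a subalgebra $A$ of a polynomial ring is a SAGBI basis for $A$ if the monomials $\mathrm{LM}(b_i)$ generate the algebra spanned by the lead monomials of the elements of $A$. A tête-à-tête is a pair $(b^I,b^J)$ of products of elements of $\mathcal B$ with $\mathrm{LM}(b^I)=\mathrm{LM}(b^J)$. Its subduction: choose a scalar $c$ with $\mathrm{LT}(b^I)=\mathrm{LT}(cb^J)$ and repeatedly cancel the lead term of $b^I-cb^J$ by scalar multiples of products of elements of $\mathcal B$; if this ends at zero, it expresses $b^I-cb^J$ as a polynomial in $\mathcal B$, giving a relation. "Generating relations coming from the subduction of" given têtes-à-têtes means that the kernel of the surjection from the polynomial ring on $m$ variables sending the variables to $b_1,\dots,b_m$ is generated by the relations so obtained. A complete intersection is an algebra having a presentation whose ideal of relations is generated by a regular sequence. *)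

theory Defs
  imports
    "HOL-Analysis.Determinants"
    "HOL-Analysis.Cartesian_Space"
    "HOL-Library.Poly_Mapping"
    "HOL-Computational_Algebra.Fraction_Field"
    "Berlekamp_Zassenhaus.Finite_Field"
begin

section \<open>Polynomial rings\<close>

text \<open>
  A polynomial over \<open>'a\<close> in variables \<open>'v\<close> is a finitely supported function from
  exponent vectors \<open>'v \<Rightarrow>\<^sub>0 nat\<close> to coefficients.
\<close>

type_synonym ('v, 'a) mpoly = "('v \<Rightarrow>\<^sub>0 nat) \<Rightarrow>\<^sub>0 'a"

definition Const :: "'a::comm_ring_1 \<Rightarrow> ('v, 'a) mpoly" where
  "Const c = Poly_Mapping.single 0 c"

definition Var :: "'v \<Rightarrow> ('v, 'a::comm_ring_1) mpoly" where
  "Var v = Poly_Mapping.single (Poly_Mapping.single v 1) 1"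

definition subst ::
  "('v \<Rightarrow> ('w, 'a::comm_ring_1) mpoly) \<Rightarrow> ('v, 'a) mpoly \<Rightarrow> ('w, 'a) mpoly" where
  "subst h f = (\<Sum>u\<in>Poly_Mapping.keys f.
     Const (Poly_Mapping.lookup f u) *
     (\<Prod>v\<in>Poly_Mapping.keys u. h v ^ Poly_Mapping.lookup u v))"

text \<open>The quotient \<open>f / d\<close>, meaningful only if \<open>d \<noteq> 0\<close> divides \<open>f\<close>.\<close>

definition exact_quot :: "'a::comm_ring_1 \<Rightarrow> 'a \<Rightarrow> 'a" where
  "exact_quot f d = (THE g. g * d = f)"

definition is_subalgebra :: "('v, 'a::comm_ring_1) mpoly set \<Rightarrow> bool" where
  "is_subalgebra S \<longleftrightarrow>
     (\<forall>c. Const c \<in> S) \<and> (\<forall>f\<in>S. \<forall>g\<in>S. f + g \<in> S) \<and> (\<forall>f\<in>S. \<forall>g\<in>S. f * g \<in> S)"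

definition is_subspace :: "('v, 'a::comm_ring_1) mpoly set \<Rightarrow> bool" where
  "is_subspace S \<longleftrightarrow>
     0 \<in> S \<and> (\<forall>f\<in>S. \<forall>g\<in>S. f + g \<in> S) \<and> (\<forall>c. \<forall>f\<in>S. Const c * f \<in> S)"


section \<open>Graded reverse lexicographic order\<close>

datatype var = Vx | Vy | Vz

text \<open>
  The linear order on variables is what makes the polynomial ring an instance of
  \<^class>\<open>idom\<close>; the monomial order used below is \<open>grevlex_less\<close>.
\<close>

instantiation var :: linorder
begin

definition less_eq_var :: "var \<Rightarrow> var \<Rightarrow> bool" where
  "less_eq_var a b \<longleftrightarrow> a = Vx \<or> b = Vz \<or> a = b"

definition less_var :: "var \<Rightarrow> var \<Rightarrow> bool" where
  "less_var a b \<longleftrightarrow> a \<le> b \<and> a \<noteq> b"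

instance
proof
  fix a b c :: var
  show "(a < b) = (a \<le> b \<and> \<not> b \<le> a)" "a \<le> a" "a \<le> b \<or> b \<le> a"
    "a \<le> b \<Longrightarrow> b \<le> c \<Longrightarrow> a \<le> c" "a \<le> b \<Longrightarrow> b \<le> a \<Longrightarrow> a = b"
    by (cases a; cases b; cases c; simp add: less_eq_var_def less_var_def)+
qed

end

definition tdeg :: "(var \<Rightarrow>\<^sub>0 nat) \<Rightarrow> nat" where
  "tdeg u = Poly_Mapping.lookup u Vx + Poly_Mapping.lookup u Vy + Poly_Mapping.lookup u Vz"

definition grevlex_less :: "(var \<Rightarrow>\<^sub>0 nat) \<Rightarrow> (var \<Rightarrow>\<^sub>0 nat) \<Rightarrow> bool" where
  "grevlex_less u v \<longleftrightarrow>
     tdeg u < tdeg v \<or>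
     tdeg u = tdeg v \<and>
       (Poly_Mapping.lookup u Vx > Poly_Mapping.lookup v Vx \<or>
        Poly_Mapping.lookup u Vx = Poly_Mapping.lookup v Vx \<and>
        Poly_Mapping.lookup u Vy > Poly_Mapping.lookup v Vy)"

definition lead_exp :: "(var, 'a::comm_ring_1) mpoly \<Rightarrow> (var \<Rightarrow>\<^sub>0 nat)" where
  "lead_exp f = (THE u. u \<in> Poly_Mapping.keys f \<and>
     (\<forall>v\<in>Poly_Mapping.keys f. v = u \<or> grevlex_less v u))"

text \<open>\<open>LM f\<close> is meaningful only for \<open>f \<noteq> 0\<close>; by contrast \<open>LT 0 = 0\<close> and \<open>LT f \<noteq> 0\<close> for \<open>f \<noteq> 0\<close>.\<close>

definition LM :: "(var, 'a::comm_ring_1) mpoly \<Rightarrow> (var, 'a) mpoly" where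
  "LM f = Poly_Mapping.single (lead_exp f) 1"

definition LT :: "(var, 'a::comm_ring_1) mpoly \<Rightarrow> (var, 'a) mpoly" where
  "LT f = Poly_Mapping.single (lead_exp f) (Poly_Mapping.lookup f (lead_exp f))"

definition LMs :: "(var, 'a::comm_ring_1) mpoly set \<Rightarrow> (var, 'a) mpoly set" where
  "LMs S = LM ` (S - {0})"

definition sagbi_basis ::
  "(var, 'a::field) mpoly set \<Rightarrow> (var, 'a) mpoly set \<Rightarrow> bool" where
  "sagbi_basis B A \<longleftrightarrow>
     is_subalgebra A \<and> finite B \<and> B \<subseteq> A \<and>
     is_subalgebra hull (LMs B) = is_subspace hull (LMs A)"


section \<open>Presentations and complete intersections\<close>

text \<open>
  The polynomial ring on \<open>m\<close> variables $t_0,\dots,t_{m-1}$ is realised inside the ring of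
  polynomials with variables indexed by \<^typ>\<open>nat\<close>, so that \<open>m\<close> can be quantified over.
\<close>

definition poly_ring :: "nat \<Rightarrow> (nat, 'a::comm_ring_1) mpoly set" where
  "poly_ring m = {P. \<forall>u\<in>Poly_Mapping.keys P. Poly_Mapping.keys u \<subseteq> {..<m}}"

text \<open>The ideal of the subring \<open>R\<close> generated by the entries of \<open>rs\<close>.\<close>

definition ideal_gen :: "'a::comm_ring_1 set \<Rightarrow> 'a list \<Rightarrow> 'a set" where
  "ideal_gen R rs = {(\<Sum>i<length rs. a i * rs ! i) | a. \<forall>i<length rs. a i \<in> R}"

definition regular_sequence :: "'a::comm_ring_1 set \<Rightarrow> 'a list \<Rightarrow> bool" where
  "regular_sequence R rs \<longleftrightarrow>
     set rs \<subseteq> R \<and>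
     (\<forall>i<length rs. \<forall>g\<in>R.
        rs ! i * g \<in> ideal_gen R (take i rs) \<longrightarrow> g \<in> ideal_gen R (take i rs)) \<and>
     ideal_gen R rs \<noteq> R"

definition eval_at ::
  "('w, 'a::comm_ring_1) mpoly list \<Rightarrow> (nat, 'a) mpoly \<Rightarrow> ('w, 'a) mpoly" where
  "eval_at bs = subst (\<lambda>i. bs ! i)"

definition relations ::
  "('w, 'a::comm_ring_1) mpoly list \<Rightarrow> (nat, 'a) mpoly set" where
  "relations bs = {P \<in> poly_ring (length bs). eval_at bs P = 0}"

definition complete_intersection :: "('w, 'a::field) mpoly set \<Rightarrow> bool" where
  "complete_intersection A \<longleftrightarrow>
     (\<exists>bs rs. eval_at bs ` poly_ring (length bs) = A \<and>
        regular_sequence (poly_ring (length bs)) rs \<and>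
        relations bs = ideal_gen (poly_ring (length bs)) rs)"


section \<open>Subduction\<close>

definition power_product ::
  "('w, 'a::comm_ring_1) mpoly list \<Rightarrow> (nat \<Rightarrow>\<^sub>0 nat) \<Rightarrow> ('w, 'a) mpoly" where
  "power_product bs I = (\<Prod>i<length bs. (bs ! i) ^ Poly_Mapping.lookup I i)"

text \<open>
  \<open>subducts_to_zero bs f P\<close>: some subduction of \<open>f\<close> over \<open>bs\<close> ends at zero, and \<open>P\<close> is the
  polynomial in the \<open>bs\<close> collected along the way, so that \<open>f = eval_at bs P\<close>. As there may be
  several ways to cancel a lead term, \<open>P\<close> need not be determined by \<open>bs\<close> and \<open>f\<close>.
\<close>

inductive subducts_to_zero ::
  "(var, 'a::field) mpoly list \<Rightarrow> (var, 'a) mpoly \<Rightarrow> (nat, 'a) mpoly \<Rightarrow> bool"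
  for bs where
  stop: "subducts_to_zero bs 0 0"
| cancel: "f \<noteq> 0 \<Longrightarrow> Poly_Mapping.keys K \<subseteq> {..<length bs} \<Longrightarrow>
    LT f = LT (Const c * power_product bs K) \<Longrightarrow>
    subducts_to_zero bs (f - Const c * power_product bs K) P \<Longrightarrow>
    subducts_to_zero bs f (P + Poly_Mapping.single K c)"

definition tete_a_tete ::
  "(var, 'a::field) mpoly list \<Rightarrow> (nat \<Rightarrow>\<^sub>0 nat) \<Rightarrow> (nat \<Rightarrow>\<^sub>0 nat) \<Rightarrow> bool" where
  "tete_a_tete bs I J \<longleftrightarrow>
     Poly_Mapping.keys I \<subseteq> {..<length bs} \<and> Poly_Mapping.keys J \<subseteq> {..<length bs} \<and>
     power_product bs I \<noteq> 0 \<and> power_product bs J \<noteq> 0 \<and>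
     LM (power_product bs I) = LM (power_product bs J)"

definition subduction_relation ::
  "(var, 'a::field) mpoly list \<Rightarrow> (nat \<Rightarrow>\<^sub>0 nat) \<Rightarrow> (nat \<Rightarrow>\<^sub>0 nat) \<Rightarrow> (nat, 'a) mpoly \<Rightarrow> bool"
where
  "subduction_relation bs I J R \<longleftrightarrow>
     tete_a_tete bs I J \<and>
     (\<exists>c P. LT (power_product bs I) = LT (Const c * power_product bs J) \<and>
        subducts_to_zero bs (power_product bs I - Const c * power_product bs J) P \<and>
        R = Poly_Mapping.single I 1 - Poly_Mapping.single J c - P)"


section \<open>The generic matrix and the group action\<close>

text \<open>
  The index types \<open>2\<close> and \<open>4\<close> are those of \<^theory>\<open>HOL-Library.Numeral_Type\<close>; their elements
  are \<open>1, 2\<close> and \<open>1, 2, 3, 4\<close>, where \<open>2 = 0\<close> in the former and \<open>4 = 0\<close> in the latter. As for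
  \<^typ>\<open>var\<close>, the order on the indeterminates serves only to obtain the class \<^class>\<open>idom\<close>.
\<close>

datatype entry = Entry 2 4

instantiation entry :: linorder
begin

definition less_eq_entry :: "entry \<Rightarrow> entry \<Rightarrow> bool" where
  "less_eq_entry a b =
     (case a of Entry i j \<Rightarrow> case b of Entry k l \<Rightarrow> i < k \<or> i = k \<and> j \<le> l)"

definition less_entry :: "entry \<Rightarrow> entry \<Rightarrow> bool" where
  "less_entry a b \<longleftrightarrow> a \<le> b \<and> a \<noteq> b"

instance
proof
  fix a b c :: entry
  show "(a < b) = (a \<le> b \<and> \<not> b \<le> a)" "a \<le> a" "a \<le> b \<or> b \<le> a"
    "a \<le> b \<Longrightarrow> b \<le> c \<Longrightarrow> a \<le> c" "a \<le> b \<Longrightarrow> b \<le> a \<Longrightarrow> a = b"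
    by (cases a; cases b; cases c; force simp: less_eq_entry_def less_entry_def)+
qed

end

text \<open>
  The prime is $p$ = \<open>CARD('p)\<close>, and \<^typ>\<open>'p mod_ring\<close> is the field $\mathbf{F}_p$, whose
  additive group is $\mathbf{Z}/p$.
\<close>

type_synonym 'p genfield = "((entry, 'p mod_ring) mpoly) fract"

type_synonym 'p gring = "(var, 'p genfield) mpoly"

definition xm :: "2 \<Rightarrow> 4 \<Rightarrow> 'p::prime_card genfield" where
  "xm i j = Fract (Var (Entry i j)) 1"

definition gen_act :: "4 \<Rightarrow> 'p::prime_card gring \<Rightarrow> 'p gring" where
  "gen_act j = subst (\<lambda>v. case v of
       Vx \<Rightarrow> Var Vx
     | Vy \<Rightarrow> Var Vy + Const (xm 1 j) * Var Vx
     | Vz \<Rightarrow> Var Vz + Const (2 * xm 1 j) * Var Vy + Const ((xm 1 j)^2 + xm 2 j) * Var Vx)"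

text \<open>
  The vector \<open>c\<close> stands for the element $e_1^{c_1} e_2^{c_2} e_3^{c_3} e_4^{c_4}$ of $E$, and
  \<open>act f c\<close> is $f \cdot e_1^{c_1} e_2^{c_2} e_3^{c_3} e_4^{c_4}$ for the right action.
\<close>

definition act :: "'p::prime_card gring \<Rightarrow> 'p mod_ring ^ 4 \<Rightarrow> 'p gring" where
  "act f c = (let n = (\<lambda>j. nat (to_int_mod_ring (c $ j))) in
     (gen_act 4 ^^ n 4) ((gen_act 3 ^^ n 3) ((gen_act 2 ^^ n 2) ((gen_act 1 ^^ n 1) f))))"

definition invariants :: "'p::prime_card gring set" where
  "invariants = {f. \<forall>c. act f c = f}"

definition norm_z :: "'p::prime_card gring" where
  "norm_z = \<Prod>(range (act (Var Vz)))"


section \<open>The invariants\<close>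

text \<open>The entry in row \<open>r\<close> (counted from 1) and column \<open>j\<close> of the matrix $\Gamma$.\<close>

definition Gam :: "nat \<Rightarrow> 4 \<Rightarrow> 'p::prime_card genfield" where
  "Gam r j = (xm (if odd r then 1 else 2) j) ^ (CARD('p) ^ ((r - 1) div 2))"

definition gam :: "nat \<Rightarrow> nat \<Rightarrow> nat \<Rightarrow> nat \<Rightarrow> 'p::prime_card genfield" where
  "gam i j k l = det (\<chi> a b. Gam ((vector [i, j, k, l] :: nat ^ 4) $ a) b)"

definition dlt :: "'p::prime_card gring" where
  "dlt = Var Vy ^ 2 - Var Vx * Var Vz"

definition f1 :: "'p::prime_card gring" where
  "f1 = (let p = CARD('p) in
       Const (gam 1 2 3 4) * Var Vy ^ (p^2)
     + Const (gam 1 2 3 5) * dlt ^ p * Var Vx ^ (p^2 - 2*p)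
     + Const (gam 1 2 4 5) * Var Vx ^ (p^2 - p) * Var Vy ^ p
     + Const (gam 1 3 4 5) * dlt * Var Vx ^ (p^2 - 2)
     + Const (gam 2 3 4 5) * Var Vx ^ (p^2 - 1) * Var Vy)"

definition f12346 :: "'p::prime_card gring" where
  "f12346 = (let p = CARD('p) in
     - Const (gam 1 2 3 4) * dlt ^ (p^2)
     + Const (gam 1 2 3 6) * dlt ^ p * Var Vx ^ (2*p^2 - 2*p)
     + Const (gam 1 2 4 6) * Var Vx ^ (2*p^2 - p) * Var Vy ^ p
     + Const (gam 1 3 4 6) * dlt * Var Vx ^ (2*p^2 - 2)
     + Const (gam 2 3 4 6) * Var Vx ^ (2*p^2 - 1) * Var Vy)"

definition f2 :: "'p::prime_card gring" where
  "f2 = (let p = CARD('p) in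
     exact_quot (f1^2 + Const (gam 1 2 3 4) * f12346) (2 * Var Vx ^ (p^2 - 2*p)))"

definition alpha1 :: "'p::prime_card genfield" where
  "alpha1 = - 2 * gam 1 2 3 5 ^ CARD('p)"

definition alpha2 :: "'p::prime_card genfield" where
  "alpha2 = gam 1 2 3 4 * gam 1 2 4 5 ^ CARD('p)"

definition alpha3 :: "'p::prime_card genfield" where
  "alpha3 = gam 1 2 3 4 ^ (CARD('p) + 1) * gam 1 2 3 7 / gam 1 2 3 5"

definition alpha4 :: "'p::prime_card genfield" where
  "alpha4 = gam 1 2 3 4 ^ (CARD('p) + 3) * gam 1 2 5 7 / gam 1 2 3 5 ^ ((CARD('p) + 3) div 2)"

definition f3_tilde :: "'p::prime_card gring" where
  "f3_tilde = (let p = CARD('p) in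
       Const (gam 1 2 3 5 ^ p) * f1 ^ (p + 2)
     - Const (gam 1 2 3 4 ^ 2) * f2 ^ p
     + Const alpha1 * Var Vx ^ (p^2 - 2*p) * f1 ^ p * f2
     + Const alpha2 * Var Vx ^ (p^2) * f1 ^ (p + 1)
     + Const alpha3 * Var Vx ^ (2*p^2 - 2*p) * f1 ^ (p - 1) * f2
     + Const alpha4 * Var Vx ^ (2*p^2 - p) * f1 ^ ((p - 3) div 2) * f2 ^ ((p + 1) div 2))"

definition f3 :: "'p::prime_card gring" where
  "f3 = (let p = CARD('p) in
     exact_quot (- f3_tilde * Const (gam 1 2 3 5))
       (Const (gam 1 2 3 4 ^ (2*p + 2)) * Var Vx ^ (2*p^2 - 2)))"

definition gens :: "'p::prime_card gring list" where
  "gens = [Var Vx, f1, f2, f3, norm_z]"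

end

theory Submission
  imports Defs
begin

text \<open>
  With \<open>\<delta> = y\<^sup>2 - x z\<close>, the group acts on the affine chart \<open>x = 1\<close> by translations
  of \<open>(y, -\<delta>)\<close>; let \<open>G\<close> be the group of these \<open>p\<^sup>4\<close> translations. Restrict an invariant \<open>h\<close> to the
  line \<open>x = 1, z = 0\<close>, giving a polynomial \<open>r\<close> in one variable. For \<open>g \<noteq> 0\<close> in \<open>G\<close> the line meets its
  translate by \<open>g\<close> in one point, and the points belonging to \<open>g\<close> and \<open>-g\<close> lie in one orbit, so
  \<open>r\<close> takes the same value at both; the derivative of the polynomial vanishing at all these
  \<open>p\<^sup>4 - 1\<close> points takes opposite values there. Hence Lagrange's formula for the coefficient of \<open>r\<close>
  in degree \<open>p\<^sup>4 - 2\<close> is a sum that cancels in pairs, and \<open>r\<close> never has degree \<open>p\<^sup>4 - 2\<close>.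

  The restrictions of \<open>f\<^sub>1, f\<^sub>2, f\<^sub>3\<close> have degrees \<open>p\<^sup>2\<close>, \<open>p\<^sup>2 + 2p\<close>, \<open>p\<^sup>3 + 2\<close>, which generate a symmetric
  semigroup with Frobenius number \<open>p\<^sup>4 - 2\<close>. If the degree of \<open>r\<close> were a gap, multiplying \<open>h\<close> by a
  suitable monomial in the \<open>f\<^sub>i\<close> would give an invariant whose restriction has degree \<open>p\<^sup>4 - 2\<close>. So the
  degree of \<open>r\<close> lies in the semigroup, and subtracting multiples of monomials in \<open>x, f\<^sub>1, f\<^sub>2, f\<^sub>3\<close>
  lowers it until \<open>r = 0\<close>. Then \<open>z\<close>, hence the norm of \<open>z\<close>, divides \<open>h\<close>, and induction on the degree
  writes \<open>h\<close> as a combination of monomials in the generators with exponents of \<open>f\<^sub>2\<close> and \<open>f\<^sub>3\<close> below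
  \<open>p\<close>. These monomials have distinct lead monomials, which gives the SAGBI property, the
  termination of all subductions at zero, and the presentation.
\<close>

text \<open>The argument sees \<open>f1\<close>, \<open>f2\<close>, \<open>f3\<close> only through
  invariance, homogeneity and lead monomial. The obstacle is that \<open>f2\<close> and
  \<open>f3\<close> are defined by division by powers of x, so divisibility and lead terms have to
  be proved. Since x is the smallest variable, a multiple of x lies below the power of y of the same
  degree, and a lead term that is a power of y can be read off modulo x. The constants \<alpha>_i
  are tuned to this: they remove the terms of \<open>f3_tilde\<close> of low order in x, the
  cancellations being Pluecker relations among the minors, whose p-th powers are again minors, two
  rows further down. What survives at x^(2p^2-2) is a multiple of \<gamma>_1357. The minors 1234,
  1235 and 1357 are nonzero because specialising the matrix to 0 and powers of one indeterminate T
  turns them into products of differences of powers T^(p^m). The number p^4 - 2 enters twice, for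
  different reasons: it is one less than the number of points, hence the degree whose coefficient
  interpolation computes, and it is the constant of the reflection n -> p^4 - 2 - n of the
  semigroup. The proof works because the two agree.\<close>

abbreviation (input) "keys \<equiv> Poly_Mapping.keys"
abbreviation (input) "lookup \<equiv> Poly_Mapping.lookup"
abbreviation (input) "single \<equiv> Poly_Mapping.single"

section \<open>Evaluation homomorphisms\<close>

lemma sum_single_lookup:
  fixes f :: "'m \<Rightarrow>\<^sub>0 'a::comm_monoid_add"
  shows "(\<Sum>u\<in>keys f. single u (lookup f u)) = f"
proof (rule poly_mapping_eqI)
  fix k
  have "lookup (\<Sum>u\<in>keys f. single u (lookup f u)) k = (\<Sum>u\<in>keys f. (if u = k then lookup f u else 0))"
    by (simp add: lookup_sum lookup_single when_def cong: if_cong)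
  then show "lookup (\<Sum>u\<in>keys f. single u (lookup f u)) k = lookup f k"
    by (simp add: sum.delta in_keys_iff)
qed

lemma poly_mapping_induct_single [case_names single add]:
  fixes f :: "'m \<Rightarrow>\<^sub>0 'a::comm_monoid_add"
  assumes "\<And>u c. P (single u c)" and "\<And>f g. P f \<Longrightarrow> P g \<Longrightarrow> P (f + g)"
  shows "P f"
proof -
  have "P (\<Sum>u\<in>A. single u (lookup f u))" if "finite A" for A
    using that
  proof (induction A rule: finite_induct)
    case empty
    \<comment> \<open>The empty sum is itself a single term, \<open>single u 0\<close>.\<close>
    then show ?case using assms(1)[of undefined 0] by simp
  qed (use assms in auto)
  from this[of "keys f"] show ?thesis by (simp add: sum_single_lookup)
qed

definition mon :: "('v \<Rightarrow> 'b::comm_ring_1) \<Rightarrow> ('v \<Rightarrow>\<^sub>0 nat) \<Rightarrow> 'b" where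
  "mon h u = (\<Prod>v\<in>keys u. h v ^ lookup u v)"

lemma mon_eq_prod:
  assumes "finite S" "keys u \<subseteq> S"
  shows "mon h u = (\<Prod>v\<in>S. h v ^ lookup u v)"
  unfolding mon_def using assms by (intro prod.mono_neutral_left) (auto simp: in_keys_iff)

lemma mon_zero [simp]: "mon h 0 = 1"
  by (simp add: mon_def)

lemma mon_add: "mon h (u + w) = mon h u * mon h w"
proof -
  let ?S = "keys u \<union> keys w"
  have "mon h (u + w) = (\<Prod>v\<in>?S. h v ^ lookup (u + w) v)"
    by (rule mon_eq_prod) (auto simp: keys_add)
  also have "\<dots> = (\<Prod>v\<in>?S. h v ^ lookup u v) * (\<Prod>v\<in>?S. h v ^ lookup w v)"
    by (simp add: lookup_add power_add prod.distrib)
  also have "\<dots> = mon h u * mon h w"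
    by (subst (1 2) mon_eq_prod[symmetric]) auto
  finally show ?thesis .
qed

lemma mon_single [simp]: "mon h (single v n) = h v ^ n"
  by (cases "n = 0") (simp_all add: mon_def)

text \<open>Allowing a homomorphism \<phi> on the coefficients lets one construction serve for
  substitution, for restriction to the line and for specialising the generic matrix.\<close>

definition ev :: "('a::comm_ring_1 \<Rightarrow> 'b::comm_ring_1) \<Rightarrow> ('v \<Rightarrow> 'b) \<Rightarrow> ('v, 'a) mpoly \<Rightarrow> 'b" where
  "ev \<phi> h f = (\<Sum>u\<in>keys f. \<phi> (lookup f u) * mon h u)"

lemma subst_eq_ev: "subst h = ev Const h"
  by (simp add: subst_def ev_def mon_def fun_eq_iff)

lemma ev_eq_sum:
  assumes "comm_ring_hom \<phi>" "finite S" "keys f \<subseteq> S"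
  shows "ev \<phi> h f = (\<Sum>u\<in>S. \<phi> (lookup f u) * mon h u)"
proof -
  interpret comm_ring_hom \<phi> by fact
  show ?thesis unfolding ev_def using assms(2,3)
    by (intro sum.mono_neutral_left) (auto simp: in_keys_iff)
qed

lemma ev_single:
  assumes "comm_ring_hom \<phi>"
  shows "ev \<phi> h (single u c) = \<phi> c * mon h u"
proof -
  interpret comm_ring_hom \<phi> by fact
  show ?thesis by (cases "c = 0") (simp_all add: ev_def)
qed

lemma ev_add:
  assumes "comm_ring_hom \<phi>"
  shows "ev \<phi> h (f + g) = ev \<phi> h f + ev \<phi> h g"
proof -
  interpret comm_ring_hom \<phi> by fact
  let ?S = "keys f \<union> keys g"
  have "ev \<phi> h (f + g) = (\<Sum>u\<in>?S. \<phi> (lookup (f + g) u) * mon h u)"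
    using keys_add[of f g] by (intro ev_eq_sum assms) auto
  also have "\<dots> = (\<Sum>u\<in>?S. \<phi> (lookup f u) * mon h u) + (\<Sum>u\<in>?S. \<phi> (lookup g u) * mon h u)"
    by (simp add: lookup_add hom_add distrib_right sum.distrib)
  also have "\<dots> = ev \<phi> h f + ev \<phi> h g"
    by (subst (1 2) ev_eq_sum[OF assms, symmetric]) auto
  finally show ?thesis .
qed

lemma ev_mult:
  assumes "comm_ring_hom \<phi>"
  shows "ev \<phi> h (f * g) = ev \<phi> h f * ev \<phi> h g"
proof -
  interpret comm_ring_hom \<phi> by fact
  show ?thesis
  proof (induction f rule: poly_mapping_induct_single)
    case (single u c)
    show ?case
    proof (induction g rule: poly_mapping_induct_single)
      case (single w d)
      show ?case
        by (simp add: mult_single ev_single[OF assms] hom_mult mon_add mult_ac)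
    qed (simp add: distrib_left ev_add[OF assms])
  qed (simp add: distrib_right ev_add[OF assms])
qed

lemma ev_hom:
  assumes "comm_ring_hom \<phi>"
  shows "comm_ring_hom (ev \<phi> h)"
proof -
  interpret comm_ring_hom \<phi> by fact
  have one: "ev \<phi> h 1 = 1"
    using ev_single[OF assms, of h 0 1] by simp
  have zero: "ev \<phi> h 0 = 0"
    by (simp add: ev_def)
  show ?thesis
    by unfold_locales (simp_all add: one zero ev_add[OF assms] ev_mult[OF assms])
qed

lemma comm_ring_hom_Const: "comm_ring_hom Const"
  by unfold_locales (simp_all add: Const_def single_add mult_single)

interpretation Const: comm_ring_hom Const
  by (rule comm_ring_hom_Const)

lemma Const_numeral [simp]: "Const (numeral n) = numeral n"
  by (metis Const.hom_of_nat of_nat_numeral)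

lemma Const_eq_iff [simp]: "Const a = Const b \<longleftrightarrow> a = b"
  by (auto simp: Const_def dest: arg_cong[of _ _ "\<lambda>f. lookup f 0"])

lemma Const_eq_0_iff [simp]: "Const a = 0 \<longleftrightarrow> a = 0"
  by (metis Const.hom_zero Const_eq_iff)

lemma ev_Const [simp]: "comm_ring_hom \<phi> \<Longrightarrow> ev \<phi> h (Const c) = \<phi> c"
  by (simp add: Const_def ev_single)

lemma ev_Var [simp]: "comm_ring_hom \<phi> \<Longrightarrow> ev \<phi> h (Var v) = h v"
  by (simp add: Var_def ev_single comm_ring_hom_def semiring_hom_def ring_hom_def
        comm_semiring_hom_def monoid_mult_hom_def one_hom_def)

lemma mon_Var: "mon Var u = (single u 1 :: ('v, 'a::comm_ring_1) mpoly)"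
proof -
  have *: "(Var v :: ('v, 'a) mpoly) ^ n = single (single v n) 1" for v n
    by (induction n) (simp_all add: Var_def mult_single single_add[symmetric])
  have "(\<Prod>v\<in>A. single (single v (lookup u v)) (1::'a)) = single (\<Sum>v\<in>A. single v (lookup u v)) 1"
    if "finite A" for A
    using that by (induction A rule: finite_induct) (simp_all add: mult_single)
  then show ?thesis
    by (simp add: mon_def * sum_single_lookup)
qed

lemma single_eq_Const_mon: "single u c = Const c * mon Var u"
  by (simp add: mon_Var Const_def mult_single)

text \<open>Reduces identities between compositions of shifts to a check on three variables.\<close>

lemma mpoly_hom_eqI:
  fixes \<phi> \<psi> :: "('v, 'a::comm_ring_1) mpoly \<Rightarrow> 'b::comm_ring_1"
  assumes "comm_ring_hom \<phi>" "comm_ring_hom \<psi>"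
    and "\<And>c. \<phi> (Const c) = \<psi> (Const c)" and "\<And>v. \<phi> (Var v) = \<psi> (Var v)"
  shows "\<phi> f = \<psi> f"
proof -
  interpret p: comm_ring_hom \<phi> by fact
  interpret q: comm_ring_hom \<psi> by fact
  have "\<phi> (mon Var u) = \<psi> (mon Var u)" for u
    by (simp add: mon_def p.hom_prod q.hom_prod p.hom_power q.hom_power assms)
  then show ?thesis
    by (induction f rule: poly_mapping_induct_single)
       (simp_all add: single_eq_Const_mon p.hom_mult q.hom_mult p.hom_add q.hom_add assms)
qed

lemma subst_hom: "comm_ring_hom (subst h)"
  unfolding subst_eq_ev by (rule ev_hom[OF comm_ring_hom_Const])

interpretation subst: comm_ring_hom "subst h" for h
  by (rule subst_hom)

lemma subst_Const [simp]: "subst h (Const c) = Const c"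
  and subst_Var [simp]: "subst h (Var v) = h v"
  unfolding subst_eq_ev by (simp_all add: comm_ring_hom_Const)

section \<open>Homogeneous polynomials\<close>

lemma UNIV_var: "UNIV = {Vx, Vy, Vz}"
  using var.exhaust by blast

lemma tdeg_zero [simp]: "tdeg 0 = 0"
  and tdeg_add: "tdeg (u + v) = tdeg u + tdeg v"
  by (simp_all add: tdeg_def lookup_add)

lemma tdeg_single: "tdeg (single v n) = n"
  by (cases v) (simp_all add: tdeg_def lookup_single)

definition homog :: "nat \<Rightarrow> (var, 'a::comm_ring_1) mpoly \<Rightarrow> bool" where
  "homog d f \<longleftrightarrow> (\<forall>u\<in>keys f. tdeg u = d)"

lemma homog_0 [simp]: "homog d 0"
  by (simp add: homog_def)

lemma homog_add: "homog d f \<Longrightarrow> homog d g \<Longrightarrow> homog d (f + g)"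
  using keys_add[of f g] by (auto simp: homog_def)

lemma keys_uminus [simp]: "keys (- f) = keys (f :: 'm \<Rightarrow>\<^sub>0 'a::ab_group_add)"
  by (auto simp: in_keys_iff)

lemma homog_uminus: "homog d f \<Longrightarrow> homog d (- f)"
  by (simp add: homog_def)

lemma homog_diff: "homog d f \<Longrightarrow> homog d g \<Longrightarrow> homog d (f - g)"
  using homog_add[of d f "- g"] by (simp add: homog_uminus)

lemma homog_mult: "homog d f \<Longrightarrow> homog e g \<Longrightarrow> homog (d + e) (f * g)"
  using keys_mult[of f g] by (fastforce simp: homog_def tdeg_add)

lemma homog_single: "homog (tdeg u) (single u c)"
  by (auto simp: homog_def)

lemma homog_Const: "homog 0 (Const c)"
  using homog_single[of 0] by (simp add: Const_def)

lemma homog_one: "homog 0 1"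
  using homog_Const[of 1] by simp

lemma homog_Var: "homog 1 (Var v)"
  using homog_single[of "single v 1"] by (simp add: Var_def tdeg_single)

lemma homog_power: "homog d f \<Longrightarrow> homog (n * d) (f ^ n)"
  by (induction n) (auto intro: homog_mult homog_one)

lemma homog_sum: "(\<And>i. i \<in> A \<Longrightarrow> homog d (f i)) \<Longrightarrow> homog d (sum f A)"
  by (induction A rule: infinite_finite_induct) (auto intro: homog_add)

lemma homog_prod: "(\<And>i. i \<in> A \<Longrightarrow> homog (d i) (f i)) \<Longrightarrow> homog (sum d A) (prod f A)"
  by (induction A rule: infinite_finite_induct) (auto intro: homog_mult homog_one)

lemma homog_Const_mult: "homog d f \<Longrightarrow> homog d (Const c * f)"
  using homog_mult[OF homog_Const] by force

definition hcomp :: "nat \<Rightarrow> (var, 'a::comm_ring_1) mpoly \<Rightarrow> (var, 'a) mpoly" where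
  "hcomp d f = (\<Sum>u\<in>{u\<in>keys f. tdeg u = d}. single u (lookup f u))"

lemma homog_hcomp: "homog d (hcomp d f)"
  unfolding hcomp_def using homog_single by (intro homog_sum) blast

lemma lookup_hcomp: "lookup (hcomp d f) u = (if tdeg u = d then lookup f u else 0)"
proof -
  have "lookup (hcomp d f) u = (\<Sum>w\<in>{w\<in>keys f. tdeg w = d}. if w = u then lookup f w else 0)"
    by (simp add: hcomp_def lookup_sum lookup_single when_def cong: if_cong)
  then show ?thesis by (simp add: sum.delta in_keys_iff)
qed

lemma hcomp_homog: "homog e f \<Longrightarrow> hcomp d f = (if d = e then f else 0)"
  by (rule poly_mapping_eqI) (auto simp: lookup_hcomp homog_def in_keys_iff)

lemma hcomp_add: "hcomp d (f + g) = hcomp d f + hcomp d g"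
  by (rule poly_mapping_eqI) (simp add: lookup_hcomp lookup_add)

lemma hcomp_sum: "hcomp d (sum f A) = (\<Sum>i\<in>A. hcomp d (f i))"
proof (induction A rule: infinite_finite_induct)
  case empty
  show ?case by (rule poly_mapping_eqI) (simp add: lookup_hcomp)
next
  case (infinite A)
  then show ?case by (intro poly_mapping_eqI) (simp add: lookup_hcomp)
qed (simp add: hcomp_add)

lemma sum_hcomp: "(\<Sum>d\<in>tdeg ` keys f. hcomp d f) = f"
  by (rule poly_mapping_eqI)
     (auto simp: lookup_sum lookup_hcomp sum.delta' in_keys_iff image_iff)

lemma hcomp_mult_homog:
  assumes "homog d g"
  shows "hcomp (d + e) (g * f) = g * hcomp e f"
proof -
  have "hcomp (d + e) (g * f) = (\<Sum>i\<in>tdeg ` keys f. hcomp (d + e) (g * hcomp i f))"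
    by (subst (1) sum_hcomp[of f, symmetric]) (simp add: sum_distrib_left hcomp_sum)
  also have "\<dots> = (\<Sum>i\<in>tdeg ` keys f. if i = e then g * hcomp e f else 0)"
    by (intro sum.cong refl) (simp add: hcomp_homog[OF homog_mult[OF assms homog_hcomp]])
  also have "\<dots> = g * hcomp e f"
  proof (cases "e \<in> tdeg ` keys f")
    case False
    then have "hcomp e f = 0"
      by (intro poly_mapping_eqI) (auto simp: lookup_hcomp in_keys_iff image_iff)
    with False show ?thesis by (simp add: sum.delta)
  qed (simp add: sum.delta)
  finally show ?thesis .
qed

text \<open>Multiplication by a homogeneous g shifts components without mixing them, and in a domain
  it kills none; this gives the degrees of the exact quotients \<open>f2\<close> and
  \<open>f3\<close>.\<close>

lemma homog_cancel:
  fixes f g :: "(var, 'a::idom) mpoly"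
  assumes "homog d g" "g \<noteq> 0" "homog (d + e) (g * f)"
  shows "homog e f"
proof -
  have "hcomp i f = 0" if "i \<noteq> e" for i
  proof -
    have "g * hcomp i f = hcomp (d + i) (g * f)"
      by (simp add: hcomp_mult_homog[OF assms(1)])
    also have "\<dots> = 0"
      using that by (simp add: hcomp_homog[OF assms(3)])
    finally show ?thesis using assms(2) by simp
  qed
  then have "lookup f u = 0" if "tdeg u \<noteq> e" for u
    using that lookup_hcomp[of "tdeg u" f u] by simp
  then show ?thesis by (auto simp: homog_def in_keys_iff)
qed

lemma homog_subst:
  assumes "\<And>v. homog 1 (h v)" "homog d f"
  shows "homog d (subst h f)"
proof -
  have *: "homog (tdeg u) (mon h u)" for u
  proof -
    have fin: "finite (UNIV :: var set)"
      by (simp add: UNIV_var)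
    have "homog (\<Sum>v\<in>UNIV. lookup u v * 1) (\<Prod>v\<in>UNIV. h v ^ lookup u v)"
      by (intro homog_prod homog_power assms)
    moreover have "(\<Sum>v\<in>UNIV. lookup u v * 1) = tdeg u"
      by (simp add: UNIV_var tdeg_def)
    ultimately show ?thesis
      by (simp add: mon_eq_prod[OF fin])
  qed
  have "homog d (Const (lookup f u) * mon h u)" if "u \<in> keys f" for u
    using that assms(2) *[of u] by (auto simp: homog_def[of d f] intro: homog_Const_mult)
  then show ?thesis
    unfolding subst_eq_ev ev_def by (intro homog_sum)
qed

section \<open>Monomial orders\<close>

text \<open>Two orders are instances: grevlex on exponents of x, y, z, and an order on exponents of
  the presentation variables. The latter is total only on exponents supported on the five variables
  in use, hence the set \<open>M\<close>.\<close>

locale monomial_order =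
  fixes less :: "'m::cancel_comm_monoid_add \<Rightarrow> 'm \<Rightarrow> bool" (infix "\<prec>" 50) and M :: "'m set"
  assumes irrefl: "\<not> u \<prec> u"
    and trans: "u \<prec> v \<Longrightarrow> v \<prec> w \<Longrightarrow> u \<prec> w"
    and total: "u \<in> M \<Longrightarrow> v \<in> M \<Longrightarrow> u \<noteq> v \<Longrightarrow> u \<prec> v \<or> v \<prec> u"
    and add_mono: "u \<prec> v \<Longrightarrow> u + w \<prec> v + w"
begin

definition below :: "'m \<Rightarrow> ('m \<Rightarrow>\<^sub>0 'a::idom) \<Rightarrow> bool" where
  "below u f \<longleftrightarrow> (\<forall>k\<in>keys f. k \<prec> u)"

text \<open>As a relation with explicit exponent and coefficient it passes through sums and products
  directly, without the definite description in \<open>lead_exp\<close>.\<close>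

definition lead :: "('m \<Rightarrow>\<^sub>0 'a::idom) \<Rightarrow> 'm \<Rightarrow> 'a \<Rightarrow> bool" where
  "lead f u c \<longleftrightarrow> c \<noteq> 0 \<and> below u (f - single u c)"

lemma below_0 [simp]: "below u 0"
  by (simp add: below_def)

lemma below_add: "below u f \<Longrightarrow> below u g \<Longrightarrow> below u (f + g)"
  using keys_add[of f g] by (auto simp: below_def)

lemma below_uminus: "below u f \<Longrightarrow> below u (- f)"
  by (simp add: below_def)

lemma below_diff: "below u f \<Longrightarrow> below u g \<Longrightarrow> below u (f - g)"
  using below_add[of u f "- g"] by (simp add: below_uminus)

lemma below_sum: "(\<And>i. i \<in> A \<Longrightarrow> below u (f i)) \<Longrightarrow> below u (sum f A)"
  by (induction A rule: infinite_finite_induct) (auto intro: below_add)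

lemma below_less: "below u f \<Longrightarrow> u \<prec> v \<Longrightarrow> below v f"
  using trans by (auto simp: below_def)

lemma below_single: "u \<prec> v \<Longrightarrow> below v (single u c)"
  by (simp add: below_def)

lemma below_mult:
  assumes "below u f" "below w g"
  shows "below (u + w) (f * g)"
  unfolding below_def
proof
  fix k assume "k \<in> keys (f * g)"
  then obtain a b where k: "k = a + b" "a \<in> keys f" "b \<in> keys g"
    using keys_mult[of f g] by auto
  have "a + b \<prec> u + b" using k assms by (auto simp: below_def intro: add_mono)
  moreover have "u + b \<prec> u + w" using k assms add_mono[of b w u]
    by (auto simp: below_def add.commute)
  ultimately show "k \<prec> u + w" using k trans by blast
qed

lemma below_single_mult:
  assumes "below w g"
  shows "below (u + w) (single u c * g)"
  unfolding below_def
proof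
  fix k assume "k \<in> keys (single u c * g)"
  then obtain b where "k = u + b" "b \<in> keys g"
    using keys_mult[of "single u c" g] by (auto split: if_splits)
  then show "k \<prec> u + w"
    using assms add_mono[of b w u] by (auto simp: below_def add.commute)
qed

lemma lead_lookup: "lead f u c \<Longrightarrow> lookup f u = c"
proof -
  assume "lead f u c"
  then have "u \<notin> keys (f - single u c)"
    using irrefl by (auto simp: lead_def below_def)
  then show ?thesis by (simp add: in_keys_iff lookup_minus)
qed

lemma lead_nonzero:
  assumes "lead f u c"
  shows "c \<noteq> 0" "f \<noteq> 0"
  using lead_lookup[OF assms] assms by (auto simp: lead_def)

lemma lead_less:
  assumes "lead f u c" "v \<in> keys f"
  shows "v = u \<or> v \<prec> u"
proof (cases "v = u")
  case False
  then have "v \<in> keys (f - single u c)"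
    using assms(2) by (simp add: in_keys_iff lookup_minus lookup_single)
  then show ?thesis using assms(1) by (auto simp: lead_def below_def)
qed simp

lemma lead_in_keys: "lead f u c \<Longrightarrow> u \<in> keys f"
  by (simp add: in_keys_iff lead_lookup lead_nonzero)

lemma lead_unique:
  assumes "lead f u c" "lead f w d"
  shows "u = w" "c = d"
proof -
  show "u = w"
    using lead_less[OF assms(1) lead_in_keys[OF assms(2)]]
      lead_less[OF assms(2) lead_in_keys[OF assms(1)]] trans irrefl by blast
  then show "c = d" using assms lead_lookup by blast
qed

lemma lead_single: "c \<noteq> 0 \<Longrightarrow> lead (single u c) u c"
  by (simp add: lead_def)

lemma lead_add_below: "lead f u c \<Longrightarrow> below u g \<Longrightarrow> lead (f + g) u c"
  using below_add[of u "f - single u c" g] by (simp add: lead_def algebra_simps)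

lemma lead_below: "lead f u c \<Longrightarrow> u \<prec> v \<Longrightarrow> below v f"
  using below_add[of v "f - single u c" "single u c"]
  by (auto simp: lead_def intro: below_less below_single)

lemma lead_mult:
  assumes "lead f u c" "lead g w d"
  shows "lead (f * g) (u + w) (c * d)"
proof -
  define f' g' where "f' = f - single u c" and "g' = g - single w d"
  have f: "f = single u c + f'" and g: "g = single w d + g'"
    by (simp_all add: f'_def g'_def)
  have below: "below u f'" "below w g'"
    using assms by (simp_all add: lead_def f'_def g'_def)
  have "f * g - single (u + w) (c * d) = single u c * g' + single w d * f' + f' * g'"
    unfolding f g by (simp add: algebra_simps mult_single)
  moreover have "below (u + w) (single u c * g' + single w d * f' + f' * g')"
    using below_single_mult[OF below(2), of u c] below_single_mult[OF below(1), of w d]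
      below_mult[OF below] by (auto intro!: below_add simp: add.commute)
  ultimately show ?thesis
    using assms by (simp add: lead_def)
qed

lemma lead_1: "lead (1 :: 'm \<Rightarrow>\<^sub>0 'a::idom) 0 1"
  using lead_single[of 1 0] by simp

lemma lead_prod:
  assumes "finite A" "\<And>i. i \<in> A \<Longrightarrow> lead (f i) (u i) (c i)"
  shows "lead (prod f A) (sum u A) (prod c A)"
  using assms by (induction A rule: finite_induct) (auto intro: lead_mult lead_1)

lemma finite_has_max:
  assumes "finite A" "A \<noteq> {}" "A \<subseteq> M"
  obtains u where "u \<in> A" "\<And>v. v \<in> A \<Longrightarrow> v \<noteq> u \<Longrightarrow> v \<prec> u"
proof -
  have "\<exists>u\<in>A. \<forall>v\<in>A. v \<noteq> u \<longrightarrow> v \<prec> u"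
    using assms
  proof (induction A rule: finite_ne_induct)
    case (insert x F)
    then obtain u where u: "u \<in> F" "\<And>v. v \<in> F \<Longrightarrow> v \<noteq> u \<Longrightarrow> v \<prec> u" by auto
    have "x \<noteq> u" using insert u by auto
    then consider "x \<prec> u" | "u \<prec> x" using total[of x u] insert u by auto
    then show ?case
    proof cases
      case 1
      then show ?thesis using u by auto
    next
      case 2
      then have "v \<prec> x" if "v \<in> F" for v
        using u(2)[OF that] trans by blast
      then show ?thesis by auto
    qed
  qed simp
  then show ?thesis using that by blast
qed

lemma lead_exists:
  assumes "f \<noteq> 0" "keys f \<subseteq> M"
  obtains u c where "lead f u c" "u \<in> keys f"
proof -
  obtain u where u: "u \<in> keys f" "\<And>v. v \<in> keys f \<Longrightarrow> v \<noteq> u \<Longrightarrow> v \<prec> u"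
    using finite_has_max[of "keys f"] assms
    by (metis finite_keys in_keys_iff lookup_zero poly_mapping_eqI empty_iff)
  have "keys (f - single u (lookup f u)) \<subseteq> keys f - {u}"
    by (auto simp: in_keys_iff lookup_minus lookup_single when_def split: if_splits)
  then have "lead f u (lookup f u)"
    using u by (auto simp: lead_def below_def in_keys_iff)
  then show ?thesis using that u by blast
qed

text \<open>The largest of the pairwise distinct lead exponents cannot be cancelled by the other
  summands.\<close>

lemma lead_sum_distinct:
  assumes "finite A" "A \<noteq> {}" "\<And>i. i \<in> A \<Longrightarrow> lead (f i) (u i) (c i)"
    and "inj_on u A" "u ` A \<subseteq> M"
  obtains i where "i \<in> A" "lead (sum f A) (u i) (c i)"
proof -
  obtain w where w: "w \<in> u ` A" "\<And>v. v \<in> u ` A \<Longrightarrow> v \<noteq> w \<Longrightarrow> v \<prec> w"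
    using finite_has_max[of "u ` A"] assms by auto
  then obtain i where i: "i \<in> A" "w = u i" by auto
  have "below (u i) (f j)" if "j \<in> A - {i}" for j
  proof -
    have "u j \<noteq> u i" using that i assms(4) by (auto dest: inj_onD)
    then show ?thesis using that w(2)[of "u j"] i assms(3)[of j] lead_below by auto
  qed
  then have "lead (f i + sum f (A - {i})) (u i) (c i)"
    using i assms(3) by (intro lead_add_below below_sum) auto
  then show ?thesis
    using that[OF i(1)] i(1) assms(1) by (simp add: sum.remove)
qed

lemma below_diff_lead:
  assumes "lead f u c" "lead g u c"
  shows "below u (f - g)"
  using below_diff[of u "f - single u c" "g - single u c"] assms by (simp add: lead_def)

end

lemma var_exp_eqI:
  assumes "lookup u Vx = lookup v Vx" "lookup u Vy = lookup v Vy" "lookup u Vz = lookup v Vz"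
  shows "u = v"
proof (rule poly_mapping_eqI)
  show "lookup u k = lookup v k" for k using assms by (cases k) auto
qed

interpretation grevlex: monomial_order grevlex_less UNIV
proof
  fix u v w
  show "u \<noteq> v \<Longrightarrow> grevlex_less u v \<or> grevlex_less v u"
    using var_exp_eqI[of u v] unfolding grevlex_less_def tdeg_def by linarith
qed (auto simp: grevlex_less_def tdeg_add lookup_add)

text \<open>In equal degree a larger exponent of x means a smaller sum of those of y and z, and then
  a larger exponent of y means a smaller one of z. So the reversed comparisons become descending
  natural numbers.\<close>

lemma wfp_grevlex: "wfp grevlex_less"
proof -
  have "{(u, v). grevlex_less u v} \<subseteq> inv_image (less_than <*lex*> less_than <*lex*> less_than)
      (\<lambda>u. (tdeg u, lookup u Vy + lookup u Vz, lookup u Vz))"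
    by (auto simp: grevlex_less_def tdeg_def)
  moreover have "wf \<dots>"
    by (intro wf_inv_image wf_lex_prod wf_less_than)
  ultimately show ?thesis
    unfolding wfp_def by (rule wf_subset[rotated])
qed

lemma lead_exp_eq: "grevlex.lead f u c \<Longrightarrow> lead_exp f = u"
  unfolding lead_exp_def
proof (rule the_equality)
  assume lead: "grevlex.lead f u c"
  show "u \<in> keys f \<and> (\<forall>v\<in>keys f. v = u \<or> grevlex_less v u)"
    using grevlex.lead_in_keys[OF lead] grevlex.lead_less[OF lead] by auto
  fix w assume "w \<in> keys f \<and> (\<forall>v\<in>keys f. v = w \<or> grevlex_less v w)"
  then show "w = u"
    using grevlex.lead_in_keys[OF lead] grevlex.lead_less[OF lead]
    by (metis grevlex.trans grevlex.irrefl)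
qed

lemma LM_eq: "grevlex.lead f u c \<Longrightarrow> LM f = single u 1"
  by (simp add: LM_def lead_exp_eq)

lemma LT_eq: "grevlex.lead f u c \<Longrightarrow> LT f = single u c"
  by (simp add: LT_def lead_exp_eq grevlex.lead_lookup)

lemma LT_0 [simp]: "LT 0 = 0"
  by (simp add: LT_def)

lemma obtain_lead:
  fixes f :: "(var, 'a::idom) mpoly"
  assumes "f \<noteq> 0"
  obtains u c where "grevlex.lead f u c"
  using grevlex.lead_exists[of f] assms by blast

lemma single_eq_0_iff: "single u c = 0 \<longleftrightarrow> c = 0"
  by (metis lookup_single_eq lookup_zero single_zero)

lemma single_eq_iff: "c \<noteq> 0 \<Longrightarrow> single u c = single v d \<longleftrightarrow> u = v \<and> c = d"
  by (metis lookup_single_eq lookup_single_not_eq)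

lemma LT_eq_iff_lead:
  fixes f g :: "(var, 'a::idom) mpoly"
  assumes "f \<noteq> 0" "LT f = LT g"
  obtains u c where "grevlex.lead f u c" "grevlex.lead g u c"
proof -
  obtain u c where f: "grevlex.lead f u c" using obtain_lead assms(1) by blast
  then have "c \<noteq> 0" by (rule grevlex.lead_nonzero)
  then have LT: "single u c = LT g" "single u c \<noteq> 0"
    using LT_eq[OF f] assms(2) by (auto simp: single_eq_0_iff)
  then have "g \<noteq> 0" by auto
  then obtain v d where g: "grevlex.lead g v d" using obtain_lead by blast
  with LT \<open>c \<noteq> 0\<close> have "u = v \<and> c = d"
    by (simp add: LT_eq[OF g] single_eq_iff)
  with f g that show ?thesis by blast
qed

text \<open>Among monomials of degree s, those divisible by x are below y^s. Hence a residue c y^s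
  modulo x already determines the lead term.\<close>

lemma lead_homog_mod_x:
  fixes w :: "(var, 'a::idom) mpoly"
  assumes "homog s (Const c * Var Vy ^ s + Var Vx * w)" "c \<noteq> 0"
  shows "grevlex.lead (Const c * Var Vy ^ s + Var Vx * w) (single Vy s) c"
proof -
  have y: "Const c * Var Vy ^ s = (single (single Vy s) c :: (var, 'a) mpoly)"
    by (simp add: single_eq_Const_mon)
  have "homog s (Var Vx * w)"
    using homog_diff[OF assms(1), of "Const c * Var Vy ^ s"] homog_single[of "single Vy s" c]
    by (simp add: y tdeg_single)
  then have "tdeg u = s \<and> lookup u Vx > 0" if "u \<in> keys (Var Vx * w)" for u
    using that keys_mult[of "Var Vx" w]
    by (auto simp: homog_def Var_def lookup_add)
  then have "grevlex.below (single Vy s) (Var Vx * w)"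
    by (auto simp: grevlex.below_def grevlex_less_def tdeg_single lookup_single)
  then show ?thesis
    using grevlex.lead_single[OF assms(2)] by (simp add: y grevlex.lead_add_below)
qed

lemma lead_Var: "grevlex.lead (Var v :: (var, 'a::idom) mpoly) (single v 1) 1"
  by (simp add: Var_def grevlex.lead_single)

lemma lead_Const_mult: "c \<noteq> 0 \<Longrightarrow> grevlex.lead f u d \<Longrightarrow> grevlex.lead (Const c * f) u (c * d)"
  using grevlex.lead_mult[OF grevlex.lead_single[of c 0]] by (simp add: Const_def)

section \<open>The shift action and restriction to a line\<close>

text \<open>The coefficient s^2 + t is the one for which y^2 - x z goes to y^2 - x z - t x^2. In
  these coordinates shifts compose by adding the pairs (s, t).\<close>

definition shift :: "'a::comm_ring_1 \<Rightarrow> 'a \<Rightarrow> (var, 'a) mpoly \<Rightarrow> (var, 'a) mpoly" where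
  "shift s t = subst (\<lambda>v. case v of
       Vx \<Rightarrow> Var Vx
     | Vy \<Rightarrow> Var Vy + Const s * Var Vx
     | Vz \<Rightarrow> Var Vz + Const (2 * s) * Var Vy + Const (s^2 + t) * Var Vx)"

interpretation shift: comm_ring_hom "shift s t" for s t
  unfolding shift_def by (rule subst_hom)

lemma shift_Const [simp]: "shift s t (Const c) = Const c"
  and shift_x [simp]: "shift s t (Var Vx) = Var Vx"
  and shift_y: "shift s t (Var Vy) = Var Vy + Const s * Var Vx"
  and shift_z: "shift s t (Var Vz) = Var Vz + Const (2 * s) * Var Vy + Const (s^2 + t) * Var Vx"
  by (simp_all add: shift_def)

lemma shift_numeral [simp]: "shift s t (numeral n) = numeral n"
  by (metis shift.hom_of_nat of_nat_numeral)

lemma comm_ring_hom_comp: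
  assumes "comm_ring_hom f" "comm_ring_hom g"
  shows "comm_ring_hom (\<lambda>x. f (g x))"
proof -
  interpret f: comm_ring_hom f by fact
  interpret g: comm_ring_hom g by fact
  show ?thesis
    by unfold_locales (simp_all add: f.hom_add f.hom_mult g.hom_add g.hom_mult)
qed

lemma comm_ring_hom_id: "comm_ring_hom (\<lambda>x. x)"
  by unfold_locales simp_all

lemma shift_shift: "shift s t (shift s' t' f) = shift (s + s') (t + t') f"
proof (rule mpoly_hom_eqI[where \<phi> = "\<lambda>f. shift s t (shift s' t' f)"])
  fix v
  show "shift s t (shift s' t' (Var v)) = shift (s + s') (t + t') (Var v)"
    by (cases v)
       (simp_all add: shift_y shift_z shift.hom_add shift.hom_mult Const.hom_add Const.hom_mult
         algebra_simps power2_eq_square)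
qed (simp_all add: comm_ring_hom_comp shift.comm_ring_hom_axioms)

lemma shift_0 [simp]: "shift 0 0 f = f"
proof (rule mpoly_hom_eqI[OF shift.comm_ring_hom_axioms comm_ring_hom_id])
  show "shift 0 0 (Var v) = Var v" for v
    by (cases v) (simp_all add: shift_y shift_z)
qed simp

lemma funpow_shift: "(shift s t ^^ n) f = shift (of_nat n * s) (of_nat n * t) f"
  by (induction n) (simp_all add: shift_shift algebra_simps)

lemma homog_shift: "homog d f \<Longrightarrow> homog d (shift s t f)"
  unfolding shift_def
proof (rule homog_subst)
  show "homog 1 (case v of
       Vx \<Rightarrow> Var Vx
     | Vy \<Rightarrow> Var Vy + Const s * Var Vx
     | Vz \<Rightarrow> Var Vz + Const (2 * s) * Var Vy + Const (s^2 + t) * Var Vx)" for v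
    by (cases v) (auto intro!: homog_add homog_Const_mult homog_Var[simplified])
qed

lemma hcomp_shift: "hcomp d (shift s t f) = shift s t (hcomp d f)"
proof -
  have "hcomp d (shift s t f) = (\<Sum>i\<in>tdeg ` keys f. hcomp d (shift s t (hcomp i f)))"
    by (subst (1) sum_hcomp[of f, symmetric]) (simp add: shift.hom_sum hcomp_sum)
  also have "\<dots> = (\<Sum>i\<in>tdeg ` keys f. if i = d then shift s t (hcomp d f) else 0)"
    by (intro sum.cong refl) (simp add: hcomp_homog[OF homog_shift[OF homog_hcomp]])
  also have "\<dots> = shift s t (hcomp d f)"
  proof (cases "d \<in> tdeg ` keys f")
    case False
    then have "hcomp d f = 0"
      by (intro poly_mapping_eqI) (auto simp: lookup_hcomp in_keys_iff image_iff)
    with False show ?thesis by (simp add: sum.delta)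
  qed (simp add: sum.delta)
  finally show ?thesis .
qed

section \<open>Restriction to the line x = 1, z = 0\<close>

definition restr :: "(var, 'a::comm_ring_1) mpoly \<Rightarrow> 'a poly" where
  "restr = ev (\<lambda>c. [:c:]) (\<lambda>v. case v of Vx \<Rightarrow> 1 | Vy \<Rightarrow> [:0, 1:] | Vz \<Rightarrow> 0)"

lemma comm_ring_hom_const_poly: "comm_ring_hom (\<lambda>c::'a::comm_ring_1. [:c:])"
  by unfold_locales (simp_all add: one_pCons)

interpretation restr: comm_ring_hom restr
  unfolding restr_def by (rule ev_hom[OF comm_ring_hom_const_poly])

lemma restr_Const [simp]: "restr (Const c) = [:c:]"
  and restr_x [simp]: "restr (Var Vx) = 1"
  and restr_y [simp]: "restr (Var Vy) = [:0, 1:]"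
  and restr_z [simp]: "restr (Var Vz) = 0"
  by (simp_all add: restr_def comm_ring_hom_const_poly)

text \<open>Homogeneity makes setting x = 1 harmless: the exponent of x is recovered from the
  degree, so each coefficient comes from one monomial.\<close>

lemma coeff_restr:
  assumes "homog D f"
  shows "coeff (restr f) b = (if b \<le> D then lookup f (single Vx (D - b) + single Vy b) else 0)"
proof -
  define e where "e = single Vx (D - b) + single Vy b"
  have mon: "mon (\<lambda>v. case v of Vx \<Rightarrow> 1 | Vy \<Rightarrow> [:0, 1:] | Vz \<Rightarrow> 0) u
      = (if lookup u Vz = 0 then monom (1::'a) (lookup u Vy) else 0)" for u
  proof -
    have fin: "finite (UNIV :: var set)"
      by (simp add: UNIV_var)
    show ?thesis
      unfolding mon_eq_prod[OF fin subset_UNIV] by (simp add: UNIV_var monom_altdef power_0_left)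
  qed
  have "coeff (restr f) b = (\<Sum>u\<in>keys f. lookup f u * (if lookup u Vz = 0 \<and> lookup u Vy = b then 1 else 0))"
    unfolding restr_def ev_def by (auto simp: coeff_sum mon intro!: sum.cong)
  also have "\<dots> = (\<Sum>u\<in>keys f. if u = e then (if b \<le> D then lookup f u else 0) else 0)"
  proof (intro sum.cong refl)
    fix u assume "u \<in> keys f"
    then have u: "tdeg u = D" using assms by (auto simp: homog_def)
    have "u = e \<longleftrightarrow> lookup u Vx = D - b \<and> lookup u Vy = b \<and> lookup u Vz = 0"
      using var_exp_eqI[of u e] by (auto simp: e_def lookup_add lookup_single)
    then have "u = e \<and> b \<le> D \<longleftrightarrow> lookup u Vz = 0 \<and> lookup u Vy = b"
      using u by (auto simp: tdeg_def)
    then show "lookup f u * (if lookup u Vz = 0 \<and> lookup u Vy = b then 1 else 0) =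
        (if u = e then (if b \<le> D then lookup f u else 0) else 0)"
      by auto
  qed
  also have "\<dots> = (if b \<le> D then lookup f e else 0)"
    by (simp add: sum.delta in_keys_iff)
  finally show ?thesis by (simp add: e_def)
qed

lemma degree_restr_le: "homog D f \<Longrightarrow> degree (restr f) \<le> D"
  by (rule degree_le) (simp add: coeff_restr)

lemma degree_restr:
  assumes "homog D f" "grevlex.lead f (single Vy D) c"
  shows "degree (restr f) = D" "lead_coeff (restr f) = c"
proof -
  have "coeff (restr f) D = c"
    using assms(2) by (simp add: coeff_restr[OF assms(1)] grevlex.lead_lookup)
  then show "degree (restr f) = D" "lead_coeff (restr f) = c"
    using degree_restr_le[OF assms(1)] grevlex.lead_nonzero(1)[OF assms(2)]
      le_degree[of "restr f" D] by auto
qed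

lemma Var_dvd:
  assumes "\<And>u. u \<in> keys f \<Longrightarrow> lookup u v > 0"
  shows "Var v dvd f"
proof -
  have "Var v dvd single u (lookup f u)" if "u \<in> keys f" for u
  proof
    have "single v 1 + (u - single v 1) = u"
      using assms[OF that]
      by (intro poly_mapping_eqI) (auto simp: lookup_add lookup_minus lookup_single when_def)
    then show "single u (lookup f u) = Var v * single (u - single v 1) (lookup f u)"
      by (simp add: Var_def mult_single)
  qed
  then have "Var v dvd (\<Sum>u\<in>keys f. single u (lookup f u))"
    by (intro dvd_sum)
  then show ?thesis by (simp add: sum_single_lookup)
qed

lemma restr_eq_0_imp_dvd:
  assumes "homog D f" "restr f = 0"
  shows "Var Vz dvd f"
proof (rule Var_dvd)
  fix u assume u: "u \<in> keys f"
  then have deg: "tdeg u = D" using assms(1) by (auto simp: homog_def)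
  show "lookup u Vz > 0"
  proof (rule ccontr)
    assume z: "\<not> lookup u Vz > 0"
    then have "u = single Vx (D - lookup u Vy) + single Vy (lookup u Vy)" "lookup u Vy \<le> D"
      using deg by (auto simp: lookup_add lookup_single tdeg_def intro!: var_exp_eqI)
    then have "lookup f u = coeff (restr f) (lookup u Vy)"
      by (simp add: coeff_restr[OF assms(1)])
    with u show False by (simp add: assms(2) in_keys_iff)
  qed
qed

lemma homog_mult_cancel:
  fixes f g :: "(var, 'a::idom) mpoly"
  assumes "homog d g" "homog D (g * f)" "g * f \<noteq> 0"
  obtains e where "D = d + e" "homog e f"
proof -
  from assms(3) have "f \<noteq> 0" "g \<noteq> 0" by auto
  then obtain u where u: "u \<in> keys f"
    by (metis in_keys_iff lookup_zero poly_mapping_eqI)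
  then have "lookup (hcomp (tdeg u) f) u \<noteq> 0"
    by (simp add: lookup_hcomp in_keys_iff)
  then have "hcomp (d + tdeg u) (g * f) \<noteq> 0"
    using \<open>g \<noteq> 0\<close> by (auto simp: hcomp_mult_homog[OF assms(1)])
  then have "D = d + tdeg u"
    by (auto simp: hcomp_homog[OF assms(2)] split: if_splits)
  then show ?thesis
    using that homog_cancel[OF assms(1) \<open>g \<noteq> 0\<close>] assms(2) by blast
qed

text \<open>The shift moves the point (1 : a : 0) to (1 : a + s : 2 s a + s^2 + t), which is again
  on the line exactly when the last coordinate vanishes.\<close>

lemma poly_restr_shift:
  "poly (restr (shift s t f)) a =
     ev (\<lambda>c. c) (\<lambda>v. case v of Vx \<Rightarrow> 1 | Vy \<Rightarrow> a + s | Vz \<Rightarrow> 2 * s * a + s^2 + t) f"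
proof (rule mpoly_hom_eqI[where \<phi> = "\<lambda>f. poly (restr (shift s t f)) a"])
  show "comm_ring_hom (\<lambda>f. poly (restr (shift s t f)) a)"
    by unfold_locales
      (simp_all add: shift.hom_add shift.hom_mult restr.hom_add restr.hom_mult)
next
  fix v
  show "poly (restr (shift s t (Var v))) a =
     ev (\<lambda>c. c) (\<lambda>v. case v of Vx \<Rightarrow> 1 | Vy \<Rightarrow> a + s | Vz \<Rightarrow> 2 * s * a + s^2 + t) (Var v)"
    by (cases v)
       (simp_all add: comm_ring_hom_id shift_y shift_z restr.hom_add restr.hom_mult)
qed (simp_all add: ev_hom comm_ring_hom_id)

text \<open>Each numerator in Lagrange's formula is monic of degree \<open>card A - 1\<close>, so
  the top coefficient of the interpolant is the sum of the weights.\<close>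

lemma lagrange_top_coeff:
  fixes r :: "'a::field poly"
  assumes "finite A" "degree r < card A"
  shows "(\<Sum>a\<in>A. poly r a / (\<Prod>b\<in>A - {a}. a - b)) = coeff r (card A - 1)"
proof -
  define l where "l a = (\<Prod>b\<in>A - {a}. [:- b, 1:])" for a
  define w where "w a = poly r a / (\<Prod>b\<in>A - {a}. a - b)" for a
  define q where "q = (\<Sum>a\<in>A. smult (w a) (l a))"
  have deg: "degree (l a) = card A - 1" and lc: "coeff (l a) (card A - 1) = 1" if "a \<in> A" for a
  proof -
    have "degree (l a) = (\<Sum>b\<in>A - {a}. degree [:- b, 1:])"
      unfolding l_def by (rule degree_prod_eq_sum_degree) simp
    then show deg: "degree (l a) = card A - 1"
      using that assms(1) by simp
    have "lead_coeff (l a) = 1"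
      unfolding l_def lead_coeff_prod by simp
    then show "coeff (l a) (card A - 1) = 1"
      using deg by simp
  qed
  have "degree q \<le> card A - 1"
    unfolding q_def using deg
    by (intro degree_sum_le assms(1)) (metis degree_smult_le)
  moreover have "poly q a = poly r a" if a: "a \<in> A" for a
  proof -
    have "poly (l b) a = 0" if "b \<in> A" "b \<noteq> a" for b
      unfolding l_def poly_prod using a that assms(1) by (intro prod_zero) auto
    then have "poly q a = (\<Sum>b\<in>A. if b = a then w a * poly (l a) a else 0)"
      unfolding q_def poly_sum by (intro sum.cong) auto
    also have "\<dots> = w a * poly (l a) a"
      using a assms(1) by (simp add: sum.delta)
    also have "\<dots> = poly r a"
    proof -
      have "(\<Prod>b\<in>A - {a}. a - b) \<noteq> 0"
        using assms(1) by auto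
      then show ?thesis by (simp add: w_def l_def poly_prod)
    qed
    finally show ?thesis .
  qed
  ultimately have "q = r"
    using assms by (intro poly_eqI_degree[of A]) auto
  then have "coeff r (card A - 1) = (\<Sum>a\<in>A. w a * coeff (l a) (card A - 1))"
    by (auto simp: q_def coeff_sum)
  then show ?thesis
    using lc by (simp add: w_def cong: sum.cong)
qed

section \<open>Invariants of a finite group of shifts\<close>

lemma lead_shift_z:
  fixes s t :: "'a::idom"
  shows "grevlex.lead (shift s t (Var Vz)) (single Vz 1) 1"
proof -
  have "grevlex.below (single Vz 1) (Const a * Var v)" if "v \<noteq> Vz" for v and a :: 'a
    using that by (cases v) (auto simp: Const_def Var_def mult_single grevlex_less_def
        tdeg_single lookup_single intro!: grevlex.below_single)
  then show ?thesis
    unfolding shift_z add.assoc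
    by (intro grevlex.lead_add_below lead_Var grevlex.below_add) auto
qed

lemma homog_shift_z: "homog 1 (shift s t (Var Vz))"
  by (intro homog_shift homog_Var)

text \<open>\<open>fst_inj\<close> keeps the translates of z apart. \<open>slope_inj\<close> makes
  the points of intersection with the line distinct: the one of (s, t) is at y = -(s +
  t/s)/2.\<close>

locale shift_group =
  fixes G :: "('a::field \<times> 'a) set"
  assumes finite_G: "finite G"
    and zero_in: "(0, 0) \<in> G"
    and add_in: "g \<in> G \<Longrightarrow> g' \<in> G \<Longrightarrow> (fst g + fst g', snd g + snd g') \<in> G"
    and neg_in: "g \<in> G \<Longrightarrow> (- fst g, - snd g) \<in> G"
    and fst_inj: "g \<in> G \<Longrightarrow> g' \<in> G \<Longrightarrow> fst g = fst g' \<Longrightarrow> g = g'"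
    and two_nonzero: "(2::'a) \<noteq> 0"
    and slope_inj: "g \<in> G \<Longrightarrow> g' \<in> G \<Longrightarrow> fst g \<noteq> 0 \<Longrightarrow> fst g' \<noteq> 0 \<Longrightarrow>
      fst g + snd g / fst g = fst g' + snd g' / fst g' \<Longrightarrow> g = g'"
begin

abbreviation act_by :: "'a \<times> 'a \<Rightarrow> (var, 'a) mpoly \<Rightarrow> (var, 'a) mpoly" where
  "act_by g \<equiv> shift (fst g) (snd g)"

definition invariant :: "(var, 'a) mpoly \<Rightarrow> bool" where
  "invariant f \<longleftrightarrow> (\<forall>g\<in>G. act_by g f = f)"

definition orbit_norm :: "(var, 'a) mpoly" where
  "orbit_norm = (\<Prod>g\<in>G. act_by g (Var Vz))"

lemma inv_Const: "invariant (Const c)"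
  and inv_x: "invariant (Var Vx)"
  and inv_add: "invariant f \<Longrightarrow> invariant f' \<Longrightarrow> invariant (f + f')"
  and inv_mult: "invariant f \<Longrightarrow> invariant f' \<Longrightarrow> invariant (f * f')"
  and inv_uminus: "invariant f \<Longrightarrow> invariant (- f)"
  by (simp_all add: invariant_def shift.hom_add shift.hom_mult shift.hom_uminus)

lemma inv_diff: "invariant f \<Longrightarrow> invariant f' \<Longrightarrow> invariant (f - f')"
  using inv_add[of f "- f'"] by (simp add: inv_uminus)

lemma inv_power: "invariant f \<Longrightarrow> invariant (f ^ n)"
  by (simp add: invariant_def shift.hom_power)

lemma inv_sum: "(\<And>i. i \<in> A \<Longrightarrow> invariant (f i)) \<Longrightarrow> invariant (sum f A)"
  by (simp add: invariant_def shift.hom_sum)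

lemma inv_cancel: "invariant (f * f') \<Longrightarrow> invariant f \<Longrightarrow> f \<noteq> 0 \<Longrightarrow> invariant f'"
  by (simp add: invariant_def shift.hom_mult)

lemma inv_hcomp: "invariant f \<Longrightarrow> invariant (hcomp d f)"
  by (simp add: invariant_def hcomp_shift[symmetric])

lemma translate_bij:
  assumes "h \<in> G"
  shows "bij_betw (\<lambda>g. (fst g + fst h, snd g + snd h)) G G"
proof (rule bij_betw_byWitness[where f' = "\<lambda>g. (fst g + - fst h, snd g + - snd h)"])
  show "(\<lambda>g. (fst g + - fst h, snd g + - snd h)) ` G \<subseteq> G"
    using add_in[OF _ neg_in[OF assms]] by auto
  show "(\<lambda>g. (fst g + fst h, snd g + snd h)) ` G \<subseteq> G"
    using add_in[OF _ assms] by auto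
qed auto

lemma inv_norm: "invariant orbit_norm"
  unfolding invariant_def
proof
  fix h assume "h \<in> G"
  have "act_by h orbit_norm = (\<Prod>g\<in>G. act_by (fst g + fst h, snd g + snd h) (Var Vz))"
    by (simp add: orbit_norm_def shift.hom_prod shift_shift add.commute)
  also have "\<dots> = orbit_norm"
    unfolding orbit_norm_def
    by (rule prod.reindex_bij_betw[OF translate_bij[OF \<open>h \<in> G\<close>], where g = "\<lambda>g. act_by g (Var Vz)"])
  finally show "act_by h orbit_norm = orbit_norm" .
qed

lemma homog_norm: "homog (card G) orbit_norm"
  using homog_prod[of G "\<lambda>_. 1" "\<lambda>g. act_by g (Var Vz)", OF homog_shift_z]
    by (simp add: orbit_norm_def)

lemma lead_norm: "grevlex.lead orbit_norm (single Vz (card G)) 1"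
proof -
  have "grevlex.lead orbit_norm (\<Sum>g\<in>G. single Vz 1) (\<Prod>g\<in>G. 1)"
    unfolding orbit_norm_def by (intro grevlex.lead_prod finite_G lead_shift_z)
  moreover have "(\<Sum>g\<in>G. single Vz 1) = single Vz (card G)"
    by (rule var_exp_eqI) (simp_all add: lookup_sum lookup_single)
  ultimately show ?thesis by simp
qed

lemma norm_nonzero: "orbit_norm \<noteq> 0"
  using grevlex.lead_nonzero(2)[OF lead_norm] .

text \<open>A substitute for coprimality of the factors. Applying the inverse of g turns its factor
  into z; the factors already split off then restrict to linear polynomials with nonzero slope 2 (s'
  - s), so it is the quotient that vanishes on the line.\<close>

lemma shift_z_dvd:
  assumes h: "invariant h" "homog D h" "restr h = 0" and F: "F \<subseteq> G"
  shows "(\<Prod>g\<in>F. act_by g (Var Vz)) dvd h"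
  using finite_subset[OF F finite_G] F
proof (induction F rule: finite_subset_induct')
  case (insert g F)
  let ?P = "\<Prod>g\<in>F. act_by g (Var Vz)"
  obtain q where q: "h = ?P * q" using insert by auto
  show ?case
  proof (cases "h = 0")
    case False
    have "homog (card F) ?P"
      using homog_prod[of F "\<lambda>_. 1" "\<lambda>g. act_by g (Var Vz)", OF homog_shift_z]
      by simp
    then obtain e where e: "homog e q"
      using homog_mult_cancel[of "card F" ?P D q] h(2) False q by metis
    define tau where "tau = shift (- fst g) (- snd g)"
    have "tau h = h"
      using h(1) neg_in[OF \<open>g \<in> G\<close>] by (auto simp: invariant_def tau_def)
    then have "0 = restr (tau h)"
      using h(3) by simp
    also have "\<dots> = (\<Prod>g'\<in>F. restr (shift (fst g' - fst g) (snd g' - snd g) (Var Vz))) * restr (tau q)"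
      by (simp add: q tau_def shift.hom_mult shift.hom_prod restr.hom_mult restr.hom_prod shift_shift)
    finally have "restr (tau q) = 0 \<or>
        (\<exists>g'\<in>F. restr (shift (fst g' - fst g) (snd g' - snd g) (Var Vz)) = 0)"
      using insert.hyps(1) by auto
    moreover have "restr (shift (fst g' - fst g) (snd g' - snd g) (Var Vz)) \<noteq> 0" if "g' \<in> F" for g'
    proof -
      have "fst g' \<noteq> fst g"
        using that insert fst_inj[of g' g] by auto
      then show ?thesis
        using two_nonzero by (simp add: shift_z restr.hom_add restr.hom_mult)
    qed
    ultimately have "restr (tau q) = 0" by blast
    then have "Var Vz dvd tau q"
      using restr_eq_0_imp_dvd[of e "tau q"] by (simp add: tau_def homog_shift[OF e])
    then have "act_by g (Var Vz) dvd act_by g (tau q)"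
      by (auto simp: dvd_def shift.hom_mult)
    then have "act_by g (Var Vz) dvd q"
      by (simp add: tau_def shift_shift)
    then show ?thesis
      using insert.hyps by (simp add: q mult.commute mult_dvd_mono)
  qed simp
qed simp

lemma norm_dvd: "invariant h \<Longrightarrow> homog D h \<Longrightarrow> restr h = 0 \<Longrightarrow> orbit_norm dvd h"
  unfolding orbit_norm_def by (rule shift_z_dvd) auto

section \<open>Points where the line meets its translates\<close>

definition neg :: "'a \<times> 'a \<Rightarrow> 'a \<times> 'a" where
  "neg g = (- fst g, - snd g)"

text \<open>The y-coordinate of the point of the line that g keeps on the line, that is, the zero of
  \<open>lin g\<close>, the restriction of the translate of z by g.\<close>

definition line_root :: "'a \<times> 'a \<Rightarrow> 'a" where
  "line_root g = - (fst g ^ 2 + snd g) / (2 * fst g)"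

definition lin :: "'a \<times> 'a \<Rightarrow> 'a \<Rightarrow> 'a" where
  "lin g a = 2 * fst g * a + fst g ^ 2 + snd g"

abbreviation "G' \<equiv> G - {(0, 0)}"

lemma fst_nonzero: "g \<in> G' \<Longrightarrow> fst g \<noteq> 0"
  using fst_inj[OF _ zero_in, of g] by auto

lemma neg_in': "g \<in> G' \<Longrightarrow> neg g \<in> G'"
  using neg_in by (auto simp: neg_def prod_eq_iff)

lemma neg_bij: "bij_betw neg G' G'"
  by (rule bij_betw_byWitness[where f' = neg]) (use neg_in' in \<open>auto simp: neg_def\<close>)

lemma lin_eq: "g \<in> G' \<Longrightarrow> lin g a = 2 * fst g * (a - line_root g)"
  using fst_nonzero[of g] two_nonzero by (simp add: lin_def line_root_def field_simps)

lemma lin_root: "g \<in> G' \<Longrightarrow> lin g (line_root g) = 0"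
  by (simp add: lin_eq)

lemma root_neg: "g \<in> G' \<Longrightarrow> line_root (neg g) = line_root g + fst g"
  using fst_nonzero[of g] two_nonzero
  by (simp add: line_root_def neg_def field_simps power2_eq_square)

lemma root_inj: "inj_on line_root G'"
proof (rule inj_onI)
  fix g h assume gh: "g \<in> G'" "h \<in> G'" "line_root g = line_root h"
  have "fst k + snd k / fst k = - (2 * line_root k)" if "k \<in> G'" for k
    using fst_nonzero[OF that] two_nonzero by (simp add: line_root_def field_simps power2_eq_square)
  then have "fst g + snd g / fst g = fst h + snd h / fst h"
    using gh by metis
  then show "g = h"
    using slope_inj gh fst_nonzero by blast
qed

text \<open>\<open>lin\<close> is a cocycle: \<open>lin\<close> of h + g at a is
  \<open>lin h\<close> at a + s plus \<open>lin g\<close> at a, with s the first coordinate of g. At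
  the root of g the last summand vanishes.\<close>

lemma lin_neg_root:
  assumes "g \<in> G'"
  shows "lin h (line_root (neg g)) = lin (fst h + fst g, snd h + snd g) (line_root g)"
proof -
  have "lin (fst h + fst g, snd h + snd g) (line_root g) = lin h (line_root g + fst g) + lin g (line_root g)"
    by (simp add: lin_def algebra_simps power2_eq_square)
  then show ?thesis using assms by (simp add: lin_root root_neg)
qed

definition diffprod :: "'a \<times> 'a \<Rightarrow> 'a" where
  "diffprod g = (\<Prod>h\<in>G' - {g}. line_root g - line_root h)"

text \<open>The derivative of \<open>\<Prod>g\<in>G'. lin g X\<close> takes opposite values at the roots of \<open>g\<close> and \<open>neg g\<close>.\<close>

lemma diffprod_neg:
  assumes g: "g \<in> G'"
  shows "diffprod (neg g) = - diffprod g"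
proof -
  define W where "W = (\<Prod>h\<in>G'. 2 * fst h)"
  define Q where "Q g = (\<Prod>h\<in>G' - {g}. lin h (line_root g))" for g
  have W: "W \<noteq> 0"
    unfolding W_def using finite_G two_nonzero fst_nonzero by (auto simp: prod_zero_iff)
  \<comment> \<open>Multiplying by the slopes of all factors replaces differences of roots by values
    of \<open>lin\<close>. The factor 2 s of g itself remains, and it is the source of the sign, as
    \<open>Q\<close> turns out to be the same for g and its negative.\<close>
  have diffprod: "diffprod g * W = 2 * fst g * Q g" if "g \<in> G'" for g
  proof -
    have "Q g = (\<Prod>h\<in>G' - {g}. 2 * fst h) * diffprod g"
      unfolding Q_def diffprod_def prod.distrib[symmetric]
      by (intro prod.cong refl) (auto simp: lin_eq)
    moreover have "W = 2 * fst g * (\<Prod>h\<in>G' - {g}. 2 * fst h)"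
      unfolding W_def by (rule prod.remove) (use that finite_G in auto)
    ultimately show ?thesis by simp
  qed
  \<comment> \<open>Translation by g sends the omitted elements -g and 0 to 0 and g, so it matches
    the index sets of the two products.\<close>
  have "bij_betw (\<lambda>h. (fst h + fst g, snd h + snd g)) (G' - {neg g}) (G' - {g})"
  proof (rule bij_betw_byWitness[where f' = "\<lambda>h. (fst h + - fst g, snd h + - snd g)"])
    show "(\<lambda>h. (fst h + - fst g, snd h + - snd g)) ` (G' - {g}) \<subseteq> G' - {neg g}"
      using add_in[of _ "(- fst g, - snd g)"] neg_in[of g] g by (auto simp: neg_def prod_eq_iff)
    show "(\<lambda>h. (fst h + fst g, snd h + snd g)) ` (G' - {neg g}) \<subseteq> G' - {g}"
      using add_in[of _ g] g by (auto simp: neg_def prod_eq_iff eq_neg_iff_add_eq_0)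
  qed auto
  then have "Q (neg g) = Q g"
    unfolding Q_def lin_neg_root[OF g] by (rule prod.reindex_bij_betw)
  then have "diffprod (neg g) * W = - diffprod g * W"
    using diffprod[OF g] diffprod[OF neg_in'[OF g]] by (simp add: neg_def)
  then show ?thesis using W mult_right_cancel by blast
qed

text \<open>
  The points \<open>(1 : line_root g : 0)\<close> and \<open>(1 : line_root (neg g) : 0)\<close> are exchanged by the group, so an
  invariant takes the same value at both and the terms of Lagrange's formula cancel in pairs.
\<close>

lemma degree_restr_inv:
  assumes h: "invariant h" and card: "card G > 2"
  shows "degree (restr h) \<noteq> card G - 2"
proof
  assume deg: "degree (restr h) = card G - 2"
  define r where "r = restr h"
  have card': "card G' = card G - 1"
    using finite_G zero_in by simp
  have r: "poly r (line_root (neg g)) = poly r (line_root g)" if "g \<in> G'" for g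
  proof -
    have "poly r (line_root g) = poly (restr (act_by g h)) (line_root g)"
      using h that by (simp add: invariant_def r_def)
    also have "\<dots> = poly (restr (shift 0 0 h)) (line_root g + fst g)"
      unfolding poly_restr_shift using lin_root[OF that] by (simp add: lin_def)
    also have "\<dots> = poly r (line_root (neg g))"
      by (simp add: r_def root_neg[OF that])
    finally show ?thesis by simp
  qed
  define S where "S = (\<Sum>g\<in>G'. poly r (line_root g) / diffprod g)"
  have "S = (\<Sum>g\<in>G'. poly r (line_root (neg g)) / diffprod (neg g))"
    unfolding S_def by (rule sum.reindex_bij_betw[OF neg_bij, symmetric])
  also have "\<dots> = - S"
    unfolding S_def sum_negf[symmetric]
    by (intro sum.cong refl) (simp add: r diffprod_neg)
  finally have "2 * S = 0" by simp
  then have "S = 0" using two_nonzero by simp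
  moreover have "S = (\<Sum>a\<in>line_root ` G'. poly r a / (\<Prod>b\<in>line_root ` G' - {a}. a - b))"
  proof -
    have "diffprod g = (\<Prod>b\<in>line_root ` G' - {line_root g}. line_root g - b)" if "g \<in> G'" for g
    proof -
      have "line_root ` G' - {line_root g} = line_root ` (G' - {g})"
        using root_inj that by (auto dest: inj_onD)
      moreover have "inj_on line_root (G' - {g})"
        using root_inj by (rule inj_on_subset) auto
      ultimately show ?thesis
        by (simp add: diffprod_def prod.reindex)
    qed
    then show ?thesis
      unfolding S_def sum.reindex[OF root_inj] by (intro sum.cong refl) simp
  qed
  \<comment> \<open>With \<open>card G - 1\<close> nodes the coefficient computed by interpolation
    is the one in degree \<open>card G - 2\<close>.\<close>
  moreover have "card (line_root ` G') = card G - 1"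
    using card_image[OF root_inj] card' by simp
  ultimately have "coeff r (card G - 2) = 0"
    using lagrange_top_coeff[of "line_root ` G'" r] deg card finite_G by (simp add: r_def numeral_2_eq_2)
  then have "lead_coeff r = 0"
    unfolding r_def deg .
  then have "r = 0" by simp
  \<comment> \<open>The zero polynomial has degree 0, and \<open>card\<close> excludes
    \<open>card G - 2 = 0\<close>.\<close>
  then show False using deg card by (simp add: r_def)
qed

end

section \<open>A symmetric numerical semigroup\<close>

definition wt :: "nat \<Rightarrow> nat \<Rightarrow> nat \<Rightarrow> nat \<Rightarrow> nat" where
  "wt p a b c = a * p^2 + b * (p^2 + 2 * p) + c * (p^3 + 2)"

lemma exists_half_mod:
  fixes p n :: int
  assumes "odd p" "p > 0"
  obtains c where "0 \<le> c" "c < p" "p dvd n - 2 * c"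
proof -
  obtain k where k: "p = 2 * k + 1" using assms(1) by (rule oddE)
  \<comment> \<open>k + 1 is the inverse of 2 modulo p = 2 k + 1.\<close>
  let ?c = "(n * (k + 1)) mod p"
  have "0 \<le> ?c" "?c < p" using assms(2) by simp_all
  moreover
  have "n - 2 * ?c = 2 * (n * (k + 1) - ?c) - n * p"
    by (simp add: k algebra_simps)
  moreover have "p dvd n * (k + 1) - ?c"
    by (simp add: mod_eq_dvd_iff[symmetric])
  ultimately have "p dvd n - 2 * ?c"
    by (metis dvd_diff dvd_mult dvd_triv_right)
  with \<open>0 \<le> ?c\<close> \<open>?c < p\<close> show ?thesis by (rule that)
qed

lemma half_mod_unique:
  fixes p c d :: int
  assumes "odd p" "0 \<le> c" "c < p" "0 \<le> d" "d < p" "p dvd 2 * c - 2 * d"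
  shows "c = d"
proof -
  have "coprime p 2" using assms(1) by simp
  then have "p dvd c - d"
    using assms(6) by (metis coprime_dvd_mult_right_iff right_diff_distrib)
  then have "c mod p = d mod p" by (simp add: mod_eq_dvd_iff)
  then show ?thesis using assms by simp
qed

text \<open>Modulo p only 2 c remains, which determines c; after subtracting the c-part and dividing
  by p, only 2 b remains modulo p. Both use that 2 is invertible modulo p, and a is whatever integer
  is left.\<close>

lemma wt_representation:
  fixes p n :: int
  assumes "odd p" "p > 0"
  obtains a b c where "0 \<le> b" "b < p" "0 \<le> c" "c < p"
    "n = a * p^2 + b * (p^2 + 2 * p) + c * (p^3 + 2)"
proof -
  obtain c where c: "0 \<le> c" "c < p" "p dvd n - 2 * c"
    using exists_half_mod[OF assms] by blast
  then obtain m where m: "n = 2 * c + p * m" by (metis dvdE diff_add_cancel add.commute)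
  obtain b where b: "0 \<le> b" "b < p" "p dvd (m - c * p^2) - 2 * b"
    using exists_half_mod[OF assms] by blast
  then obtain l where "m = 2 * b + c * p^2 + p * l"
    by (metis dvdE diff_add_cancel add.commute add.left_commute add.assoc)
  \<comment> \<open>The weight of b already contains b p^2, whence a = l - b.\<close>
  then have "n = (l - b) * p^2 + b * (p^2 + 2 * p) + c * (p^3 + 2)"
    by (simp add: m algebra_simps power2_eq_square power3_eq_cube)
  then show ?thesis using that b c by blast
qed

text \<open>
  Replacing \<open>b, c\<close> by \<open>p - 1 - b, p - 1 - c\<close> in the representation of \<open>n\<close> with integral \<open>a\<close> and
  \<open>0 \<le> b, c < p\<close> turns the one of \<open>n\<close> into the one of \<open>p\<^sup>4 - 2 - n\<close>, with \<open>-1 - a\<close> in place of \<open>a\<close>.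
\<close>

lemma wt_gap:
  assumes "odd p" and gap: "\<And>a b c. b < p \<Longrightarrow> c < p \<Longrightarrow> n \<noteq> wt p a b c"
  obtains a b c where "n + wt p a b c = p^4 - 2"
proof -
  let ?p = "int p"
  have p: "odd ?p" "?p > 0" using assms(1) by (auto elim: oddE)
  obtain a b c where abc: "0 \<le> b" "b < ?p" "0 \<le> c" "c < ?p"
    "int n = a * ?p^2 + b * (?p^2 + 2 * ?p) + c * (?p^3 + 2)"
    using wt_representation[OF p] by blast
  have "a < 0"
  proof (rule ccontr)
    assume "\<not> a < 0"
    then have "int n = int (wt p (nat a) (nat b) (nat c))"
      using abc by (simp add: wt_def algebra_simps)
    then show False
      using gap[of "nat b" "nat c" "nat a"] abc by linarith
  qed
  define a' b' c' where "a' = nat (- 1 - a)" and "b' = nat (?p - 1 - b)" and "c' = nat (?p - 1 - c)"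
  have "int (wt p a' b' c') = (- 1 - a) * ?p^2 + (?p - 1 - b) * (?p^2 + 2 * ?p) + (?p - 1 - c) * (?p^3 + 2)"
    using abc \<open>a < 0\<close> by (simp add: wt_def a'_def b'_def c'_def algebra_simps)
  then have "int (n + wt p a' b' c') + 2 = ?p^4"
    by (simp add: abc algebra_simps power2_eq_square power3_eq_cube power4_eq_xxxx)
  then have "n + wt p a' b' c' + 2 = p^4"
    by (metis of_nat_add of_nat_eq_iff of_nat_numeral of_nat_power)
  then show ?thesis using that[of a' b' c'] by simp
qed

text \<open>The two congruences modulo p that produce c and then b also determine them in the range
  below p.\<close>

lemma wt_inj:
  assumes "odd p" "b < p" "c < p" "b' < p" "c' < p" "wt p a b c = wt p a' b' c'"
  shows "a = a' \<and> b = b' \<and> c = c'"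
proof -
  let ?p = "int p"
  have p: "odd ?p" using assms(1) by simp
  have pos: "?p > 0" using assms by simp
  have eq: "int a * ?p^2 + int b * (?p^2 + 2 * ?p) + int c * (?p^3 + 2) =
      int a' * ?p^2 + int b' * (?p^2 + 2 * ?p) + int c' * (?p^3 + 2)"
    using arg_cong[OF assms(6), of int] by (simp add: wt_def algebra_simps)
  have "2 * int c - 2 * int c' = ?p *
    ((int a' - int a) * ?p + (int b' - int b) * (?p + 2) + (int c' - int c) * ?p^2)"
    using eq by (simp add: algebra_simps power2_eq_square power3_eq_cube)
  then have "int c = int c'"
    using assms by (intro half_mod_unique[OF p]) auto
  then have c: "c = c'" by simp
  have "?p * (2 * int b - 2 * int b') = ?p * (?p * ((int a' - int a) + (int b' - int b)))"
    using eq by (simp add: c algebra_simps power2_eq_square)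
  then have "2 * int b - 2 * int b' = ?p * ((int a' - int a) + (int b' - int b))"
    using pos by simp
  then have "int b = int b'"
    using assms by (intro half_mod_unique[OF p]) auto
  then have b: "b = b'" by simp
  have "a * p^2 = a' * p^2" using assms(6) by (simp add: wt_def b c)
  then show ?thesis using b c pos by simp
qed

section \<open>Normal forms of invariants\<close>

lemma poly_ring_iff: "P \<in> poly_ring m \<longleftrightarrow> keys P \<subseteq> {K. keys K \<subseteq> {..<m}}"
  by (auto simp: poly_ring_def)

lemma power_product_eq_mon:
  "keys K \<subseteq> {..<length bs} \<Longrightarrow> power_product bs K = mon ((!) bs) K"
  by (simp add: power_product_def mon_eq_prod[of "{..<length bs}"])

interpretation eval_at: comm_ring_hom "eval_at bs" for bs
  unfolding eval_at_def by (rule subst_hom)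

lemma eval_at_single:
  "keys K \<subseteq> {..<length bs} \<Longrightarrow> eval_at bs (single K c) = Const c * power_product bs K"
  by (simp add: eval_at_def subst_eq_ev ev_single comm_ring_hom_Const power_product_eq_mon)

lemma eval_at_eq_sum:
  assumes "P \<in> poly_ring (length bs)"
  shows "eval_at bs P = (\<Sum>K\<in>keys P. Const (lookup P K) * power_product bs K)"
proof -
  have "eval_at bs P = (\<Sum>K\<in>keys P. eval_at bs (single K (lookup P K)))"
    by (subst (1) sum_single_lookup[of P, symmetric]) (simp add: eval_at.hom_sum)
  also have "\<dots> = (\<Sum>K\<in>keys P. Const (lookup P K) * power_product bs K)"
    using assms by (intro sum.cong refl eval_at_single) (auto simp: poly_ring_def)
  finally show ?thesis .
qed

text \<open>All that the structure theorem uses about the three invariants. Their lead monomials are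
  powers of y of full degree, so restriction to the line preserves the degree.\<close>

locale sagbi_generators = shift_group G for G :: "('a::field \<times> 'a) set" +
  fixes p :: nat and f1 f2 f3 :: "(var, 'a) mpoly" and c1 c2 c3 :: 'a
  assumes odd_p: "odd p" and p_gt_1: "p > 1" and card_G: "card G = p^4"
    and inv1: "invariant f1" and inv2: "invariant f2" and inv3: "invariant f3"
    and homog1: "homog (p^2) f1" and homog2: "homog (p^2 + 2 * p) f2" and homog3: "homog (p^3 + 2) f3"
    and lead1: "grevlex.lead f1 (single Vy (p^2)) c1"
    and lead2: "grevlex.lead f2 (single Vy (p^2 + 2 * p)) c2"
    and lead3: "grevlex.lead f3 (single Vy (p^3 + 2)) c3"
begin

section \<open>Lead exponents of products of the generators\<close>

definition B :: "(var, 'a) mpoly list" where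
  "B = [Var Vx, f1, f2, f3, orbit_norm]"

lemma length_B [simp]: "length B = 5"
  by (simp add: B_def)

definition lexp :: "(nat \<Rightarrow>\<^sub>0 nat) \<Rightarrow> (var \<Rightarrow>\<^sub>0 nat)" where
  "lexp K = single Vx (lookup K 0) + single Vy (wt p (lookup K 1) (lookup K 2) (lookup K 3))
     + single Vz (p^4 * lookup K 4)"

definition lcf :: "(nat \<Rightarrow>\<^sub>0 nat) \<Rightarrow> 'a" where
  "lcf K = c1 ^ lookup K 1 * c2 ^ lookup K 2 * c3 ^ lookup K 3"

text \<open>The bound p is where representations stop being unique: p (p^2 + 2p) = (p + 2) p^2 and p
  (p^3 + 2) = (p^2 + 2p) + (p^2 - 1) p^2.\<close>

definition normal :: "(nat \<Rightarrow>\<^sub>0 nat) set" where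
  "normal = {K. keys K \<subseteq> {..<5} \<and> lookup K 2 < p \<and> lookup K 3 < p}"

lemma power_product_B:
  "power_product B K = Var Vx ^ lookup K 0 * f1 ^ lookup K 1 * f2 ^ lookup K 2 *
     f3 ^ lookup K 3 * orbit_norm ^ lookup K 4"
  by (simp add: power_product_def B_def lessThan_Suc eval_nat_numeral mult_ac)

lemma invariant_power_product: "invariant (power_product B K)"
  unfolding power_product_B
  by (intro inv_mult inv_power inv_x inv1 inv2 inv3 inv_norm)

lemma nsmul_single: "(\<Sum>i\<in>{..<n::nat}. single v m) = (single v (n * m) :: 'v \<Rightarrow>\<^sub>0 nat)"
  by (induction n) (simp_all add: single_add[symmetric] add.commute)

lemma lead_power:
  assumes "grevlex.lead f (single v m) c"
  shows "grevlex.lead (f ^ n) (single v (n * m)) (c ^ n)"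
  using grevlex.lead_prod[of "{..<n}" "\<lambda>_. f" "\<lambda>_. single v m" "\<lambda>_. c"] assms
  by (simp add: nsmul_single)

lemma lead_power_product: "grevlex.lead (power_product B K) (lexp K) (lcf K)"
proof -
  have "grevlex.lead (power_product B K)
      (single Vx (lookup K 0 * 1) + single Vy (lookup K 1 * p^2) + single Vy (lookup K 2 * (p^2 + 2 * p))
        + single Vy (lookup K 3 * (p^3 + 2)) + single Vz (lookup K 4 * card G))
      (1 ^ lookup K 0 * c1 ^ lookup K 1 * c2 ^ lookup K 2 * c3 ^ lookup K 3 * 1 ^ lookup K 4)"
    unfolding power_product_B
    by (intro grevlex.lead_mult lead_power lead_Var lead1 lead2 lead3 lead_norm)
  then show ?thesis
    by (simp add: lexp_def lcf_def wt_def card_G single_add add.assoc mult.commute)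
qed

lemma power_product_nonzero: "power_product B K \<noteq> 0"
  using grevlex.lead_nonzero(2)[OF lead_power_product] .

lemma lcf_nonzero: "lcf K \<noteq> 0"
  using grevlex.lead_nonzero(1)[OF lead_power_product] .

lemma lookup_lexp:
  "lookup (lexp K) Vx = lookup K 0"
  "lookup (lexp K) Vy = wt p (lookup K 1) (lookup K 2) (lookup K 3)"
  "lookup (lexp K) Vz = p^4 * lookup K 4"
  by (simp_all add: lexp_def lookup_add lookup_single)

lemma exp5_eqI:
  assumes "keys K \<subseteq> {..<5}" "keys L \<subseteq> {..<5}" "\<And>i. i < 5 \<Longrightarrow> lookup K i = lookup L i"
  shows "K = L"
proof (rule poly_mapping_eqI)
  fix i
  show "lookup K i = lookup L i"
  proof (cases "i < 5")
    case False
    then have "i \<notin> keys K" "i \<notin> keys L" using assms by auto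
    then show ?thesis by (simp add: in_keys_iff)
  qed (rule assms(3))
qed

lemma less_5_cases: "(i::nat) < 5 \<Longrightarrow> i = 0 \<or> i = 1 \<or> i = 2 \<or> i = 3 \<or> i = 4"
  by arith

lemma lexp_inj: "inj_on lexp normal"
proof (rule inj_onI)
  fix K L assume KL: "K \<in> normal" "L \<in> normal" and eq: "lexp K = lexp L"
  have "lookup K 1 = lookup L 1 \<and> lookup K 2 = lookup L 2 \<and> lookup K 3 = lookup L 3"
    using arg_cong[OF eq, of "\<lambda>u. lookup u Vy"] KL
    by (intro wt_inj[OF odd_p]) (auto simp: normal_def lookup_lexp)
  moreover have "lookup K 0 = lookup L 0" "lookup K 4 = lookup L 4"
    using arg_cong[OF eq, of "\<lambda>u. lookup u Vx"] arg_cong[OF eq, of "\<lambda>u. lookup u Vz"] p_gt_1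
    by (auto simp: lookup_lexp)
  ultimately show "K = L"
    using KL less_5_cases by (intro exp5_eqI) (auto simp: normal_def)
qed

section \<open>Every invariant is a combination of normal monomials\<close>

definition nspan :: "(var, 'a) mpoly set" where
  "nspan = eval_at B ` {P. keys P \<subseteq> normal}"

lemma normal_poly_ring: "keys P \<subseteq> normal \<Longrightarrow> P \<in> poly_ring (length B)"
  by (auto simp: poly_ring_iff normal_def)

lemma nspan_add: "f \<in> nspan \<Longrightarrow> g \<in> nspan \<Longrightarrow> f + g \<in> nspan"
  unfolding nspan_def
proof clarify
  fix P Q :: "(nat, 'a) mpoly" assume "keys P \<subseteq> normal" "keys Q \<subseteq> normal"
  then show "eval_at B P + eval_at B Q \<in> eval_at B ` {P. keys P \<subseteq> normal}"
    using keys_add[of P Q] by (intro image_eqI[of _ _ "P + Q"]) (auto simp: eval_at.hom_add)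
qed

lemma nspan_0: "0 \<in> nspan"
  unfolding nspan_def by (intro image_eqI[of _ _ 0]) simp_all

lemma nspan_sum: "(\<And>i. i \<in> A \<Longrightarrow> f i \<in> nspan) \<Longrightarrow> sum f A \<in> nspan"
  by (induction A rule: infinite_finite_induct) (auto intro: nspan_add nspan_0)

lemma nspan_power_product: "K \<in> normal \<Longrightarrow> Const c * power_product B K \<in> nspan"
  unfolding nspan_def
  by (intro image_eqI[of _ _ "single K c"]) (auto simp: eval_at_single normal_def)

lemma nspan_norm_mult:
  assumes "f \<in> nspan"
  shows "orbit_norm * f \<in> nspan"
proof -
  obtain P where P: "keys P \<subseteq> normal" "f = eval_at B P" using assms by (auto simp: nspan_def)
  have N: "orbit_norm = eval_at B (single (single 4 1) 1)"
    by (subst eval_at_single) (simp_all add: power_product_B lookup_single)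
  have "keys (single (single 4 1) 1 * P) \<subseteq> normal"
  proof
    fix L assume "L \<in> keys (single (single 4 1) 1 * P)"
    then obtain K where K: "K \<in> normal" "L = single 4 1 + K"
      using keys_mult[of "single (single 4 1) 1" P] P by auto
    then show "L \<in> normal"
      using keys_add[of "single 4 1" K] by (auto simp: normal_def lookup_add lookup_single)
  qed
  then show ?thesis
    by (auto simp: nspan_def P N eval_at.hom_mult intro!: image_eqI[of _ _ "single (single 4 1) 1 * P"])
qed

lemma restr_monomial:
  fixes a b c :: nat
  defines "m \<equiv> f1 ^ a * f2 ^ b * f3 ^ c"
  shows "homog (wt p a b c) m" "invariant m" "degree (restr m) = wt p a b c" "restr m \<noteq> 0"
proof -
  show h: "homog (wt p a b c) m"
    unfolding m_def wt_def by (intro homog_mult homog_power homog1 homog2 homog3)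
  show "invariant m"
    unfolding m_def by (intro inv_mult inv_power inv1 inv2 inv3)
  have "grevlex.lead m
      (single Vy (a * p^2) + single Vy (b * (p^2 + 2 * p)) + single Vy (c * (p^3 + 2)))
      (c1 ^ a * c2 ^ b * c3 ^ c)"
    unfolding m_def by (intro grevlex.lead_mult lead_power lead1 lead2 lead3)
  then have l: "grevlex.lead m (single Vy (wt p a b c)) (c1 ^ a * c2 ^ b * c3 ^ c)"
    by (simp add: wt_def single_add add.assoc)
  show "degree (restr m) = wt p a b c"
    by (rule degree_restr(1)[OF h l])
  show "restr m \<noteq> 0"
    using degree_restr(2)[OF h l] grevlex.lead_nonzero(1)[OF l] by auto
qed

lemma degree_restr_in_semigroup:
  assumes "invariant h" "restr h \<noteq> 0"
  obtains a b c where "b < p" "c < p" "degree (restr h) = wt p a b c"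
proof (rule ccontr)
  assume "\<not> thesis"
  then have "\<And>a b c. b < p \<Longrightarrow> c < p \<Longrightarrow> degree (restr h) \<noteq> wt p a b c"
    using that by blast
  then obtain a b c where gap: "degree (restr h) + wt p a b c = p^4 - 2"
    using wt_gap[OF odd_p] by blast
  let ?m = "f1 ^ a * f2 ^ b * f3 ^ c"
  have "degree (restr (h * ?m)) = p^4 - 2"
    using restr_monomial[where a=a and b=b and c=c] assms(2) gap
    by (simp add: restr.hom_mult degree_mult_eq)
  moreover have "p ^ 4 > 2"
  proof -
    have "2 ^ 4 \<le> p ^ 4" using p_gt_1 by (intro power_mono) auto
    then show ?thesis by simp
  qed
  ultimately show False
    using degree_restr_inv[of "h * ?m"] inv_mult[OF assms(1) restr_monomial(2)]
    by (simp add: card_G)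
qed

lemma homog_invariant_in_nspan:
  assumes "invariant h" "homog D h"
  shows "h \<in> nspan"
proof -
  have "wf (less_than <*lex*> less_than)" by (intro wf_lex_prod wf_less_than)
  \<comment> \<open>The second entry places a vanishing restriction below one of degree 0, so that
    cancelling a constant restriction is progress too. Division by the norm lowers the first
    entry.\<close>
  moreover define m where "m D h = (D, if restr h = 0 then 0 else Suc (degree (restr h)))"
    for D :: nat and h :: "(var, 'a) mpoly"
  ultimately have "\<forall>D h. invariant h \<longrightarrow> homog D h \<longrightarrow> m D h = k \<longrightarrow> h \<in> nspan" for k
  proof (induction k rule: wf_induct_rule)
    case (less k)
    show ?case
    proof (intro allI impI)
      fix D h assume h: "invariant h" "homog D h" "m D h = k"
      have IH: "h' \<in> nspan" if "invariant h'" "homog D' h'"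
        "(m D' h', m D h) \<in> less_than <*lex*> less_than" for D' h'
        using less that h(3) by blast
      show "h \<in> nspan"
      proof (cases "restr h = 0")
        case True
        then obtain q where q: "h = orbit_norm * q"
          using norm_dvd[OF h(1,2)] by blast
        show ?thesis
        proof (cases "h = 0")
          case False
          then obtain e where e: "D = card G + e" "homog e q"
            using homog_mult_cancel[OF homog_norm, of D q] h(2) q by metis
          have "invariant q"
            using inv_cancel[of orbit_norm q] h(1) q inv_norm norm_nonzero by simp
          moreover have "e < D" using e card_G p_gt_1 by simp
          ultimately have "q \<in> nspan"
            using e by (intro IH[of q e]) (auto simp: m_def)
          then show ?thesis unfolding q by (rule nspan_norm_mult)
        qed (simp add: nspan_0)
      next
        case False
        obtain a b c where abc: "b < p" "c < p" "degree (restr h) = wt p a b c"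
          using degree_restr_in_semigroup[OF h(1) False] by blast
        define d where "d = degree (restr h)"
        have "d \<le> D" unfolding d_def by (rule degree_restr_le[OF h(2)])
        \<comment> \<open>The power of x brings the monomial to degree D and is invisible after
          restriction.\<close>
        define M where "M = Var Vx ^ (D - d) * (f1 ^ a * f2 ^ b * f3 ^ c)"
        have M: "homog D M" "invariant M" "degree (restr M) = d" "restr M \<noteq> 0"
        proof -
          have "homog ((D - d) * 1 + d) M"
            unfolding M_def d_def abc(3)
            by (intro homog_mult homog_power homog_Var restr_monomial)
          then show "homog D M" using \<open>d \<le> D\<close> by simp
          show "invariant M"
            unfolding M_def by (intro inv_mult inv_power inv_x restr_monomial)
          show "degree (restr M) = d" "restr M \<noteq> 0"
            using restr_monomial[where a=a and b=b and c=c]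
            by (simp_all add: M_def restr.hom_mult restr.hom_power d_def abc(3))
        qed
        define \<kappa> where "\<kappa> = lead_coeff (restr h) / lead_coeff (restr M)"
        define h' where "h' = h - Const \<kappa> * M"
        have r: "restr h' = restr h - smult \<kappa> (restr M)"
          by (simp add: h'_def restr.hom_minus restr.hom_mult)
        have "coeff (restr h') d = 0"
        proof -
          have "coeff (restr M) d \<noteq> 0"
            using M(3,4) by auto
          then show ?thesis
            using M(3) by (simp add: r \<kappa>_def d_def)
        qed
        moreover have "degree (restr h') \<le> d"
          unfolding r using M(3) by (intro degree_diff_le) (auto simp: d_def)
        ultimately have "restr h' = 0 \<or> degree (restr h') < d"
          by (metis le_neq_implies_less leading_coeff_0_iff)
        then have "(m D h', m D h) \<in> less_than <*lex*> less_than"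
          using False by (auto simp: m_def d_def)
        then have "h' \<in> nspan"
          unfolding h'_def using h M
          by (intro IH[of _ D]) (auto intro!: inv_diff inv_mult inv_Const homog_diff homog_Const_mult)
        moreover have "Const \<kappa> * M \<in> nspan"
        proof -
          define K where "K = single 0 (D - d) + single 1 a + single 2 b + single (3::nat) c"
          have "keys K \<subseteq> {..<5}"
            by (auto simp: K_def in_keys_iff lookup_add lookup_single when_def split: if_splits)
          then have "K \<in> normal"
            using abc by (simp add: normal_def K_def lookup_add lookup_single)
          moreover have "power_product B K = M"
            by (simp add: power_product_B K_def lookup_add lookup_single M_def mult.assoc)
          ultimately show ?thesis using nspan_power_product by metis
        qed
        ultimately have "h' + Const \<kappa> * M \<in> nspan" by (rule nspan_add)
        then show ?thesis by (simp add: h'_def)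
      qed
    qed
  qed
  then show ?thesis using assms by blast
qed

lemma nspan_eq: "nspan = {f. invariant f}"
proof
  show "nspan \<subseteq> {f. invariant f}"
    by (auto simp: nspan_def eval_at_eq_sum[OF normal_poly_ring]
        intro!: inv_sum inv_mult inv_Const invariant_power_product)
  show "{f. invariant f} \<subseteq> nspan"
  proof clarify
    fix f assume "invariant f"
    then have "(\<Sum>d\<in>tdeg ` keys f. hcomp d f) \<in> nspan"
      by (intro nspan_sum homog_invariant_in_nspan[OF inv_hcomp homog_hcomp])
    then show "f \<in> nspan" by (simp add: sum_hcomp)
  qed
qed

end

lemma poly_ring_add: "P \<in> poly_ring m \<Longrightarrow> Q \<in> poly_ring m \<Longrightarrow> P + Q \<in> poly_ring m"
  using keys_add[of P Q] by (auto simp: poly_ring_iff)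

lemma poly_ring_uminus: "P \<in> poly_ring m \<Longrightarrow> - P \<in> poly_ring m"
  by (simp add: poly_ring_iff)

lemma poly_ring_diff: "P \<in> poly_ring m \<Longrightarrow> Q \<in> poly_ring m \<Longrightarrow> P - Q \<in> poly_ring m"
  using poly_ring_add[of P m "- Q"] by (simp add: poly_ring_uminus)

lemma poly_ring_mult: "P \<in> poly_ring m \<Longrightarrow> Q \<in> poly_ring m \<Longrightarrow> P * Q \<in> poly_ring m"
  using keys_mult[of P Q] keys_add by (fastforce simp: poly_ring_iff)

lemma poly_ring_0: "0 \<in> poly_ring m"
  and poly_ring_1: "1 \<in> poly_ring m"
  by (simp_all add: poly_ring_iff)

lemma poly_ring_single: "keys K \<subseteq> {..<m} \<Longrightarrow> single K c \<in> poly_ring m"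
  by (simp add: poly_ring_iff)

context
  fixes m :: nat and rs :: "(nat, 'a::comm_ring_1) mpoly list"
begin

private abbreviation (input) "I \<equiv> ideal_gen (poly_ring m) rs"

lemma ideal_gen_0: "0 \<in> I"
  by (auto simp: ideal_gen_def poly_ring_0 intro!: exI[of _ "\<lambda>_. 0"])

lemma ideal_gen_add: "P \<in> I \<Longrightarrow> Q \<in> I \<Longrightarrow> P + Q \<in> I"
  unfolding ideal_gen_def
proof clarify
  fix a b :: "nat \<Rightarrow> (nat, 'a) mpoly"
  assume "\<forall>i<length rs. a i \<in> poly_ring m" "\<forall>i<length rs. b i \<in> poly_ring m"
  then show "\<exists>c. (\<Sum>i<length rs. a i * rs ! i) + (\<Sum>i<length rs. b i * rs ! i)
      = (\<Sum>i<length rs. c i * rs ! i) \<and> (\<forall>i<length rs. c i \<in> poly_ring m)"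
    by (intro exI[of _ "\<lambda>i. a i + b i"])
       (auto simp: distrib_right sum.distrib poly_ring_add)
qed

lemma ideal_gen_mult: "P \<in> I \<Longrightarrow> Q \<in> poly_ring m \<Longrightarrow> Q * P \<in> I"
  unfolding ideal_gen_def
proof clarify
  fix a :: "nat \<Rightarrow> (nat, 'a) mpoly"
  assume "\<forall>i<length rs. a i \<in> poly_ring m" "Q \<in> poly_ring m"
  then show "\<exists>c. Q * (\<Sum>i<length rs. a i * rs ! i)
      = (\<Sum>i<length rs. c i * rs ! i) \<and> (\<forall>i<length rs. c i \<in> poly_ring m)"
    by (intro exI[of _ "\<lambda>i. Q * a i"])
       (auto simp: sum_distrib_left mult.assoc poly_ring_mult)
qed

lemma ideal_gen_nth: "i < length rs \<Longrightarrow> Q \<in> poly_ring m \<Longrightarrow> Q * rs ! i \<in> I"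
  unfolding ideal_gen_def
proof clarify
  assume i: "i < length rs" and Q: "Q \<in> poly_ring m"
  have "(\<Sum>j<length rs. (if j = i then Q else 0) * rs ! j) = Q * rs ! i"
    using i by (simp add: if_distrib[of "\<lambda>x. x * _"] sum.delta cong: if_cong)
  then show "\<exists>c. Q * rs ! i = (\<Sum>i<length rs. c i * rs ! i) \<and> (\<forall>i<length rs. c i \<in> poly_ring m)"
    using Q by (intro exI[of _ "\<lambda>j. if j = i then Q else 0"]) (auto simp: poly_ring_0)
qed

end

section \<open>SAGBI bases\<close>

lemma is_subalgebra_power:
  assumes "is_subalgebra T" "f \<in> T"
  shows "f ^ n \<in> T"
proof (induction n)
  case 0
  have "Const 1 \<in> T" using assms(1) by (simp only: is_subalgebra_def)
  then show ?case by simp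
qed (use assms in \<open>auto simp: is_subalgebra_def\<close>)

lemma is_subalgebra_sum:
  assumes "is_subalgebra T" "\<And>i. i \<in> A \<Longrightarrow> f i \<in> T"
  shows "sum f A \<in> T"
proof -
  have "Const 0 \<in> T" using assms(1) by (simp only: is_subalgebra_def)
  then show ?thesis using assms
    by (induction A rule: infinite_finite_induct) (auto simp: is_subalgebra_def)
qed

lemma is_subspace_sum:
  assumes "is_subspace T" "\<And>i. i \<in> A \<Longrightarrow> f i \<in> T"
  shows "sum f A \<in> T"
  using assms by (induction A rule: infinite_finite_induct) (auto simp: is_subspace_def)

context sagbi_generators
begin

text \<open>
  Ties between lead monomials are broken so that the two relations get the coprime leading
  monomials \<open>t\<^sub>2\<^sup>p\<close> and \<open>t\<^sub>3\<^sup>p\<close>, which makes them a regular sequence.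
\<close>

definition tless :: "(nat \<Rightarrow>\<^sub>0 nat) \<Rightarrow> (nat \<Rightarrow>\<^sub>0 nat) \<Rightarrow> bool" where
  "tless K L \<longleftrightarrow> grevlex_less (lexp K) (lexp L) \<or> lexp K = lexp L \<and>
     (lookup K 3 < lookup L 3 \<or> lookup K 3 = lookup L 3 \<and> lookup K 2 < lookup L 2)"

lemma wt_add: "wt p (a + a') (b + b') (c + c') = wt p a b c + wt p a' b' c'"
  by (simp add: wt_def algebra_simps)

lemma lexp_add: "lexp (K + L) = lexp K + lexp L"
  by (rule var_exp_eqI) (simp_all add: lookup_add lookup_lexp wt_add algebra_simps)

sublocale T: monomial_order tless "{K. keys K \<subseteq> {..<5}}"
proof
  fix K L J
  show "\<not> tless K K"
    by (simp add: tless_def grevlex.irrefl)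
  show "tless K L \<Longrightarrow> tless L J \<Longrightarrow> tless K J"
    using grevlex.trans[of "lexp K" "lexp L" "lexp J"] by (auto simp: tless_def)
  show "tless K L \<Longrightarrow> tless (K + J) (L + J)"
    using grevlex.add_mono[of "lexp K" "lexp L" "lexp J"]
    by (auto simp: tless_def lexp_add lookup_add)
  assume KL: "K \<in> {K. keys K \<subseteq> {..<5}}" "L \<in> {K. keys K \<subseteq> {..<5}}" "K \<noteq> L"
  \<comment> \<open>\<open>lexp\<close> shows the exponents of x and of the norm directly, and that
    of \<open>f1\<close> through the weight once those of \<open>f2\<close> and \<open>f3\<close>
    agree.\<close>
  have False if eq: "lexp K = lexp L" "lookup K 3 = lookup L 3" "lookup K 2 = lookup L 2"
  proof -
    have "lookup K 0 = lookup L 0" "lookup K 4 = lookup L 4" "lookup K 1 = lookup L 1"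
      using arg_cong[OF eq(1), of "\<lambda>u. lookup u Vx"] arg_cong[OF eq(1), of "\<lambda>u. lookup u Vz"]
        arg_cong[OF eq(1), of "\<lambda>u. lookup u Vy"] eq(2,3) p_gt_1
      by (auto simp: lookup_lexp wt_def)
    then have "K = L"
      using KL eq less_5_cases by (intro exp5_eqI) auto
    then show False using KL by simp
  qed
  then show "tless K L \<or> tless L K"
    using grevlex.total[of "lexp K" "lexp L"] unfolding tless_def
    by (metis UNIV_I linorder_neqE_nat)
qed

lemma wfp_tless: "wfp tless"
proof -
  have "{(K, L). tless K L} \<subseteq> inv_image
      ({(u, v). grevlex_less u v} <*lex*> less_than <*lex*> less_than)
      (\<lambda>K. (lexp K, lookup K 3, lookup K 2))"
    by (auto simp: tless_def)
  moreover have "wf \<dots>"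
    using wfp_grevlex by (intro wf_inv_image wf_lex_prod wf_less_than) (simp add: wfp_def)
  ultimately show ?thesis
    unfolding wfp_def by (rule wf_subset[rotated])
qed

abbreviation "A \<equiv> {f. invariant f}"

lemma eval_at_invariant: "P \<in> poly_ring 5 \<Longrightarrow> eval_at B P \<in> A"
  by (auto simp: eval_at_eq_sum intro!: inv_sum inv_mult inv_Const invariant_power_product)

text \<open>Lead exponents of normal monomials are distinct, so they cannot cancel; in particular
  the normal monomials are linearly independent.\<close>

lemma lead_nspan:
  assumes "keys P \<subseteq> normal" "P \<noteq> 0"
  obtains K c where "K \<in> keys P" "grevlex.lead (eval_at B P) (lexp K) c"
proof -
  have ne: "keys P \<noteq> {}" using assms(2) by simp
  have inj: "inj_on lexp (keys P)" using lexp_inj assms(1) by (rule inj_on_subset)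
  have "grevlex.lead (Const (lookup P K) * power_product B K) (lexp K) (lookup P K * lcf K)"
    if "K \<in> keys P" for K
    using that by (intro lead_Const_mult lead_power_product) (simp add: in_keys_iff)
  then obtain K where "K \<in> keys P"
    "grevlex.lead (\<Sum>K\<in>keys P. Const (lookup P K) * power_product B K) (lexp K) (lookup P K * lcf K)"
    using grevlex.lead_sum_distinct[OF finite_keys ne _ inj subset_UNIV,
        of "\<lambda>K. Const (lookup P K) * power_product B K" "\<lambda>K. lookup P K * lcf K"] by blast
  then show ?thesis
    using that eval_at_eq_sum[OF normal_poly_ring[OF assms(1)]] by simp
qed

lemma lead_invariant:
  assumes "invariant f" "grevlex.lead f u c"
  obtains K where "K \<in> normal" "u = lexp K"
proof -
  obtain P where P: "keys P \<subseteq> normal" "f = eval_at B P"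
    using assms(1) nspan_eq by (auto simp: nspan_def)
  moreover have "P \<noteq> 0"
    using P(2) grevlex.lead_nonzero(2)[OF assms(2)] by auto
  ultimately obtain K d where "K \<in> keys P" "grevlex.lead f (lexp K) d"
    using lead_nspan[of P] by blast
  then show ?thesis
    using that P(1) grevlex.lead_unique(1)[OF assms(2)] by blast
qed

section \<open>Generation and the SAGBI property\<close>

lemma subalgebra_A: "is_subalgebra A"
  by (simp add: is_subalgebra_def inv_Const inv_add inv_mult)

lemma set_B_subset: "set B \<subseteq> A"
  by (simp add: B_def inv_x inv1 inv2 inv3 inv_norm)

lemma hull_B: "is_subalgebra hull (set B) = A"
proof (rule hull_unique)
  show "set B \<subseteq> A" by (rule set_B_subset)
  show "is_subalgebra A" by (rule subalgebra_A)
  fix T assume T: "set B \<subseteq> T" "is_subalgebra T"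
  have pp: "power_product B K \<in> T" for K
  proof -
    have "b ^ n \<in> T" if "b \<in> {Var Vx, f1, f2, f3, orbit_norm}" for b n
      using T that by (intro is_subalgebra_power) (auto simp: B_def)
    then show ?thesis
      using T(2) by (simp add: power_product_B is_subalgebra_def)
  qed
  show "A \<subseteq> T"
  proof
    fix f assume "f \<in> A"
    then obtain P where P: "keys P \<subseteq> normal" "f = eval_at B P"
      using nspan_eq by (auto simp: nspan_def)
    have "Const c * power_product B K \<in> T" for c K
      using T(2) pp[of K] by (simp add: is_subalgebra_def)
    then show "f \<in> T"
      unfolding P(2) eval_at_eq_sum[OF normal_poly_ring[OF P(1)]]
      by (intro is_subalgebra_sum T(2))
  qed
qed

text \<open>The common value of both hulls in the SAGBI condition. Taking all exponents K, and not
  only the normal ones, makes \<open>range lexp\<close> closed under addition and this span an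
  algebra.\<close>

definition lead_algebra :: "(var, 'a) mpoly set" where
  "lead_algebra = {f. keys f \<subseteq> range lexp}"

lemma LMs_A: "LMs A = (\<lambda>u. single u 1) ` range lexp"
proof
  show "LMs A \<subseteq> (\<lambda>u. single u 1) ` range lexp"
  proof
    fix m assume "m \<in> LMs A"
    then obtain f where f: "invariant f" "f \<noteq> 0" "m = LM f" by (auto simp: LMs_def)
    then obtain u c where u: "grevlex.lead f u c" using obtain_lead by blast
    then obtain K where "u = lexp K" using lead_invariant f(1) by blast
    then show "m \<in> (\<lambda>u. single u 1) ` range lexp"
      using f(3) LM_eq[OF u] by blast
  qed
  show "(\<lambda>u. single u 1) ` range lexp \<subseteq> LMs A"
  proof clarify
    fix K
    have "single (lexp K) 1 = LM (power_product B K)"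
      using LM_eq[OF lead_power_product] by simp
    then show "single (lexp K) 1 \<in> LMs A"
      unfolding LMs_def using invariant_power_product power_product_nonzero by blast
  qed
qed

lemma hull_LMs_A: "is_subspace hull (LMs A) = lead_algebra"
proof (rule hull_unique)
  show "LMs A \<subseteq> lead_algebra"
    by (auto simp: LMs_A lead_algebra_def)
  show "is_subspace lead_algebra"
    unfolding is_subspace_def lead_algebra_def
  proof (intro conjI ballI allI; clarsimp)
    fix f g k assume "keys f \<subseteq> range lexp" "keys g \<subseteq> range lexp" "k \<in> keys (f + g)"
    then show "k \<in> range lexp" using keys_add[of f g] by blast
  next
    fix c f k assume "keys f \<subseteq> range lexp" "k \<in> keys (Const c * f)"
    then show "k \<in> range lexp" using keys_mult[of "Const c" f] by (auto simp: Const_def split: if_splits)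
  qed
  fix T assume T: "LMs A \<subseteq> T" "is_subspace T"
  show "lead_algebra \<subseteq> T"
  proof
    fix f assume f: "f \<in> lead_algebra"
    have "single u (lookup f u) \<in> T" if "u \<in> keys f" for u
    proof -
      have "single u 1 \<in> T" using T(1) f that unfolding LMs_A lead_algebra_def by blast
      then have "Const (lookup f u) * single u 1 \<in> T" using T(2) by (simp only: is_subspace_def)
      then show ?thesis by (simp add: Const_def mult_single)
    qed
    then have "(\<Sum>u\<in>keys f. single u (lookup f u)) \<in> T"
      by (intro is_subspace_sum T(2))
    then show "f \<in> T" by (simp add: sum_single_lookup)
  qed
qed

lemma single_power: "(single u 1 :: ('v, 'a) mpoly) ^ n = single (\<Sum>i<n. u) 1"
  by (induction n) (simp_all add: mult_single add.commute)

lemma B_nonzero: "b \<in> set B \<Longrightarrow> b \<noteq> 0"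
  using grevlex.lead_nonzero(2)[OF lead_Var, of Vx, where ?'a = 'a] grevlex.lead_nonzero(2)[OF lead1] grevlex.lead_nonzero(2)[OF lead2]
    grevlex.lead_nonzero(2)[OF lead3] norm_nonzero
  by (auto simp: B_def)

lemma hull_LMs_B: "is_subalgebra hull (LMs (set B)) = lead_algebra"
proof (rule hull_unique)
  have "LMs (set B) \<subseteq> LMs A"
    using set_B_subset unfolding LMs_def by blast
  then show "LMs (set B) \<subseteq> lead_algebra"
    by (auto simp: LMs_A lead_algebra_def)
  show "is_subalgebra lead_algebra"
    unfolding is_subalgebra_def lead_algebra_def
  proof (intro conjI ballI allI; clarsimp)
    fix c :: 'a and k assume "k \<in> keys (Const c :: (var, 'a) mpoly)"
    then have "k = lexp 0"
      by (auto simp: Const_def lexp_def wt_def split: if_splits)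
    then show "k \<in> range lexp" by blast
  next
    fix f g k assume "keys f \<subseteq> range lexp" "keys g \<subseteq> range lexp" "k \<in> keys (f + g)"
    then show "k \<in> range lexp" using keys_add[of f g] by blast
  next
    fix f g k assume fg: "keys f \<subseteq> range lexp" "keys g \<subseteq> range lexp" "k \<in> keys (f * g)"
    then obtain K L where "k = lexp K + lexp L" using keys_mult[of f g] by blast
    then show "k \<in> range lexp" by (simp flip: lexp_add)
  qed
  fix T assume T: "LMs (set B) \<subseteq> T" "is_subalgebra T"
  show "lead_algebra \<subseteq> T"
  proof
    fix f assume f: "f \<in> lead_algebra"
    have LM: "LM b \<in> T" if "b \<in> set B" for b
      using T(1) that B_nonzero by (auto simp: LMs_def)
    have "single (lexp K) 1 \<in> T" for K
    proof -
      have gen: "single (single v (n * m)) 1 \<in> T"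
        if "b \<in> set B" "grevlex.lead b (single v m) c" for b v m c n
        using is_subalgebra_power[OF T(2) LM[OF that(1)], of n]
        by (simp add: LM_eq[OF that(2)] single_power nsmul_single)
      have *: "single (single Vx (n * 1)) 1 \<in> T" "single (single Vy (n * p^2)) 1 \<in> T"
        "single (single Vy (n * (p^2 + 2 * p))) 1 \<in> T" "single (single Vy (n * (p^3 + 2))) 1 \<in> T"
        "single (single Vz (n * card G)) 1 \<in> T" for n
        by (rule gen[OF _ lead_Var] gen[OF _ lead1] gen[OF _ lead2] gen[OF _ lead3]
            gen[OF _ lead_norm]; simp add: B_def)+
      have "single (single Vx (lookup K 0 * 1)) 1 * single (single Vy (lookup K 1 * p^2)) 1
          * single (single Vy (lookup K 2 * (p^2 + 2 * p))) 1
          * single (single Vy (lookup K 3 * (p^3 + 2))) 1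
          * single (single Vz (lookup K 4 * card G)) 1 \<in> T"
      proof -
        have mult: "f * g \<in> T" if "f \<in> T" "g \<in> T" for f g
          using T(2) that by (simp add: is_subalgebra_def)
        then show ?thesis by (intro mult *)
      qed
      then show ?thesis
        by (simp add: mult_single lexp_def wt_def card_G single_add ac_simps)
    qed
    moreover have "Const (lookup f u) \<in> T" for u using T(2) by (simp add: is_subalgebra_def)
    ultimately have "Const (lookup f u) * single u 1 \<in> T" if "u \<in> keys f" for u
      using f that T(2) by (auto simp: lead_algebra_def is_subalgebra_def)
    then have "(\<Sum>u\<in>keys f. single u (lookup f u)) \<in> T"
      by (intro is_subalgebra_sum T(2)) (simp add: Const_def mult_single)
    then show "f \<in> T" by (simp add: sum_single_lookup)
  qed
qed

lemma sagbi_basis_B: "sagbi_basis (set B) A"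
  by (simp add: sagbi_basis_def subalgebra_A set_B_subset hull_LMs_A hull_LMs_B)

section \<open>Subduction and relations\<close>

lemma lead_scaled_power_product:
  "c \<noteq> 0 \<Longrightarrow> grevlex.lead (Const c * power_product B K) (lexp K) (c * lcf K)"
  by (intro lead_Const_mult lead_power_product)

text \<open>The lead exponent of a nonzero invariant is that of a normal monomial, so a cancellation
  is always possible, stays among the invariants and lowers the lead exponent.\<close>

lemma subducts_exists: "invariant f \<Longrightarrow> \<exists>P. subducts_to_zero B f P"
proof -
  have *: "\<forall>f c. invariant f \<longrightarrow> grevlex.lead f u c \<longrightarrow> (\<exists>P. subducts_to_zero B f P)" for u
  proof (induction u rule: wfp_induct_rule[OF wfp_grevlex])
    case (1 u)
    show ?case
    proof (intro allI impI)
      fix f c assume f: "invariant f" "grevlex.lead f u c"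
      obtain K where K: "K \<in> normal" "u = lexp K" using lead_invariant[OF f] .
      define d where "d = c / lcf K"
      have "d \<noteq> 0" using grevlex.lead_nonzero(1)[OF f(2)] lcf_nonzero by (simp add: d_def)
      then have lead: "grevlex.lead (Const d * power_product B K) u c"
        using lead_scaled_power_product[of d K] lcf_nonzero by (simp add: d_def K(2))
      define f' where "f' = f - Const d * power_product B K"
      have below: "grevlex.below u f'"
        unfolding f'_def using f(2) lead by (rule grevlex.below_diff_lead)
      have inv': "invariant f'"
        unfolding f'_def by (intro inv_diff f inv_mult inv_Const invariant_power_product)
      have "\<exists>P. subducts_to_zero B f' P"
      proof (cases "f' = 0")
        case False
        then obtain v e where v: "grevlex.lead f' v e" using obtain_lead by blast
        then have "grevlex_less v u"
          using below grevlex.lead_in_keys[OF v] by (auto simp: grevlex.below_def)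
        then show ?thesis using 1 v inv' by blast
      qed (use subducts_to_zero.stop in auto)
      then obtain P where "subducts_to_zero B f' P" by blast
      then have "subducts_to_zero B f (P + single K d)"
        using K(1) grevlex.lead_nonzero(2)[OF f(2)] LT_eq[OF f(2)] LT_eq[OF lead]
        by (intro subducts_to_zero.cancel) (auto simp: f'_def normal_def)
      then show "\<exists>P. subducts_to_zero B f P" by blast
    qed
  qed
  assume "invariant f"
  then show ?thesis
  proof (cases "f = 0")
    case False
    then obtain u c where "grevlex.lead f u c" using obtain_lead by blast
    then show ?thesis using * \<open>invariant f\<close> by blast
  qed (use subducts_to_zero.stop in auto)
qed

text \<open>Holds for whatever choices the subduction makes: no monomial it collects exceeds the
  lead exponent at the start. The clause for f = 0 covers the case without a lead exponent.\<close>

lemma subducts_to_zero_properties: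
  assumes "subducts_to_zero B f P"
  shows "P \<in> poly_ring 5 \<and> eval_at B P = f \<and> (f = 0 \<longrightarrow> P = 0) \<and>
    (\<forall>u c. grevlex.lead f u c \<longrightarrow> (\<forall>K\<in>keys P. lexp K = u \<or> grevlex_less (lexp K) u))"
  using assms
proof induction
  case stop
  then show ?case by (simp add: poly_ring_0)
next
  case (cancel f K c P)
  define f' where "f' = f - Const c * power_product B K"
  obtain u d where u: "grevlex.lead f u d" "grevlex.lead (Const c * power_product B K) u d"
    using LT_eq_iff_lead[OF cancel.hyps(1,3)] .
  have "c \<noteq> 0" using grevlex.lead_nonzero(2)[OF u(2)] by auto
  then have K: "lexp K = u"
    using grevlex.lead_unique(1)[OF u(2) lead_scaled_power_product] by simp
  have below: "grevlex.below u f'"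
    unfolding f'_def using u by (rule grevlex.below_diff_lead)
  have "lexp L = u \<or> grevlex_less (lexp L) u" if "L \<in> keys (P + single K c)" for L
  proof (cases "L \<in> keys P")
    case True
    then have "f' \<noteq> 0" using cancel.IH by (auto simp: f'_def)
    then obtain v e where v: "grevlex.lead f' v e" using obtain_lead by blast
    then have "grevlex_less v u"
      using below grevlex.lead_in_keys[OF v] by (auto simp: grevlex.below_def)
    moreover have "lexp L = v \<or> grevlex_less (lexp L) v"
      using cancel.IH True v by (auto simp: f'_def)
    ultimately show ?thesis using grevlex.trans by blast
  next
    case False
    then have "L = K" using that keys_add[of P "single K c"] by (auto split: if_splits)
    then show ?thesis using K by simp
  qed
  moreover have "v = u" if "grevlex.lead f v e" for v e
    using grevlex.lead_unique(1)[OF that u(1)] .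
  moreover have "P + single K c \<in> poly_ring 5"
    using cancel by (intro poly_ring_add poly_ring_single) auto
  moreover have "eval_at B (P + single K c) = f"
    using cancel by (simp add: eval_at.hom_add eval_at_single)
  ultimately show ?case using cancel.hyps(1) by auto
qed

lemma subduction_relation_exists:
  assumes "keys I \<subseteq> {..<5}" "keys J \<subseteq> {..<5}" "lexp I = lexp J"
  shows "\<exists>R. subduction_relation B I J R"
proof -
  define c where "c = lcf I / lcf J"
  have "c \<noteq> 0" by (simp add: c_def lcf_nonzero)
  then have "grevlex.lead (Const c * power_product B J) (lexp I) (lcf I)"
    using lead_scaled_power_product[of c J] lcf_nonzero[of J] by (simp add: c_def assms(3))
  then have "LT (power_product B I) = LT (Const c * power_product B J)"
    by (simp only: LT_eq[OF lead_power_product] LT_eq)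
  moreover obtain P where "subducts_to_zero B (power_product B I - Const c * power_product B J) P"
    using subducts_exists[OF inv_diff[OF invariant_power_product
      inv_mult[OF inv_Const invariant_power_product]]] by blast
  moreover have "tete_a_tete B I J"
    using assms LM_eq[OF lead_power_product]
    by (simp add: tete_a_tete_def power_product_nonzero)
  ultimately show ?thesis
    unfolding subduction_relation_def by blast
qed

text \<open>J ties with I in \<open>lexp\<close> and loses by the tie-breaking; everything collected
  by the subduction is below I already in \<open>lexp\<close>, because the lead terms of the pair
  cancel.\<close>

lemma subduction_relation_properties:
  assumes "subduction_relation B I J R" "tless J I"
  shows "R \<in> poly_ring 5" "eval_at B R = 0" "T.lead R I 1"
proof -
  obtain c P where R: "tete_a_tete B I J"
    "LT (power_product B I) = LT (Const c * power_product B J)"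
    "subducts_to_zero B (power_product B I - Const c * power_product B J) P"
    "R = single I 1 - single J c - P"
    using assms(1) by (auto simp: subduction_relation_def)
  have IJ: "keys I \<subseteq> {..<5}" "keys J \<subseteq> {..<5}" using R(1) by (simp_all add: tete_a_tete_def)
  define f where "f = power_product B I - Const c * power_product B J"
  have P: "P \<in> poly_ring 5" "eval_at B P = f" "f = 0 \<longrightarrow> P = 0"
    "\<And>u c. grevlex.lead f u c \<Longrightarrow> (\<forall>K\<in>keys P. lexp K = u \<or> grevlex_less (lexp K) u)"
    using subducts_to_zero_properties[OF R(3)] by (auto simp: f_def)
  show "R \<in> poly_ring 5"
    unfolding R(4) by (intro poly_ring_diff poly_ring_single IJ P(1))
  show "eval_at B R = 0"
    using IJ by (simp add: R(4) eval_at.hom_minus eval_at_single P(2) f_def)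
  obtain u d where u: "grevlex.lead (power_product B I) u d"
    "grevlex.lead (Const c * power_product B J) u d"
    using LT_eq_iff_lead[OF power_product_nonzero R(2)] .
  have "u = lexp I" using grevlex.lead_unique(1)[OF u(1) lead_power_product] .
  then have below: "grevlex.below (lexp I) f"
    unfolding f_def using u grevlex.below_diff_lead by blast
  have "T.below I P"
    unfolding T.below_def
  proof
    fix K assume K: "K \<in> keys P"
    then have "f \<noteq> 0" using P(3) by auto
    then obtain v e where v: "grevlex.lead f v e" using obtain_lead by blast
    then have "grevlex_less v (lexp I)"
      using below grevlex.lead_in_keys[OF v] by (auto simp: grevlex.below_def)
    then have "grevlex_less (lexp K) (lexp I)"
      using P(4)[OF v] K by (metis grevlex.trans)
    then show "tless K I" by (simp add: tless_def)
  qed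
  then have "T.below I (single J c + P)"
    using assms(2) by (intro T.below_add T.below_single)
  then have "T.below I (- (single J c + P))"
    by (rule T.below_uminus)
  then have "T.lead (single I 1 + - (single J c + P)) I 1"
    by (intro T.lead_add_below T.lead_single) simp_all
  then show "T.lead R I 1" by (simp add: R(4) algebra_simps)
qed

text \<open>Division with remainder by monic relations: a monomial divisible by a lead exponent is
  replaced by smaller ones, which terminates since \<open>tless\<close> is well-founded.\<close>

lemma reduce:
  fixes rs :: "(nat, 'a) mpoly list" and Is :: "(nat \<Rightarrow>\<^sub>0 nat) list"
  assumes rs: "\<And>i. i < length rs \<Longrightarrow> rs ! i \<in> poly_ring 5 \<and> T.lead (rs ! i) (Is ! i) 1"
    and P: "P \<in> poly_ring 5"
  obtains Q where "P - Q \<in> ideal_gen (poly_ring 5) rs" "Q \<in> poly_ring 5"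
    "\<And>K i L. K \<in> keys Q \<Longrightarrow> i < length rs \<Longrightarrow> K \<noteq> L + Is ! i"
proof -
  let ?I = "ideal_gen (poly_ring 5) rs"
  let ?N = "{K. keys K \<subseteq> {..<5} \<and> (\<forall>i<length rs. \<forall>L. K \<noteq> L + Is ! i)}"
  define red where "red P \<longleftrightarrow> (\<exists>Q. P - Q \<in> ?I \<and> keys Q \<subseteq> ?N)" for P
  have red_0: "red 0"
    unfolding red_def by (intro exI[of _ 0]) (simp add: ideal_gen_0)
  have red_add: "red (P + P')" if "red P" "red P'" for P P'
  proof -
    from that obtain Q Q' where Q: "P - Q \<in> ?I" "keys Q \<subseteq> ?N" "P' - Q' \<in> ?I" "keys Q' \<subseteq> ?N"
      unfolding red_def by blast
    then have "(P - Q) + (P' - Q') \<in> ?I" by (intro ideal_gen_add)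
    moreover have "keys (Q + Q') \<subseteq> ?N" using keys_add[of Q Q'] Q by blast
    ultimately show ?thesis
      unfolding red_def by (intro exI[of _ "Q + Q'"]) (simp add: algebra_simps)
  qed
  have red_sum: "red (sum f X)" if "\<And>i. i \<in> X \<Longrightarrow> red (f i)" for f and X :: "(nat \<Rightarrow>\<^sub>0 nat) set"
    using that by (induction X rule: infinite_finite_induct) (auto intro: red_0 red_add)
  have red_keys: "red P" if "\<And>K c. K \<in> keys P \<Longrightarrow> red (single K c)" for P
  proof -
    have "red (\<Sum>K\<in>keys P. single K (lookup P K))" by (intro red_sum that)
    then show ?thesis by (simp add: sum_single_lookup)
  qed
  have single: "keys K \<subseteq> {..<5} \<longrightarrow> (\<forall>c. red (single K c))" for K
  proof (induction K rule: wfp_induct_rule[OF wfp_tless])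
    case (1 K)
    show ?case
    proof (intro impI allI)
      fix c assume K: "keys K \<subseteq> {..<5}"
      show "red (single K c)"
      proof (cases "K \<in> ?N")
        case True
        then have "keys (single K c) \<subseteq> ?N" by auto
        then show ?thesis
          unfolding red_def by (intro exI[of _ "single K c"]) (simp add: ideal_gen_0)
      next
        case False
        then obtain i L where i: "i < length rs" "K = L + Is ! i" using K by auto
        have L: "keys L \<subseteq> {..<5}"
        proof
          fix x assume "x \<in> keys L"
          then have "x \<in> keys K" by (simp add: i(2) in_keys_iff lookup_add)
          then show "x \<in> {..<5}" using K by auto
        qed
        define S where "S = rs ! i - single (Is ! i) 1"
        have below: "T.below (Is ! i) S" using rs[OF i(1)] by (simp add: T.lead_def S_def)
        have below: "T.below K (single L c * S)"
          unfolding i(2) by (rule T.below_single_mult[OF below])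
        have "single L c * rs ! i \<in> poly_ring 5"
          using rs[OF i(1)] L by (intro poly_ring_mult poly_ring_single) auto
        then have ring: "single L c * S \<in> poly_ring 5"
          using K by (simp add: S_def right_diff_distrib mult_single i(2)[symmetric]
            poly_ring_diff poly_ring_single)
        have "red (- (single L c * S))"
        proof (rule red_keys)
          fix K' c' assume "K' \<in> keys (- (single L c * S))"
          with below ring have "tless K' K" "keys K' \<subseteq> {..<5}"
            unfolding T.below_def poly_ring_iff by auto
          then show "red (single K' c')" using 1 by blast
        qed
        then obtain Q where Q: "- (single L c * S) - Q \<in> ?I" "keys Q \<subseteq> ?N"
          unfolding red_def by blast
        have "single L c * rs ! i + (- (single L c * S) - Q) \<in> ?I"
          using L i(1) by (intro ideal_gen_add Q ideal_gen_nth poly_ring_single)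
        also have "single L c * rs ! i + (- (single L c * S) - Q) = single K c - Q"
          by (simp add: S_def right_diff_distrib mult_single i(2))
        finally show ?thesis unfolding red_def using Q(2) by blast
      qed
    qed
  qed
  have "red P"
    by (rule red_keys) (use P single in \<open>auto simp: poly_ring_iff\<close>)
  then obtain Q where "P - Q \<in> ?I" "keys Q \<subseteq> ?N" unfolding red_def by blast
  then show ?thesis
    by (intro that[of Q]) (auto simp: poly_ring_iff)
qed

section \<open>The two pairs with equal lead monomials and their relations\<close>

abbreviation "I1 \<equiv> single 2 p :: nat \<Rightarrow>\<^sub>0 nat"
abbreviation "J1 \<equiv> single 1 (p + 2) :: nat \<Rightarrow>\<^sub>0 nat"
abbreviation "I2 \<equiv> single 3 p :: nat \<Rightarrow>\<^sub>0 nat"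
abbreviation "J2 \<equiv> single 2 1 + single 1 (p^2 - 1) :: nat \<Rightarrow>\<^sub>0 nat"

lemma keys_tete:
  "keys I1 \<subseteq> {..<5}" "keys J1 \<subseteq> {..<5}" "keys I2 \<subseteq> {..<5}" "keys J2 \<subseteq> {..<5}"
  using keys_add[of "single 2 1 :: nat \<Rightarrow>\<^sub>0 nat" "single 1 (p^2 - 1)"] by (auto split: if_splits)

lemma lexp_tete: "lexp I1 = lexp J1" "lexp I2 = lexp J2"
proof -
  have "p^2 \<ge> 1" using p_gt_1 by simp
  have "p * p^3 = p^2 * p^2"
    by (simp add: power2_eq_square power3_eq_cube)
  also have "\<dots> = (p^2 - Suc 0) * p^2 + p^2"
    using \<open>p^2 \<ge> 1\<close> by (metis One_nat_def add_mult_distrib le_add_diff_inverse2 mult_1)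
  finally have eq: "p * p^3 = (p^2 - Suc 0) * p^2 + p^2" .
  show "lexp I1 = lexp J1"
    by (rule var_exp_eqI)
       (simp_all add: lookup_lexp lookup_single wt_def algebra_simps power2_eq_square)
  show "lexp I2 = lexp J2"
    by (rule var_exp_eqI)
       (simp_all add: lookup_lexp lookup_add lookup_single wt_def eq)
qed

text \<open>Only the tie-breaking decides: the power of \<open>f3\<close> is looked at first, then
  that of \<open>f2\<close>.\<close>

lemma tless_tete: "tless J1 I1" "tless J2 I2"
  using p_gt_1 lexp_tete by (simp_all add: tless_def lookup_add lookup_single)

context
  fixes R1 R2
  assumes R1: "subduction_relation B I1 J1 R1" and R2: "subduction_relation B I2 J2 R2"
begin

lemmas props1 = subduction_relation_properties[OF R1 tless_tete(1)]
lemmas props2 = subduction_relation_properties[OF R2 tless_tete(2)]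

text \<open>Dividing a relation by \<open>R1\<close> and \<open>R2\<close> leaves a normal remainder
  that still evaluates to zero, and independence of the normal monomials forces it to
  vanish.\<close>

lemma relations_B: "relations B = ideal_gen (poly_ring (length B)) [R1, R2]"
proof
  have "eval_at B P = 0 \<and> P \<in> poly_ring 5" if P: "P \<in> ideal_gen (poly_ring 5) [R1, R2]" for P
  proof -
    obtain a where "P = (\<Sum>i<length [R1, R2]. a i * [R1, R2] ! i)"
      "\<forall>i<length [R1, R2]. a i \<in> poly_ring 5"
      using P by (auto simp: ideal_gen_def)
    then have "P = a 0 * R1 + a 1 * R2" "a 0 \<in> poly_ring 5" "a 1 \<in> poly_ring 5"
      by (simp_all add: lessThan_Suc numeral_2_eq_2 add.commute)
    then show ?thesis using props1 props2
      by (simp add: eval_at.hom_add eval_at.hom_mult poly_ring_add poly_ring_mult)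
  qed
  then show "ideal_gen (poly_ring (length B)) [R1, R2] \<subseteq> relations B"
    by (auto simp: relations_def)
  show "relations B \<subseteq> ideal_gen (poly_ring (length B)) [R1, R2]"
  proof
    fix P assume "P \<in> relations B"
    then have P: "P \<in> poly_ring 5" "eval_at B P = 0" by (simp_all add: relations_def)
    have "[R1, R2] ! i \<in> poly_ring 5 \<and> T.lead ([R1, R2] ! i) ([I1, I2] ! i) 1"
      if "i < length [R1, R2]" for i
      using that props1 props2 by (cases i) auto
    then obtain Q where Q: "P - Q \<in> ideal_gen (poly_ring 5) [R1, R2]" "Q \<in> poly_ring 5"
      "\<And>K i L. K \<in> keys Q \<Longrightarrow> i < length [R1, R2] \<Longrightarrow> K \<noteq> L + [I1, I2] ! i"
      using reduce[of "[R1, R2]" "[I1, I2]" P] P(1) by blast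
    have "keys Q \<subseteq> normal"
    proof
      fix K assume K: "K \<in> keys Q"
      have sub: "K = (K - single j n) + single j n" if "n \<le> lookup K j" for j n
        using that by (intro poly_mapping_eqI) (auto simp: lookup_add lookup_minus lookup_single when_def)
      have "lookup K 2 < p"
        using Q(3)[OF K, of 0 "K - I1"] sub[of p 2] by (auto simp: not_less[symmetric])
      moreover have "lookup K 3 < p"
        using Q(3)[OF K, of 1 "K - I2"] sub[of p 3] by (auto simp: not_less[symmetric])
      ultimately show "K \<in> normal" using K Q(2) by (auto simp: normal_def poly_ring_iff)
    qed
    moreover have "eval_at B Q = 0"
      using P(2) \<open>\<And>P. P \<in> ideal_gen (poly_ring 5) [R1, R2] \<Longrightarrow> eval_at B P = 0 \<and> P \<in> poly_ring 5\<close>[OF Q(1)]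
      by (simp add: eval_at.hom_minus)
    ultimately have "Q = 0"
      using lead_nspan[of Q] grevlex.lead_nonzero(2) by metis
    then show "P \<in> ideal_gen (poly_ring (length B)) [R1, R2]" using Q(1) by simp
  qed
qed

text \<open>The relations have the coprime lead monomials t_2^p and t_3^p, and the first is a
  nonzero element of a domain.\<close>

lemma regular_sequence_B: "regular_sequence (poly_ring (length B)) [R1, R2]"
  unfolding regular_sequence_def
proof (intro conjI allI ballI impI)
  show "set [R1, R2] \<subseteq> poly_ring (length B)" using props1 props2 by simp
  \<comment> \<open>The ideal is that of all relations, and 1 is not a relation.\<close>
  have "eval_at B 1 \<noteq> 0" by simp
  then have "1 \<notin> relations B" by (simp add: relations_def)
  then show "ideal_gen (poly_ring (length B)) [R1, R2] \<noteq> poly_ring (length B)"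
    using poly_ring_1 by (metis relations_B)
  fix i g assume i: "i < length [R1, R2]" and g: "g \<in> poly_ring (length B)"
    and mem: "[R1, R2] ! i * g \<in> ideal_gen (poly_ring (length B)) (take i [R1, R2])"
  consider "i = 0" | "i = 1" using i by force
  then show "g \<in> ideal_gen (poly_ring (length B)) (take i [R1, R2])"
  proof cases
    case 1
    then have "R1 * g = 0" using mem by (simp add: ideal_gen_def)
    then have "g = 0" using T.lead_nonzero(2)[OF props1(3)] by simp
    then show ?thesis by (simp add: ideal_gen_0)
  next
    case 2
    have "[R1] ! i \<in> poly_ring 5 \<and> T.lead ([R1] ! i) ([I1] ! i) 1" if "i < length [R1]" for i
      using that props1 by auto
    then obtain Q where Q: "g - Q \<in> ideal_gen (poly_ring 5) [R1]" "Q \<in> poly_ring 5"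
      "\<And>K i L. K \<in> keys Q \<Longrightarrow> i < length [R1] \<Longrightarrow> K \<noteq> L + [I1] ! i"
      using reduce[of "[R1]" "[I1]" g] g by auto
    have "- R2 \<in> poly_ring 5" using props2 by (simp add: poly_ring_uminus)
    then have "- R2 * (g - Q) \<in> ideal_gen (poly_ring 5) [R1]"
      by (rule ideal_gen_mult[OF Q(1)])
    moreover have "R2 * g \<in> ideal_gen (poly_ring 5) [R1]" using mem 2 by simp
    ultimately have "R2 * g + - R2 * (g - Q) \<in> ideal_gen (poly_ring 5) [R1]"
      by (intro ideal_gen_add)
    then obtain a where "R2 * g + - R2 * (g - Q) = (\<Sum>i<length [R1]. a i * [R1] ! i)"
      "\<forall>i<length [R1]. a i \<in> poly_ring 5"
      by (auto simp: ideal_gen_def)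
    then have "R2 * Q = a 0 * R1" "a 0 \<in> poly_ring 5"
      by (simp_all add: algebra_simps)
    then obtain a where a: "R2 * Q = a * R1" "a \<in> poly_ring 5" by blast
    \<comment> \<open>Comparing lead exponents in \<open>R2 * Q = a * R1\<close> gives t_3^p t^K =
      t_2^p t^L. So t_2^p divides t^K, although the remainder Q contains no such monomial.\<close>
    have "Q = 0"
    proof (rule ccontr)
      assume "Q \<noteq> 0"
      then obtain K d where K: "T.lead Q K d" "K \<in> keys Q"
        using T.lead_exists[of Q] Q(2) by (auto simp: poly_ring_iff)
      have "a \<noteq> 0"
        using a(1) \<open>Q \<noteq> 0\<close> T.lead_nonzero(2)[OF props2(3)] by auto
      moreover have "keys a \<subseteq> {K. keys K \<subseteq> {..<5}}" using a(2) by (simp add: poly_ring_iff)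
      ultimately obtain L e where L: "T.lead a L e"
        by (rule T.lead_exists)
      have "T.lead (R2 * Q) (I2 + K) (1 * d)" using props2(3) K(1) by (rule T.lead_mult)
      moreover have "T.lead (R2 * Q) (L + I1) (e * 1)"
        unfolding a(1) using L props1(3) by (rule T.lead_mult)
      ultimately have eq: "I2 + K = L + I1" by (rule T.lead_unique(1))
      have "K = (K - I1) + I1"
        using arg_cong[OF eq, of "\<lambda>u. lookup u 2"]
        by (intro poly_mapping_eqI) (auto simp: lookup_add lookup_minus lookup_single when_def)
      then show False using Q(3)[OF K(2), of 0 "K - I1"] by simp
    qed
    then show ?thesis using Q(1) 2 by simp
  qed
qed

end

theorem presentation:
  "sagbi_basis (set B) A"
  "is_subalgebra hull (set B) = A"
  "complete_intersection A"
  "\<exists>R. subduction_relation B I1 J1 R"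
  "\<exists>R. subduction_relation B I2 J2 R"
  "subduction_relation B I1 J1 R1 \<Longrightarrow> subduction_relation B I2 J2 R2 \<Longrightarrow>
     relations B = ideal_gen (poly_ring (length B)) [R1, R2]"
proof -
  show "sagbi_basis (set B) A" by (rule sagbi_basis_B)
  show "is_subalgebra hull (set B) = A" by (rule hull_B)
  show ex1: "\<exists>R. subduction_relation B I1 J1 R"
    by (intro subduction_relation_exists keys_tete lexp_tete)
  show ex2: "\<exists>R. subduction_relation B I2 J2 R"
    by (intro subduction_relation_exists keys_tete lexp_tete)
  show "subduction_relation B I1 J1 R1 \<Longrightarrow> subduction_relation B I2 J2 R2 \<Longrightarrow>
     relations B = ideal_gen (poly_ring (length B)) [R1, R2]"
    by (rule relations_B)
  obtain R1 R2 where R: "subduction_relation B I1 J1 R1" "subduction_relation B I2 J2 R2"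
    using ex1 ex2 by blast
  have "eval_at B ` poly_ring (length B) = A"
  proof
    show "eval_at B ` poly_ring (length B) \<subseteq> A" using eval_at_invariant by auto
    show "A \<subseteq> eval_at B ` poly_ring (length B)"
      unfolding nspan_eq[symmetric] nspan_def using normal_poly_ring by blast
  qed
  then show "complete_intersection A"
    unfolding complete_intersection_def
    using regular_sequence_B[OF R] relations_B[OF R] by blast
qed

end

section \<open>Lead terms of the second and third generator\<close>

text \<open>The letters a, b, c, d, e stand for the minors 1234, 1235, 1245, 1345, 2345 and b', c',
  d', e' for 1236, 1246, 1346, 2346. Only additivity of the p-th power is used, so the identities
  can be proved with letters in any such domain.\<close>

locale frobenius_ring =
  fixes p :: nat and x y z a b c d e b' c' d' e' :: "'r::idom"
  assumes frob: "\<And>u v :: 'r. (u + v) ^ p = u ^ p + v ^ p"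
    and odd_p: "odd p" and p_ge: "p \<ge> 5"
begin

section \<open>Shape of \<open>f1\<close> and \<open>f12346\<close> and the effect of a
  shift\<close>

definition "\<delta> = y^2 - x * z"

definition "t = b * \<delta> ^ p + c * x^p * y^p + d * \<delta> * x^(2*p-2) + e * x^(2*p-1) * y"

definition "u = b' * \<delta> ^ p + c' * x^p * y^p + d' * \<delta> * x^(2*p-2) + e' * x^(2*p-1) * y"

definition "g1 = a * y^(p^2) + x^(p^2-2*p) * t"

definition "g = - a * \<delta>^(p^2) + x^(2*p^2-2*p) * u"

lemma p_sq_ge: "p^2 \<ge> 5 * p"
  using p_ge by (simp add: power2_eq_square)

lemma p_cube_ge: "p^3 \<ge> 5 * p^2"
  using p_ge by (simp add: power2_eq_square power3_eq_cube)

lemma x_pow: "i + j = k \<Longrightarrow> x^i * x^j = x^k"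
  by (simp add: power_add[symmetric])

lemma g1_eq:
  "a * y^(p^2) + b * \<delta>^p * x^(p^2-2*p) + c * x^(p^2-p) * y^p + d * \<delta> * x^(p^2-2) + e * x^(p^2-1) * y = g1"
proof -
  have "x^(p^2-p) = x^(p^2-2*p) * x^p" "x^(p^2-2) = x^(p^2-2*p) * x^(2*p-2)"
    "x^(p^2-1) = x^(p^2-2*p) * x^(2*p-1)"
    using p_sq_ge p_ge by (simp_all add: x_pow)
  then show ?thesis by (simp add: g1_def t_def algebra_simps)
qed

lemma g_eq:
  "- a * \<delta>^(p^2) + b' * \<delta>^p * x^(2*p^2-2*p) + c' * x^(2*p^2-p) * y^p + d' * \<delta> * x^(2*p^2-2)
    + e' * x^(2*p^2-1) * y = g"
proof -
  have "x^(2*p^2-p) = x^(2*p^2-2*p) * x^p" "x^(2*p^2-2) = x^(2*p^2-2*p) * x^(2*p-2)"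
    "x^(2*p^2-1) = x^(2*p^2-2*p) * x^(2*p-1)"
    using p_sq_ge p_ge by (simp_all add: x_pow)
  then show ?thesis by (simp add: g_def u_def algebra_simps)
qed

lemma frob_uminus: "(- v :: 'r) ^ p = - (v ^ p)"
  using odd_p by (rule power_minus_odd)

lemma frob_diff: "(v - w :: 'r) ^ p = v ^ p - w ^ p"
  using frob[of v "- w"] by (simp add: frob_uminus)

lemma delta_p: "\<delta> ^ p = y^(2*p) - x^p * z^p"
  by (simp add: \<delta>_def frob_diff power_mult power_mult_distrib)

lemma delta_p2: "\<delta> ^ (p^2) = (y^(p^2))^2 - x^(p^2) * z^(p^2)"
proof -
  have "\<delta> ^ (p^2) = (\<delta> ^ p) ^ p" by (simp add: power2_eq_square power_mult)
  also have "\<dots> = (y^(2*p))^p - (x^p)^p * (z^p)^p"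
    by (simp add: delta_p frob_diff power_mult_distrib)
  also have "\<dots> = (y^(p^2))^2 - x^(p^2) * z^(p^2)"
    by (simp add: power_mult[symmetric] power2_eq_square[of p] mult_ac)
  finally show ?thesis .
qed

text \<open>As p-th powers are additive, a shift adds only a multiple of x^(p^2). Its coefficient is
  the left side of the Cramer relation among rows 1 to 5 when (s, r) is a column of the generic
  matrix.\<close>

lemma g1_shift:
  "a * (y + s * x)^(p^2) + b * (\<delta> - r * x^2)^p * x^(p^2-2*p) + c * x^(p^2-p) * (y + s * x)^p
     + d * (\<delta> - r * x^2) * x^(p^2-2) + e * x^(p^2-1) * (y + s * x)
   = g1 + (e * s - d * r + c * s^p - b * r^p + a * s^(p^2)) * x^(p^2)"
proof -
  have y: "(y + s * x)^(p^2) = y^(p^2) + s^(p^2) * x^(p^2)"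
    by (simp add: power2_eq_square[of p] power_mult frob power_mult_distrib)
  have x: "x^(p^2) = x^(p^2-2*p) * x^(2*p)" "x^(p^2) = x^(p^2-p) * x^p"
    "x^(p^2) = x^(p^2-2) * x^2" "x^(p^2) = x^(p^2-1) * x"
    unfolding power_add[symmetric] power_Suc2[symmetric]
    by (rule arg_cong[where f = "\<lambda>n. x^n"], use p_sq_ge p_ge in simp)+
  have dp: "(\<delta> - r * x^2)^p = \<delta>^p - r^p * x^(2*p)"
    by (simp add: frob_diff power_mult_distrib power_mult)
  have *: "b * r^p * x^(p^2) = b * r^p * (x^(p^2-2*p) * x^(2*p))" "c * s^p * x^(p^2) = c * s^p * (x^(p^2-p) * x^p)"
    "d * r * x^(p^2) = d * r * (x^(p^2-2) * x^2)" "e * s * x^(p^2) = e * s * (x^(p^2-1) * x)"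
    using x by metis+
  have "(e * s - d * r + c * s^p - b * r^p + a * s^(p^2)) * x^(p^2)
     = e * s * (x^(p^2-1) * x) - d * r * (x^(p^2-2) * x^2) + c * s^p * (x^(p^2-p) * x^p)
       - b * r^p * (x^(p^2-2*p) * x^(2*p)) + a * s^(p^2) * x^(p^2)"
    by (simp only: distrib_right left_diff_distrib *)
  then show ?thesis
    unfolding g1_eq[symmetric] y dp frob power_mult_distrib by (simp add: algebra_simps)
qed

lemma g_shift:
  "- a * (\<delta> - r * x^2)^(p^2) + b' * (\<delta> - r * x^2)^p * x^(2*p^2-2*p) + c' * x^(2*p^2-p) * (y + s * x)^p
     + d' * (\<delta> - r * x^2) * x^(2*p^2-2) + e' * x^(2*p^2-1) * (y + s * x)
   = g + (e' * s - d' * r + c' * s^p - b' * r^p + a * r^(p^2)) * x^(2*p^2)"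
proof -
  have x: "x^(2*p^2) = x^(2*p^2-2*p) * x^(2*p)" "x^(2*p^2) = x^(2*p^2-p) * x^p"
    "x^(2*p^2) = x^(2*p^2-2) * x^2" "x^(2*p^2) = x^(2*p^2-1) * x"
    unfolding power_add[symmetric] power_Suc2[symmetric]
    by (rule arg_cong[where f = "\<lambda>n. x^n"], use p_sq_ge p_ge in simp)+
  have dp: "(\<delta> - r * x^2)^p = \<delta>^p - r^p * x^(2*p)"
    by (simp add: frob_diff power_mult_distrib power_mult)
  have "(\<delta> - r * x^2)^(p^2) = ((\<delta> - r * x^2)^p)^p"
    by (simp add: power2_eq_square[of p] power_mult)
  then have dpp: "(\<delta> - r * x^2)^(p^2) = \<delta>^(p^2) - r^(p^2) * x^(2*p^2)"
    by (simp add: dp frob_diff power_mult_distrib power_mult[symmetric] power2_eq_square[of p] mult.assoc)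
  have *: "b' * r^p * x^(2*p^2) = b' * r^p * (x^(2*p^2-2*p) * x^(2*p))"
    "c' * s^p * x^(2*p^2) = c' * s^p * (x^(2*p^2-p) * x^p)"
    "d' * r * x^(2*p^2) = d' * r * (x^(2*p^2-2) * x^2)" "e' * s * x^(2*p^2) = e' * s * (x^(2*p^2-1) * x)"
    using x by metis+
  have "(e' * s - d' * r + c' * s^p - b' * r^p + a * r^(p^2)) * x^(2*p^2)
     = e' * s * (x^(2*p^2-1) * x) - d' * r * (x^(2*p^2-2) * x^2) + c' * s^p * (x^(2*p^2-p) * x^p)
       - b' * r^p * (x^(2*p^2-2*p) * x^(2*p)) + a * r^(p^2) * x^(2*p^2)"
    by (simp only: distrib_right left_diff_distrib *)
  then show ?thesis
    unfolding g_eq[symmetric] dpp dp frob power_mult_distrib by (simp add: algebra_simps)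
qed

section \<open>The second invariant as an explicit quotient\<close>

context
  fixes h :: 'r
  assumes h: "2 * h = 1"
begin

definition "v = h * (x^(p^2-4*p) * t^2 + a^2 * z^(p^2) + a * x^(p^2-2*p) * u)"

definition "g2 = a * y^(p^2) * t + x^(2*p) * v"

text \<open>\<delta>^(p^2) equals y^(2p^2) up to a multiple of x^(p^2), so the squares a^2 y^(2p^2)
  cancel. The cross term 2 a y^(p^2) x^(p^2-2p) t is then the part of lowest visible order in x and
  gives the leading part of the quotient.\<close>

lemma g2_eq: "g1^2 + a * g = g2 * (2 * x^(p^2-2*p))"
proof -
  have "2 * v = x^(p^2-4*p) * t^2 + a^2 * z^(p^2) + a * x^(p^2-2*p) * u"
    using h unfolding v_def mult.assoc[symmetric] by simp
  moreover have "g2 * (2 * x^(p^2-2*p)) = 2 * a * y^(p^2) * t * x^(p^2-2*p)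
      + x^(2*p) * x^(p^2-2*p) * (2 * v)"
    by (simp add: g2_def algebra_simps)
  ultimately have "g2 * (2 * x^(p^2-2*p)) = 2 * a * y^(p^2) * t * x^(p^2-2*p)
      + x^(2*p) * x^(p^2-2*p) * (x^(p^2-4*p) * t^2 + a^2 * z^(p^2) + a * x^(p^2-2*p) * u)"
    by simp
  also have "\<dots> = 2 * a * y^(p^2) * t * x^(p^2-2*p)
      + ((x^(p^2-2*p))^2 * t^2 + x^(p^2) * a^2 * z^(p^2) + a * x^(2*p^2-2*p) * u)"
  proof -
    \<comment> \<open>All exponents are genuine differences, p^2 - 4p included, since 5 p <=
      p^2.\<close>
    have x: "x^(2*p) * x^(p^2-2*p) = x^(p^2)" "(x^(p^2-2*p))^2 = x^(p^2) * x^(p^2-4*p)"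
      "x^(2*p^2-2*p) = x^(p^2) * x^(p^2-2*p)"
      unfolding power_add[symmetric] power_mult[symmetric]
      by (rule arg_cong[where f = "\<lambda>n. x^n"], use p_sq_ge p_ge in simp)+
    show ?thesis unfolding x by (simp add: algebra_simps)
  qed
  also have "\<dots> = g1^2 + a * g"
    unfolding g1_def g_def delta_p2 power2_sum power_mult_distrib
    by (simp add: algebra_simps power2_eq_square[of a])
  finally show ?thesis by simp
qed

section \<open>Congruences modulo powers of x\<close>

definition eqm :: "nat \<Rightarrow> 'r \<Rightarrow> 'r \<Rightarrow> bool" where
  "eqm k l q \<longleftrightarrow> x^k dvd l - q"

lemma eqm_refl: "eqm k l l"
  by (simp add: eqm_def)

lemma eqm_trans [trans]: "eqm k l q \<Longrightarrow> eqm k q r \<Longrightarrow> eqm k l r"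
  unfolding eqm_def using dvd_add by fastforce

lemma eqm_add: "eqm k l q \<Longrightarrow> eqm k l' q' \<Longrightarrow> eqm k (l + l') (q + q')"
  unfolding eqm_def using dvd_add[of "x^k" "l - q" "l' - q'"] by (simp add: algebra_simps)

lemma eqm_mult: "eqm k l q \<Longrightarrow> eqm k l' q' \<Longrightarrow> eqm k (l * l') (q * q')"
  unfolding eqm_def
proof -
  assume "x^k dvd l - q" "x^k dvd l' - q'"
  then have "x^k dvd (l - q) * l' + q * (l' - q')" by simp
  then show "x^k dvd l * l' - q * q'" by (simp add: algebra_simps)
qed

lemma eqm_mult_left: "eqm k l q \<Longrightarrow> eqm k (r * l) (r * q)"
  by (intro eqm_mult eqm_refl)

lemma eqm_power: "eqm k l q \<Longrightarrow> eqm k (l^n) (q^n)"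
  by (induction n) (auto intro: eqm_mult eqm_refl)

lemma eqm_shift: "eqm k l q \<Longrightarrow> eqm (j + k) (x^j * l) (x^j * q)"
  unfolding eqm_def by (simp add: right_diff_distrib[symmetric] power_add mult_dvd_mono)

lemma eqm_add_right: "k \<le> j \<Longrightarrow> eqm k (l + x^j * q) l"
  unfolding eqm_def by (simp add: le_imp_power_dvd)

lemma eqm_g1: "k \<le> 2*p \<Longrightarrow> eqm k g1 (a * y^(p^2))"
  unfolding g1_def using p_sq_ge by (intro eqm_add_right) simp

lemma eqm_g2: "k \<le> 2*p \<Longrightarrow> eqm k g2 (a * y^(p^2) * t)"
  unfolding g2_def by (rule eqm_add_right)

text \<open>Modulo x^(p-1) only b y^(2p) survives in t. This precision suffices where it is used,
  behind the factor x^(2p^2-p) of the last term of \<open>g3t\<close>.\<close>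

lemma g2_mod: "eqm (p-1) g2 (a * y^(p^2) * (b * y^(2*p)))"
proof -
  have x: "x^(2*p-2) = x^p * x^(p-2)" "x^(2*p-1) = x^p * x^(p-1)"
    by (rule x_pow[symmetric], use p_ge in simp)+
  have "t = b * y^(2*p) + x^p * (- b * z^p + c * y^p + d * \<delta> * x^(p-2) + e * x^(p-1) * y)"
    unfolding t_def x delta_p by (simp add: algebra_simps)
  then have t: "eqm (p-1) t (b * y^(2*p))"
    by (simp only:) (rule eqm_add_right, simp)
  show ?thesis
    by (rule eqm_trans[OF eqm_g2 eqm_mult_left[OF t]]) simp
qed

lemma g2_form:
  obtains w where "g2 = a * b * y^(p^2+2*p) + x * w"
proof -
  obtain w where "g2 - a * y^(p^2) * (b * y^(2*p)) = x^(p-1) * w"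
    using g2_mod unfolding eqm_def dvd_def by blast
  moreover have "x^(p-1) = x * x^(p-2)"
    unfolding power_Suc[symmetric] by (rule arg_cong[where f = "\<lambda>n. x^n"]) (use p_ge in simp)
  ultimately have "g2 = a * b * y^(p^2+2*p) + x * (x^(p-2) * w)"
    by (simp add: power_add algebra_simps)
  then show ?thesis by (rule that)
qed

section \<open>The third invariant modulo x^(2p^2-1)\<close>

context
  fixes A7 B7 C7 D7 g57 G \<alpha>1 \<alpha>2 \<alpha>3 \<alpha>4 :: 'r
  assumes pl1: "c^p * b - b^p * b' - a * d^p = - (a^p * A7)"
    and pl2: "c^p * c - b^p * c' - a * e^p = - (a^p * B7)"
    and pl3: "c^p * d - b^p * d' = - (a^p * C7)"
    and pl4: "c^p * e - b^p * e' = - (a^p * D7)"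
    and pl5: "a * g57 + A7 * c = b * B7"
    and pl6: "A7 * d + a * G = b * C7"
    and \<alpha>1: "\<alpha>1 = - 2 * b^p" and \<alpha>2: "\<alpha>2 = a * c^p"
    and \<alpha>3: "b * \<alpha>3 = a^(p+1) * A7"
    and \<alpha>4: "b * \<alpha>4 * b^((p+1) div 2) = a^(p+3) * g57"
begin

text \<open>\<open>A7\<close>, \<open>B7\<close>, \<open>C7\<close>, \<open>D7\<close> stand for the
  minors 1237, 1247, 1347, 2347, and \<open>g57\<close>, \<open>G\<close> for 1257, 1357. The
  assumptions \<open>pl1\<close> to \<open>pl6\<close> are Pluecker relations between them and the
  earlier letters.\<close>

definition "g3t = b^p * g1^(p+2) - a^2 * g2^p + \<alpha>1 * x^(p^2-2*p) * g1^p * g2 + \<alpha>2 * x^(p^2) * g1^(p+1)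
   + \<alpha>3 * x^(2*p^2-2*p) * g1^(p-1) * g2 + \<alpha>4 * x^(2*p^2-p) * g1^((p-3) div 2) * g2^((p+1) div 2)"

text \<open>The counterpart of t and u for row 7 of the matrix.\<close>

definition "s = A7 * \<delta>^p + B7 * x^p * y^p + C7 * \<delta> * x^(2*p-2) + D7 * x^(2*p-1) * y"

lemma t_p: "t^p = b^p * \<delta>^(p^2) + c^p * x^(p^2) * y^(p^2) + d^p * \<delta>^p * x^(2*p^2-2*p) + e^p * x^(2*p^2-p) * y^p"
proof -
  have "(2*p-2) * p = 2*p^2-2*p" "(2*p-1) * p = 2*p^2-p"
    by (simp_all add: diff_mult_distrib power2_eq_square mult.assoc)
  then show ?thesis
    by (simp add: t_def frob power_mult_distrib power_mult[symmetric] power2_eq_square[of p])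
qed

text \<open>\<alpha>1 makes the square of \<open>g1\<close> combine with \<open>g2\<close> into a
  multiple of \<open>g\<close>. \<alpha>2 adds c^p x^(p^2) \<open>g1\<close>, and \<open>pl1\<close>
  to \<open>pl4\<close> complete the sum to t^p, with an error expressed through the row-7 form
  s.\<close>

lemma g3t_first_terms:
  "b^p * g1^(p+2) + \<alpha>1 * x^(p^2-2*p) * g1^p * g2 + \<alpha>2 * x^(p^2) * g1^(p+1)
    = a * g1^p * (a * t^p - a^p * x^(2*p^2-2*p) * s)"
proof -
  have "b^p * g1^(p+2) + \<alpha>1 * x^(p^2-2*p) * g1^p * g2 = b^p * g1^p * (g1^2 - g2 * (2 * x^(p^2-2*p)))"
    by (simp add: \<alpha>1 power_add algebra_simps power2_eq_square)
  also have "\<dots> = a * g1^p * (- (b^p * g))"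
    by (simp add: g2_eq[symmetric])
  finally have 1: "b^p * g1^(p+2) + \<alpha>1 * x^(p^2-2*p) * g1^p * g2 + \<alpha>2 * x^(p^2) * g1^(p+1)
      = a * g1^p * (c^p * x^(p^2) * g1 - b^p * g)"
    by (simp add: \<alpha>2 algebra_simps)
  let ?X = "x^(2*p^2-2*p)"
  have x: "x^(p^2) * x^(p^2-2*p) = ?X" "x^(2*p^2-p) = ?X * x^p"
    by (rule x_pow x_pow[symmetric], use p_sq_ge in simp)+
  have "c^p * x^(p^2) * g1 = c^p * (x^(p^2) * a * y^(p^2) + ?X * t)"
    unfolding g1_def x(1)[symmetric] by (simp add: algebra_simps)
  then have 2: "c^p * x^(p^2) * g1 - b^p * g = a * (b^p * \<delta>^(p^2) + c^p * x^(p^2) * y^(p^2)) + ?X * (c^p * t - b^p * u)"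
    unfolding g_def by (simp add: algebra_simps)
  have "c^p * t - b^p * u = (c^p * b - b^p * b') * \<delta>^p + (c^p * c - b^p * c') * x^p * y^p
      + (c^p * d - b^p * d') * \<delta> * x^(2*p-2) + (c^p * e - b^p * e') * x^(2*p-1) * y"
    by (simp add: t_def u_def algebra_simps)
  also have "c^p * b - b^p * b' = a * d^p - a^p * A7" using pl1 by (simp add: algebra_simps)
  also have "c^p * c - b^p * c' = a * e^p - a^p * B7" using pl2 by (simp add: algebra_simps)
  also note pl3
  also note pl4
  finally have 3: "c^p * t - b^p * u = a * d^p * \<delta>^p + a * e^p * x^p * y^p - a^p * s"
    by (simp add: s_def algebra_simps)
  have "c^p * x^(p^2) * g1 - b^p * g = a * t^p - a^p * ?X * s"
    unfolding 2 3 t_p x(2) by (simp add: algebra_simps)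
  then show ?thesis using 1 by simp
qed

lemma g1_p: "g1^p = a^p * y^(p^3) + x^(p^3-2*p^2) * t^p"
proof -
  have "(p^2-2*p) * p = p^3-2*p^2"
    by (simp add: diff_mult_distrib power2_eq_square power3_eq_cube mult.assoc)
  then show ?thesis
    by (simp add: g1_def frob power_mult_distrib power_mult[symmetric] power2_eq_square[of p]
        power3_eq_cube[of p])
qed

lemma g2_p: "g2^p = a^p * y^(p^3) * t^p + x^(2*p^2) * v^p"
  by (simp add: g2_def frob power_mult_distrib power_mult[symmetric] power2_eq_square[of p]
      power3_eq_cube[of p] mult.assoc)

text \<open>The main parts a^(p+2) y^(p^3) t^p of the two products cancel, leaving the error term
  with s. Its \<open>D7\<close>-part has the extra factor x^(2p-1) and drops out.\<close>

lemma g3t_head_mod: "eqm (2*p^2-1)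
   (a * g1^p * (a * t^p - a^p * x^(2*p^2-2*p) * s) - a^2 * g2^p)
   (- (a^(2*p+1) * y^(p^3) * x^(2*p^2-2*p) * (A7 * \<delta>^p + B7 * x^p * y^p + C7 * \<delta> * x^(2*p-2))))"
proof -
  let ?X = "x^(2*p^2-2*p)"
  let ?s = "A7 * \<delta>^p + B7 * x^p * y^p + C7 * \<delta> * x^(2*p-2)"
  let ?E = "x^(p^3-2*p^2)"
  have s: "s = ?s + x^(2*p-1) * (D7 * y)" by (simp add: s_def algebra_simps)
  have x: "?X * x^(2*p-1) = x^(2*p^2-1)"
    using p_sq_ge p_ge by (simp add: x_pow)
  have ap: "a^(2*p+1) = a * a^p * a^p" by (simp add: mult_2 power_add)
  have "a * g1^p * (a * t^p - a^p * ?X * s) - a^2 * g2^p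
     = - (a^(2*p+1) * y^(p^3) * ?X * s) + ?E * (a * t^p * (a * t^p - a^p * ?X * s))
       + x^(2*p^2) * (- (a^2 * v^p))"
    unfolding g1_p g2_p ap by (simp add: algebra_simps power2_eq_square)
  also have "a^(2*p+1) * y^(p^3) * ?X * s = a^(2*p+1) * y^(p^3) * ?X * ?s + x^(2*p^2-1) * (a^(2*p+1) * y^(p^3) * D7 * y)"
    unfolding s x[symmetric] by (simp add: algebra_simps)
  finally have eq: "a * g1^p * (a * t^p - a^p * ?X * s) - a^2 * g2^p
     - (- (a^(2*p+1) * y^(p^3) * ?X * ?s)) = x^(2*p^2-1) * (- (a^(2*p+1) * y^(p^3) * D7 * y))
       + ?E * (a * t^p * (a * t^p - a^p * ?X * s)) + x^(2*p^2) * (- (a^2 * v^p))"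
    by simp
  \<comment> \<open>This comparison discards the second summand of \<open>g1^p\<close> and is where
    the size of p enters.\<close>
  have "2*p^2 - 1 \<le> p^3 - 2*p^2" using p_cube_ge by simp
  then have "x^(2*p^2-1) dvd ?E" by (rule le_imp_power_dvd)
  moreover have "x^(2*p^2-1) dvd x^(2*p^2)" by (rule le_imp_power_dvd) simp
  ultimately show ?thesis
    unfolding eqm_def eq by (intro dvd_add dvd_mult2 dvd_refl)
qed

text \<open>Behind the factor x^(2p^2-2p) the precision 2p - 1 is just enough; it removes the e-part
  of t.\<close>

lemma g3t_alpha3_mod: "eqm (2*p-1) (g1^(p-1) * g2)
   (a^p * y^(p^3) * (b * \<delta>^p + c * x^p * y^p + d * \<delta> * x^(2*p-2)))"
proof -
  let ?t = "b * \<delta>^p + c * x^p * y^p + d * \<delta> * x^(2*p-2)"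
  have "eqm (2*p-1) (?t + x^(2*p-1) * (e * y)) ?t" by (rule eqm_add_right) simp
  then have t: "eqm (2*p-1) t ?t" by (simp add: t_def mult_ac)
  have "eqm (2*p-1) (g1^(p-1) * g2) ((a * y^(p^2))^(p-1) * (a * y^(p^2) * t))"
    by (intro eqm_mult eqm_power eqm_g1 eqm_g2) simp_all
  also have "eqm (2*p-1) ((a * y^(p^2))^(p-1) * (a * y^(p^2) * t)) ((a * y^(p^2))^(p-1) * (a * y^(p^2) * ?t))"
    by (intro eqm_mult_left t)
  also have "(a * y^(p^2))^(p-1) * (a * y^(p^2) * ?t) = (a * y^(p^2))^(Suc (p-1)) * ?t"
    by (simp only: power_Suc2 mult.assoc)
  also have "(a * y^(p^2))^(Suc (p-1)) = a^p * y^(p^3)"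
    using p_ge by (simp add: power_mult_distrib power_mult[symmetric] power2_eq_square power3_eq_cube)
  finally show ?thesis .
qed

text \<open>The exponents (p-3)/2 and (p+1)/2 add up to p - 1, and the second contributes
  y^(p(p+1)). So the total power of y is p^3 + p, matching the term x^p y^p y^(p^3) to be
  removed.\<close>

lemma g3t_alpha4_mod: "eqm (p-1) (g1^((p-3) div 2) * g2^((p+1) div 2))
   (a^(p-1) * b^((p+1) div 2) * y^(p^3+p))"
proof -
  let ?m = "(p-3) div 2" and ?n = "(p+1) div 2"
  have mn: "?m + ?n = p - 1" "2 * ?n = p + 1" using odd_p p_ge by presburger+
  have "eqm (p-1) g2 (a * y^(p^2) * (b * y^(2*p)))" by (rule g2_mod)
  then have "eqm (p-1) (g1^?m * g2^?n) ((a * y^(p^2))^?m * (a * y^(p^2) * (b * y^(2*p)))^?n)"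
    by (intro eqm_mult eqm_power eqm_g1) simp_all
  also have "(a * y^(p^2))^?m * (a * y^(p^2) * (b * y^(2*p)))^?n
      = (a * y^(p^2))^(?m + ?n) * b^?n * y^(p * (2 * ?n))"
    by (simp add: power_add power_mult_distrib power_mult[symmetric] mult_ac)
  also have "\<dots> = a^(p-1) * b^?n * y^(p^2 * (p-1) + p * (p+1))"
    unfolding mn by (simp add: power_add power_mult_distrib power_mult[symmetric] mult_ac)
  also have "p^2 * (p-1) + p * (p+1) = p^3 + p"
  proof -
    obtain q where "p = Suc q" using p_ge by (cases p) auto
    then show ?thesis by (simp add: power2_eq_square power3_eq_cube algebra_simps)
  qed
  finally show ?thesis .
qed

text \<open>The factor b clears the denominators of \<alpha>3 and \<alpha>4. The \<alpha>3-term
  removes \<delta>^p, the \<alpha>4-term removes x^p y^p by \<open>pl5\<close>, and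
  \<open>pl6\<close> turns the coefficient left at \<delta> x^(2p-2) into -a G. Finally \<delta> is
  y^2 modulo x.\<close>

lemma g3t_mod: "eqm (2*p^2-1) (b * g3t) (- (a^(2*p+2) * G * y^(p^3+2) * x^(2*p^2-2)))"
proof -
  let ?X = "x^(2*p^2-2*p)"
  let ?n = "(p+1) div 2"
  have e2: "2*p^2-2*p + (2*p-1) = 2*p^2-1" using p_sq_ge p_ge by simp
  have e3: "2*p^2-p + (p-1) = 2*p^2-1" using p_sq_ge p_ge by simp
  have P1: "eqm (2*p^2-1) (b * (a * g1^p * (a * t^p - a^p * ?X * s) - a^2 * g2^p))
     (b * - (a^(2*p+1) * y^(p^3) * ?X * (A7 * \<delta>^p + B7 * x^p * y^p + C7 * \<delta> * x^(2*p-2))))"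
    by (rule eqm_mult_left[OF g3t_head_mod])
  have P2: "eqm (2*p^2-1) (b * \<alpha>3 * (?X * (g1^(p-1) * g2)))
     (b * \<alpha>3 * (?X * (a^p * y^(p^3) * (b * \<delta>^p + c * x^p * y^p + d * \<delta> * x^(2*p-2)))))"
    by (rule eqm_mult_left[OF eqm_shift[OF g3t_alpha3_mod, of "2*p^2-2*p", unfolded e2]])
  have P3: "eqm (2*p^2-1) (b * \<alpha>4 * (x^(2*p^2-p) * (g1^((p-3) div 2) * g2^?n)))
     (b * \<alpha>4 * (x^(2*p^2-p) * (a^(p-1) * b^?n * y^(p^3+p))))"
    by (rule eqm_mult_left[OF eqm_shift[OF g3t_alpha4_mod, of "2*p^2-p", unfolded e3]])
  have E3: "b * \<alpha>4 * (x^(2*p^2-p) * (a^(p-1) * b^?n * y^(p^3+p)))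
     = a^(2*p+1) * a * g57 * ?X * x^p * y^(p^3) * y^p"
  proof -
    have x: "x^(2*p^2-p) = ?X * x^p" by (rule x_pow[symmetric], use p_sq_ge in simp)
    have "a^(p+3) * a^(p-1) = a^(2*p+1) * a"
      using p_ge by (simp add: power_add[symmetric] flip: power_Suc2)
    then have "(b * \<alpha>4 * b^?n) * a^(p-1) = a^(2*p+1) * a * g57"
      unfolding \<alpha>4 by (simp add: mult_ac)
    moreover have "b * \<alpha>4 * (x^(2*p^2-p) * (a^(p-1) * b^?n * y^(p^3+p)))
      = ((b * \<alpha>4 * b^?n) * a^(p-1)) * ?X * x^p * y^(p^3) * y^p"
      unfolding x by (simp add: power_add mult_ac)
    ultimately show ?thesis by simp
  qed
  have E2: "b * \<alpha>3 * (?X * (a^p * y^(p^3) * (b * \<delta>^p + c * x^p * y^p + d * \<delta> * x^(2*p-2))))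
     = a^(2*p+1) * A7 * ?X * y^(p^3) * (b * \<delta>^p + c * x^p * y^p + d * \<delta> * x^(2*p-2))"
  proof -
    have a: "a^(2*p+1) = a^(p+1) * a^p" by (simp add: mult_2 power_add)
    show ?thesis unfolding \<alpha>3 a by (simp only: mult_ac)
  qed
  have E0: "b * g3t = b * (a * g1^p * (a * t^p - a^p * ?X * s) - a^2 * g2^p)
     + b * \<alpha>3 * (?X * (g1^(p-1) * g2)) + b * \<alpha>4 * (x^(2*p^2-p) * (g1^((p-3) div 2) * g2^?n))"
    unfolding g3t_first_terms[symmetric] g3t_def by (simp add: algebra_simps)
  have M: "eqm (2*p^2-1) (b * g3t) (b * - (a^(2*p+1) * y^(p^3) * ?X * (A7 * \<delta>^p + B7 * x^p * y^p + C7 * \<delta> * x^(2*p-2)))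
     + a^(2*p+1) * A7 * ?X * y^(p^3) * (b * \<delta>^p + c * x^p * y^p + d * \<delta> * x^(2*p-2))
     + a^(2*p+1) * a * g57 * ?X * x^p * y^(p^3) * y^p)"
    unfolding E0 by (rule eqm_add[OF eqm_add[OF P1 P2[unfolded E2]] P3[unfolded E3]])
  have "b * - (a^(2*p+1) * y^(p^3) * ?X * (A7 * \<delta>^p + B7 * x^p * y^p + C7 * \<delta> * x^(2*p-2)))
     + a^(2*p+1) * A7 * ?X * y^(p^3) * (b * \<delta>^p + c * x^p * y^p + d * \<delta> * x^(2*p-2))
     + a^(2*p+1) * a * g57 * ?X * x^p * y^(p^3) * y^p
    = a^(2*p+1) * y^(p^3) * ?X * ((a * g57 + A7 * c - b * B7) * x^p * y^p + (A7 * d - b * C7) * \<delta> * x^(2*p-2))"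
    by (simp add: algebra_simps)
  also have "\<dots> = a^(2*p+1) * y^(p^3) * ?X * (- (a * G) * \<delta> * x^(2*p-2))"
  proof -
    have "A7 * d - b * C7 = - (a * G)" using pl6[symmetric] by simp
    then show ?thesis by (simp add: pl5)
  qed
  also have "\<dots> = - (a^(2*p+2) * G * y^(p^3+2) * x^(2*p^2-2)) + x^(2*p^2-1) * (a^(2*p+2) * G * y^(p^3) * z)"
  proof -
    have x: "x^(2*p^2-2) = ?X * x^(2*p-2)" "x^(2*p^2-1) = ?X * x^(2*p-2) * x"
      unfolding power_add[symmetric] power_Suc2[symmetric]
      by (rule arg_cong[where f = "\<lambda>n. x^n"], use p_sq_ge p_ge in simp)+
    show ?thesis unfolding x \<delta>_def by (simp add: power_add algebra_simps power2_eq_square)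
  qed
  finally have E1: "b * - (a^(2*p+1) * y^(p^3) * ?X * (A7 * \<delta>^p + B7 * x^p * y^p + C7 * \<delta> * x^(2*p-2)))
     + a^(2*p+1) * A7 * ?X * y^(p^3) * (b * \<delta>^p + c * x^p * y^p + d * \<delta> * x^(2*p-2))
     + a^(2*p+1) * a * g57 * ?X * x^p * y^(p^3) * y^p
    = - (a^(2*p+2) * G * y^(p^3+2) * x^(2*p^2-2)) + x^(2*p^2-1) * (a^(2*p+2) * G * y^(p^3) * z)" .
  show ?thesis
    by (rule eqm_trans[OF M[unfolded E1] eqm_add_right]) simp
qed

lemma g3t_form:
  obtains w where "- (b * g3t) = a^(2*p+2) * x^(2*p^2-2) * (G * y^(p^3+2)) + x^(2*p^2-2) * (x * w)"
proof -
  obtain w where "b * g3t - - (a^(2*p+2) * G * y^(p^3+2) * x^(2*p^2-2)) = x^(2*p^2-1) * w"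
    using g3t_mod unfolding eqm_def dvd_def by blast
  moreover have "x^(2*p^2-1) = x^(2*p^2-2) * x"
    unfolding power_Suc2[symmetric]
    by (rule arg_cong[where f = "\<lambda>n. x^n"]) (use p_sq_ge p_ge in simp)
  ultimately have "- (b * g3t) = a^(2*p+2) * x^(2*p^2-2) * (G * y^(p^3+2)) + x^(2*p^2-2) * (x * - w)"
    by (simp add: algebra_simps)
  then show ?thesis by (rule that)
qed

end

end

end

section \<open>Four by four minors\<close>

text \<open>The determinant expanded in its entries, with rows as functions, so that relations
  between minors become polynomial identities.\<close>

definition d4 :: "(4 \<Rightarrow> 'a::comm_ring_1) \<Rightarrow> (4 \<Rightarrow> 'a) \<Rightarrow> (4 \<Rightarrow> 'a) \<Rightarrow> (4 \<Rightarrow> 'a) \<Rightarrow> 'a" where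
  "d4 q r s t =
     q 1 * (r 2 * (s 3 * t 4 - s 4 * t 3) - r 3 * (s 2 * t 4 - s 4 * t 2) + r 4 * (s 2 * t 3 - s 3 * t 2))
   - q 2 * (r 1 * (s 3 * t 4 - s 4 * t 3) - r 3 * (s 1 * t 4 - s 4 * t 1) + r 4 * (s 1 * t 3 - s 3 * t 1))
   + q 3 * (r 1 * (s 2 * t 4 - s 4 * t 2) - r 2 * (s 1 * t 4 - s 4 * t 1) + r 4 * (s 1 * t 2 - s 2 * t 1))
   - q 4 * (r 1 * (s 2 * t 3 - s 3 * t 2) - r 2 * (s 1 * t 3 - s 3 * t 1) + r 3 * (s 1 * t 2 - s 2 * t 1))"

lemma det_4:
  fixes A :: "'a::comm_ring_1^4^4"
  shows "det A = d4 (\<lambda>j. A $ 1 $ j) (\<lambda>j. A $ 2 $ j) (\<lambda>j. A $ 3 $ j) (\<lambda>j. A $ 4 $ j)"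
proof -
  have f1234: "finite {2::4, 3, 4}" "1 \<notin> {2::4, 3, 4}"
    and f234: "finite {3::4, 4}" "2 \<notin> {3::4, 4}"
    and f34: "finite {4::4}" "3 \<notin> {4::4}"
    by auto
  show ?thesis
    unfolding det_def UNIV_4
    unfolding sum_over_permutations_insert[OF f1234]
    unfolding sum_over_permutations_insert[OF f234]
    unfolding sum_over_permutations_insert[OF f34]
    unfolding permutes_sing
    by (simp add: sign_swap_id permutation_swap_id sign_compose sign_id swap_id_eq d4_def
        permutation_compose transpose_def algebra_simps)
qed

lemma vector_4:
  "(vector [i, j, k, l] :: 'a::zero^4) $ 1 = i"
  "(vector [i, j, k, l] :: 'a::zero^4) $ 2 = j"
  "(vector [i, j, k, l] :: 'a::zero^4) $ 3 = k"
  "(vector [i, j, k, l] :: 'a::zero^4) $ 4 = l"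
  by (simp_all add: vector_def)

lemma gam_eq_d4: "gam i j k l = d4 (Gam i) (Gam j) (Gam k) (Gam l)"
  by (simp add: gam_def det_4 vector_4)

lemma all_4: "P (1::4) \<Longrightarrow> P 2 \<Longrightarrow> P 3 \<Longrightarrow> P 4 \<Longrightarrow> P j"
  using forall_4[of P] by blast

text \<open>Expansion of a 5 by 5 determinant with a repeated row: the coordinates 1 to 4 of the
  five vectors, and the j-th once more.\<close>

lemma d4_cramer:
  "d4 v2 v3 v4 v5 * v1 j - d4 v1 v3 v4 v5 * v2 j + d4 v1 v2 v4 v5 * v3 j
    - d4 v1 v2 v3 v5 * v4 j + d4 v1 v2 v3 v4 * v5 j = 0"
  by (rule all_4[of _ j]; simp add: d4_def algebra_simps)

lemma d4_linear:
  "d4 q r s t = (\<Sum>j\<in>UNIV. d4 q r s (\<lambda>i. if i = j then 1 else 0) * t j)"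
  by (simp add: sum_4 d4_def algebra_simps)

text \<open>Apply the linear form given by \<open>d4 q r s\<close> to the Cramer relation among the
  five vectors.\<close>

lemma d4_plucker:
  fixes q r s :: "4 \<Rightarrow> 'a::comm_ring_1"
  shows "d4 v2 v3 v4 v5 * d4 q r s v1 - d4 v1 v3 v4 v5 * d4 q r s v2 + d4 v1 v2 v4 v5 * d4 q r s v3
    - d4 v1 v2 v3 v5 * d4 q r s v4 + d4 v1 v2 v3 v4 * d4 q r s v5 = 0"
proof -
  define S where "S j = d4 v2 v3 v4 v5 * v1 j - d4 v1 v3 v4 v5 * v2 j + d4 v1 v2 v4 v5 * v3 j
    - d4 v1 v2 v3 v5 * v4 j + d4 v1 v2 v3 v4 * v5 j" for j
  define K where "K j = d4 q r s (\<lambda>i. if i = j then 1 else 0)" for j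
  have "d4 v2 v3 v4 v5 * d4 q r s v1 - d4 v1 v3 v4 v5 * d4 q r s v2 + d4 v1 v2 v4 v5 * d4 q r s v3
    - d4 v1 v2 v3 v5 * d4 q r s v4 + d4 v1 v2 v3 v4 * d4 q r s v5 = (\<Sum>j\<in>UNIV. K j * S j)"
    unfolding d4_linear[of q r s v1] d4_linear[of q r s v2] d4_linear[of q r s v3]
      d4_linear[of q r s v4] d4_linear[of q r s v5] K_def[symmetric] S_def
    by (simp add: sum_distrib_left sum.distrib sum_subtractf algebra_simps)
  then show ?thesis by (simp add: S_def d4_cramer)
qed

lemma d4_alt [simp]: "d4 q r s s = 0" "d4 q r s r = 0" "d4 q r s q = 0"
  by (simp_all add: d4_def algebra_simps)

lemma d4_swap34: "d4 q r s t = - d4 q r t s"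
  and d4_swap23: "d4 q r s t = - d4 q s r t"
  by (simp_all add: d4_def algebra_simps)

context
  fixes \<phi> :: "'a::comm_ring_1 \<Rightarrow> 'b::comm_ring_1"
  assumes "comm_ring_hom \<phi>"
begin

interpretation comm_ring_hom \<phi> by fact

lemma hom_d4: "\<phi> (d4 q r s t) = d4 (\<lambda>j. \<phi> (q j)) (\<lambda>j. \<phi> (r j)) (\<lambda>j. \<phi> (s j)) (\<lambda>j. \<phi> (t j))"
  by (simp add: d4_def hom_add hom_minus hom_mult)

end

section \<open>The generic point\<close>

definition emb :: "(entry, 'p::prime_card mod_ring) mpoly \<Rightarrow> 'p genfield" where
  "emb P = Fract P 1"

interpretation emb: comm_ring_hom "emb :: _ \<Rightarrow> 'p::prime_card genfield"
  by unfold_locales (simp_all add: emb_def Zero_fract_def One_fract_def)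

lemma emb_eq_iff [simp]: "emb P = emb Q \<longleftrightarrow> P = Q"
  by (simp add: emb_def eq_fract)

lemma emb_eq_0_iff [simp]: "emb P = 0 \<longleftrightarrow> P = 0"
  using emb_eq_iff[of P 0] by (simp only: emb.hom_zero)

lemma xm_eq_emb: "xm i j = emb (Var (Entry i j))"
  by (simp add: xm_def emb_def)

lemma of_nat_card_eq_0:
  "of_nat CARD('p::prime_card) = (0 :: ('v, 'p mod_ring) mpoly)"
  "of_nat CARD('p::prime_card) = (0 :: 'p genfield)"
  "of_nat CARD('p::prime_card) = (0 :: 'p gring)"
proof -
  show "of_nat CARD('p::prime_card) = (0 :: ('v, 'p mod_ring) mpoly)"
    by (metis Const.hom_of_nat Const.hom_zero of_nat_card_eq_0)
  have "of_nat CARD('p::prime_card) = (0 :: (entry, 'p mod_ring) mpoly)"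
    by (metis Const.hom_of_nat Const.hom_zero of_nat_card_eq_0)
  then show 2: "of_nat CARD('p::prime_card) = (0 :: 'p genfield)"
    by (metis emb.hom_of_nat emb.hom_zero)
  show "of_nat CARD('p::prime_card) = (0 :: 'p gring)"
    by (metis Const.hom_of_nat Const.hom_zero 2)
qed

lemma CHAR_eq_CARD:
  assumes "of_nat CARD('p::prime_card) = (0 :: 'a::comm_ring_1)"
  shows "CHAR('a) = CARD('p)"
proof -
  have "CHAR('a) dvd CARD('p)"
    using assms by (simp add: of_nat_eq_0_iff_char_dvd)
  moreover have "CHAR('a) \<noteq> 1"
  proof
    assume "CHAR('a) = 1"
    then have "of_nat 1 = (0 :: 'a)" by (metis of_nat_CHAR)
    then show False by simp
  qed
  ultimately show ?thesis
    using prime_card[where ?'a = 'p] by (auto simp: prime_nat_iff)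
qed

lemma frobenius_add:
  fixes v w :: "'a::comm_ring_1"
  assumes "of_nat CARD('p::prime_card) = (0 :: 'a)"
  shows "(v + w) ^ CARD('p) = v ^ CARD('p) + w ^ CARD('p)"
  using CHAR_eq_CARD[OF assms] prime_card[where ?'a = 'p]
  by (intro freshmans_dream) simp_all

lemma two_nonzero_of_CHAR:
  assumes "of_nat CARD('p::prime_card) = (0 :: 'a::comm_ring_1)" "odd CARD('p)"
  shows "(2 :: 'a) \<noteq> 0"
proof
  assume "(2 :: 'a) = 0"
  then have "of_nat 2 = (0 :: 'a)" by simp
  then have "CARD('p) dvd 2"
    using CHAR_eq_CARD[OF assms(1)] of_nat_eq_0_iff_char_dvd by metis
  then have "CARD('p) \<le> 2" by (rule dvd_imp_le) simp
  then show False
    using assms(2) prime_gt_1_nat[OF prime_card[where ?'a = 'p]] by (cases "CARD('p) = 2") auto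
qed

section \<open>The group as a set of shifts\<close>

definition lincomb :: "2 \<Rightarrow> 'p::prime_card mod_ring ^ 4 \<Rightarrow> (entry, 'p mod_ring) mpoly" where
  "lincomb i c = (\<Sum>j\<in>UNIV. Const (c $ j) * Var (Entry i j))"

lemma lincomb_add: "lincomb i (c + c') = lincomb i c + lincomb i c'"
  by (simp add: lincomb_def Const.hom_add distrib_right sum.distrib)

lemma lincomb_uminus: "lincomb i (- c) = - lincomb i c"
  by (simp add: lincomb_def Const.hom_uminus sum_negf)

lemma lincomb_0: "lincomb i 0 = 0"
  by (simp add: lincomb_def)

text \<open>The indeterminates of one row are linearly independent over the prime field; this is
  what makes the action faithful.\<close>

lemma lincomb_inj: "lincomb i c = lincomb i c' \<Longrightarrow> c = c'"
proof -
  have "lookup (lincomb i c) (single (Entry i j) 1) = c $ j" for c :: "'p::prime_card mod_ring ^ 4" and j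
  proof -
    have "lookup (Const (c $ k) * Var (Entry i k)) (single (Entry i j) 1) = (if k = j then c $ k else 0)" for k
      by (auto simp: Const_def Var_def mult_single lookup_single when_def single_eq_iff)
    then show ?thesis by (simp add: lincomb_def lookup_sum)
  qed
  then show "lincomb i c = lincomb i c' \<Longrightarrow> c = c'"
    unfolding vec_eq_iff by metis
qed

definition shifts :: "('p::prime_card genfield \<times> 'p genfield) set" where
  "shifts = range (\<lambda>c. (emb (lincomb 1 c), emb (lincomb 2 c)))"

lemma gen_act_eq_shift: "gen_act j = shift (xm 1 j) (xm 2 j)"
  by (simp add: gen_act_def shift_def)

lemma of_nat_to_int_mod_ring:
  "of_nat (nat (to_int_mod_ring a)) = (emb (Const a) :: 'p::prime_card genfield)"
proof -
  have "to_int_mod_ring a \<ge> 0"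
    using range_to_int_mod_ring[where ?'a = 'p] by (metis atLeastLessThan_iff rangeI)
  then have "of_nat (nat (to_int_mod_ring a)) = (of_int (to_int_mod_ring a) :: 'p mod_ring)"
    by simp
  also have "\<dots> = a" by (simp add: of_int_of_int_mod_ring)
  finally have "of_nat (nat (to_int_mod_ring a)) = a" .
  then show ?thesis
    by (metis Const.hom_of_nat emb.hom_of_nat)
qed

text \<open>The n-th power of a generator is the shift by n times its pair, and n depends on c only
  modulo p, so the total shift is linear in c.\<close>

lemma act_eq_shift: "act f c = shift (emb (lincomb 1 c)) (emb (lincomb 2 c)) f"
proof -
  have "emb (lincomb i c) = (\<Sum>j\<in>UNIV. of_nat (nat (to_int_mod_ring (c $ j))) * xm i j)" for i
    by (simp add: lincomb_def emb.hom_sum emb.hom_mult xm_eq_emb of_nat_to_int_mod_ring)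
  then show ?thesis
    by (simp add: act_def Let_def gen_act_eq_shift funpow_shift shift_shift sum_4 add_ac)
qed

lemma shift_group_shifts:
  assumes "odd CARD('p::prime_card)"
  shows "shift_group (shifts :: ('p genfield \<times> 'p genfield) set)"
proof
  show "finite (shifts :: ('p genfield \<times> 'p genfield) set)"
    by (simp add: shifts_def)
  show "(0, 0) \<in> (shifts :: ('p genfield \<times> 'p genfield) set)"
    unfolding shifts_def by (rule range_eqI[of _ _ 0]) (simp add: lincomb_0)
  show "(2 :: 'p genfield) \<noteq> 0"
    using of_nat_card_eq_0(2) assms by (rule two_nonzero_of_CHAR)
  fix g g' :: "'p genfield \<times> 'p genfield" assume g: "g \<in> shifts"
  then obtain c where c: "g = (emb (lincomb 1 c), emb (lincomb 2 c))" by (auto simp: shifts_def)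
  show "(- fst g, - snd g) \<in> shifts"
    unfolding shifts_def c
    by (rule range_eqI[of _ _ "- c"]) (simp add: lincomb_uminus emb.hom_uminus)
  assume g': "g' \<in> shifts"
  then obtain c' where c': "g' = (emb (lincomb 1 c'), emb (lincomb 2 c'))" by (auto simp: shifts_def)
  show "(fst g + fst g', snd g + snd g') \<in> shifts"
    unfolding shifts_def c c'
    by (rule range_eqI[of _ _ "c + c'"]) (simp add: lincomb_add emb.hom_add)
  show eq: "g = g'" if "fst g = fst g'"
    using that lincomb_inj[of 1 c c'] by (simp add: c c')
  show "g = g'" if nz: "fst g \<noteq> 0" "fst g' \<noteq> 0" and
    slope: "fst g + snd g / fst g = fst g' + snd g' / fst g'"
  proof -
    let ?L = lincomb
    have "fst g^2 * fst g' + snd g * fst g' = fst g * fst g'^2 + snd g' * fst g"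
      using slope nz by (simp add: field_simps power2_eq_square)
    then have "emb (?L 1 c ^ 2 * ?L 1 c' + ?L 2 c * ?L 1 c') = emb (?L 1 c * ?L 1 c' ^ 2 + ?L 2 c' * ?L 1 c)"
      by (simp add: c c' emb.hom_add emb.hom_mult emb.hom_power)
    then have eq: "?L 1 c ^ 2 * ?L 1 c' + ?L 2 c * ?L 1 c' = ?L 1 c * ?L 1 c' ^ 2 + ?L 2 c' * ?L 1 c"
      by simp
    \<comment> \<open>Setting the second row to 0 removes the terms with \<open>lincomb 2\<close>
      and leaves s^2 s' = s s'^2, hence s = s'.\<close>
    define \<psi> :: "(entry, 'p mod_ring) mpoly \<Rightarrow> (entry, 'p mod_ring) mpoly" where
      "\<psi> = subst (\<lambda>v. case v of Entry i j \<Rightarrow> if i = 1 then Var v else 0)"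
    have \<psi>: "\<psi> (?L 1 c) = ?L 1 c" "\<psi> (?L 2 c) = 0" for c
      by (simp_all add: lincomb_def \<psi>_def subst.hom_sum subst.hom_mult)
    have "?L 1 c ^ 2 * ?L 1 c' = ?L 1 c * ?L 1 c' ^ 2"
      using arg_cong[OF eq, of \<psi>] \<psi>
      by (simp add: \<psi>_def subst.hom_add subst.hom_mult subst.hom_power)
    moreover have "?L 1 c \<noteq> 0" "?L 1 c' \<noteq> 0" using nz by (simp_all add: c c')
    ultimately have "?L 1 c = ?L 1 c'" by (simp add: power2_eq_square)
    then show ?thesis using lincomb_inj[of 1 c c'] by (simp add: c c')
  qed
qed

lemma card_shifts: "card (shifts :: ('p::prime_card genfield \<times> 'p genfield) set) = CARD('p) ^ 4"
proof -
  have "inj (\<lambda>c::'p mod_ring ^ 4. (emb (lincomb 1 c), emb (lincomb 2 c)))"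
    using lincomb_inj by (auto intro!: injI)
  then show ?thesis
    by (simp add: shifts_def card_image)
qed

lemma invariants_eq:
  assumes "odd CARD('p::prime_card)"
  shows "invariants = {f :: 'p gring. shift_group.invariant shifts f}"
proof -
  interpret shift_group "shifts :: ('p genfield \<times> 'p genfield) set"
    by (rule shift_group_shifts[OF assms])
  show ?thesis
    unfolding invariants_def invariant_def act_eq_shift by (auto simp: shifts_def)
qed

lemma norm_z_eq:
  assumes "odd CARD('p::prime_card)"
  shows "norm_z = shift_group.orbit_norm (shifts :: ('p genfield \<times> 'p genfield) set)"
proof -
  interpret shift_group "shifts :: ('p genfield \<times> 'p genfield) set"
    by (rule shift_group_shifts[OF assms])
  \<comment> \<open>\<open>norm_z\<close> is a product over the orbit as a set. The translates of z
    are distinct because the restriction of each has slope 2 s, so it equals the product over the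
    group.\<close>
  have inj: "inj_on (\<lambda>g. act_by g (Var Vz)) shifts"
  proof (rule inj_onI)
    fix g h :: "'p genfield \<times> 'p genfield"
    assume gh: "g \<in> shifts" "h \<in> shifts" "act_by g (Var Vz) = act_by h (Var Vz)"
    have "restr (act_by g (Var Vz)) = restr (act_by h (Var Vz))" using gh(3) by simp
    then have "fst g = fst h"
      using two_nonzero by (simp add: shift_z restr.hom_add restr.hom_mult)
    then show "g = h" using fst_inj gh by blast
  qed
  have "range (act (Var Vz)) = (\<lambda>g. act_by g (Var Vz)) ` (shifts :: ('p genfield \<times> 'p genfield) set)"
    by (auto simp: shifts_def act_eq_shift image_iff)
  then have "norm_z = \<Prod>((\<lambda>g. act_by g (Var Vz)) ` (shifts :: ('p genfield \<times> 'p genfield) set))"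
    by (simp add: norm_z_def)
  also have "\<dots> = orbit_norm"
    unfolding orbit_norm_def using prod.reindex[OF inj, of "\<lambda>f. f"] by simp
  finally show ?thesis .
qed

lemma odd_card:
  assumes "CARD('p::prime_card) > 5"
  shows "odd CARD('p)"
  using prime_odd_nat[OF prime_card[where ?'a = 'p]] assms by simp

section \<open>Relations between the minors in use\<close>

lemma Gam_power: "r \<ge> 1 \<Longrightarrow> Gam r j ^ CARD('p) = (Gam (r + 2) j :: 'p::prime_card genfield)"
proof -
  assume "r \<ge> 1"
  then have "(r + 2 - 1) div 2 = Suc ((r - 1) div 2)" by presburger
  then show ?thesis by (simp add: Gam_def power_mult[symmetric] mult.commute)
qed

text \<open>The p-th power is a ring homomorphism, and on the matrix it moves every row down by
  two.\<close>

lemma gam_power: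
  assumes "i \<ge> 1" "j \<ge> 1" "k \<ge> 1" "l \<ge> 1"
    and "i' = i + 2" "j' = j + 2" "k' = k + 2" "l' = l + 2"
  shows "gam i j k l ^ CARD('p) = (gam i' j' k' l' :: 'p::prime_card genfield)"
proof -
  have "comm_ring_hom (\<lambda>v :: 'p genfield. v ^ CARD('p))"
    by unfold_locales
      (simp_all add: frobenius_add[OF of_nat_card_eq_0(2)] power_mult_distrib power_0_left)
  from hom_d4[OF this, of "Gam i" "Gam j" "Gam k" "Gam l"] show ?thesis
    using assms by (simp add: gam_eq_d4 Gam_power)
qed

lemma gam_power_numerals:
  "gam 1 2 3 4 ^ CARD('p) = (gam 3 4 5 6 :: 'p::prime_card genfield)"
  "gam 1 2 3 5 ^ CARD('p) = (gam 3 4 5 7 :: 'p genfield)"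
  "gam 1 2 4 5 ^ CARD('p) = (gam 3 4 6 7 :: 'p genfield)"
  "gam 1 3 4 5 ^ CARD('p) = (gam 3 5 6 7 :: 'p genfield)"
  "gam 2 3 4 5 ^ CARD('p) = (gam 4 5 6 7 :: 'p genfield)"
  by (rule gam_power; simp)+

text \<open>p-th powers of minors of rows 1 to 5 are minors of rows 3 to 7. Here, as in the next
  three, these five rows are expanded against three fixed ones, here 1, 2, 3; terms with a repeated
  row vanish.\<close>

lemma plucker1:
  "gam 1 2 4 5 ^ CARD('p) * gam 1 2 3 5 - gam 1 2 3 5 ^ CARD('p) * gam 1 2 3 6
    - gam 1 2 3 4 * gam 1 3 4 5 ^ CARD('p) = - (gam 1 2 3 4 ^ CARD('p) * (gam 1 2 3 7 :: 'p::prime_card genfield))"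
  unfolding gam_power_numerals unfolding gam_eq_d4
  using d4_plucker[where ?v1.0 = "Gam 3" and ?v2.0 = "Gam 4" and ?v3.0 = "Gam 5" and ?v4.0 = "Gam 6"
      and ?v5.0 = "Gam 7" and q = "Gam 1" and r = "Gam 2" and s = "Gam 3 :: 4 \<Rightarrow> 'p genfield"]
  by (simp add: algebra_simps eq_neg_iff_add_eq_0)

lemma plucker2:
  "gam 1 2 4 5 ^ CARD('p) * gam 1 2 4 5 - gam 1 2 3 5 ^ CARD('p) * gam 1 2 4 6
    - gam 1 2 3 4 * gam 2 3 4 5 ^ CARD('p) = - (gam 1 2 3 4 ^ CARD('p) * (gam 1 2 4 7 :: 'p::prime_card genfield))"
  unfolding gam_power_numerals unfolding gam_eq_d4
  using d4_plucker[where ?v1.0 = "Gam 3" and ?v2.0 = "Gam 4" and ?v3.0 = "Gam 5" and ?v4.0 = "Gam 6"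
      and ?v5.0 = "Gam 7" and q = "Gam 1" and r = "Gam 2" and s = "Gam 4 :: 4 \<Rightarrow> 'p genfield"]
  unfolding d4_swap34[of "Gam 1" "Gam 2" "Gam 4" "Gam 3 :: 4 \<Rightarrow> 'p genfield"]
  by (simp add: algebra_simps eq_neg_iff_add_eq_0)

lemma plucker3:
  "gam 1 2 4 5 ^ CARD('p) * gam 1 3 4 5 - gam 1 2 3 5 ^ CARD('p) * gam 1 3 4 6
     = - (gam 1 2 3 4 ^ CARD('p) * (gam 1 3 4 7 :: 'p::prime_card genfield))"
  unfolding gam_power_numerals unfolding gam_eq_d4
  using d4_plucker[where ?v1.0 = "Gam 3" and ?v2.0 = "Gam 4" and ?v3.0 = "Gam 5" and ?v4.0 = "Gam 6"
      and ?v5.0 = "Gam 7" and q = "Gam 1" and r = "Gam 3" and s = "Gam 4 :: 4 \<Rightarrow> 'p genfield"]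
  by (simp add: algebra_simps eq_neg_iff_add_eq_0)

lemma plucker4:
  "gam 1 2 4 5 ^ CARD('p) * gam 2 3 4 5 - gam 1 2 3 5 ^ CARD('p) * gam 2 3 4 6
     = - (gam 1 2 3 4 ^ CARD('p) * (gam 2 3 4 7 :: 'p::prime_card genfield))"
  unfolding gam_power_numerals unfolding gam_eq_d4
  using d4_plucker[where ?v1.0 = "Gam 3" and ?v2.0 = "Gam 4" and ?v3.0 = "Gam 5" and ?v4.0 = "Gam 6"
      and ?v5.0 = "Gam 7" and q = "Gam 2" and r = "Gam 3" and s = "Gam 4 :: 4 \<Rightarrow> 'p genfield"]
  by (simp add: algebra_simps eq_neg_iff_add_eq_0)

text \<open>Now rows 1 to 5 are expanded against 1, 2, 7, so only three terms survive; the next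
  relation does the same with 1, 3, 7.\<close>

lemma plucker5:
  "gam 1 2 3 4 * gam 1 2 5 7 + gam 1 2 3 7 * gam 1 2 4 5 = gam 1 2 3 5 * (gam 1 2 4 7 :: 'p::prime_card genfield)"
  unfolding gam_eq_d4
  using d4_plucker[where ?v1.0 = "Gam 1" and ?v2.0 = "Gam 2" and ?v3.0 = "Gam 3" and ?v4.0 = "Gam 4"
      and ?v5.0 = "Gam 5" and q = "Gam 1" and r = "Gam 2" and s = "Gam 7 :: 4 \<Rightarrow> 'p genfield"]
    d4_swap34[of "Gam 1" "Gam 2" "Gam 7" "Gam 3 :: 4 \<Rightarrow> 'p genfield"]
    d4_swap34[of "Gam 1" "Gam 2" "Gam 7" "Gam 4 :: 4 \<Rightarrow> 'p genfield"]
    d4_swap34[of "Gam 1" "Gam 2" "Gam 7" "Gam 5 :: 4 \<Rightarrow> 'p genfield"]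
  by (simp add: algebra_simps)

lemma plucker6:
  "gam 1 2 3 7 * gam 1 3 4 5 + gam 1 2 3 4 * gam 1 3 5 7 = gam 1 2 3 5 * (gam 1 3 4 7 :: 'p::prime_card genfield)"
  unfolding gam_eq_d4
  using d4_plucker[where ?v1.0 = "Gam 1" and ?v2.0 = "Gam 2" and ?v3.0 = "Gam 3" and ?v4.0 = "Gam 4"
      and ?v5.0 = "Gam 5" and q = "Gam 1" and r = "Gam 3" and s = "Gam 7 :: 4 \<Rightarrow> 'p genfield"]
    d4_swap34[of "Gam 1" "Gam 3" "Gam 7" "Gam 2 :: 4 \<Rightarrow> 'p genfield"]
    d4_swap23[of "Gam 1" "Gam 3" "Gam 2" "Gam 7 :: 4 \<Rightarrow> 'p genfield"]
    d4_swap34[of "Gam 1" "Gam 3" "Gam 7" "Gam 4 :: 4 \<Rightarrow> 'p genfield"]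
    d4_swap34[of "Gam 1" "Gam 3" "Gam 7" "Gam 5 :: 4 \<Rightarrow> 'p genfield"]
  by (simp add: algebra_simps)

subsection \<open>Nonvanishing minors\<close>

definition spec_row :: "(entry \<Rightarrow> 'p::prime_card mod_ring poly) \<Rightarrow> nat \<Rightarrow> 4 \<Rightarrow> 'p mod_ring poly" where
  "spec_row h r j = h (Entry (if odd r then 1 else 2) j) ^ (CARD('p) ^ ((r - 1) div 2))"

text \<open>Before passing to fractions the minor is a polynomial in the entries, so it is nonzero
  as soon as one specialisation of it is.\<close>

lemma gam_nonzero:
  fixes h :: "entry \<Rightarrow> 'p::prime_card mod_ring poly"
  assumes "d4 (spec_row h i) (spec_row h j) (spec_row h k) (spec_row h l) \<noteq> 0"
  shows "gam i j k l \<noteq> (0 :: 'p genfield)"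
proof
  assume zero: "gam i j k l = (0 :: 'p genfield)"
  define P :: "nat \<Rightarrow> 4 \<Rightarrow> (entry, 'p mod_ring) mpoly" where
    "P r j = Var (Entry (if odd r then 1 else 2) j) ^ (CARD('p) ^ ((r - 1) div 2))" for r j
  have Gam: "Gam r = (\<lambda>j. emb (P r j))" for r
    by (simp add: fun_eq_iff Gam_def P_def xm_eq_emb emb.hom_power)
  have "emb (d4 (P i) (P j) (P k) (P l)) = 0"
    using zero by (simp add: gam_eq_d4 Gam hom_d4[OF emb.comm_ring_hom_axioms])
  then have "d4 (P i) (P j) (P k) (P l) = 0" by simp
  then have 0: "ev (\<lambda>c. [:c:]) h (d4 (P i) (P j) (P k) (P l)) = 0"
    by (simp add: ev_def)
  interpret ev: comm_ring_hom "ev (\<lambda>c. [:c:]) h"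
    by (rule ev_hom[OF comm_ring_hom_const_poly])
  have "(\<lambda>j. ev (\<lambda>c. [:c:]) h (P r j)) = spec_row h r" for r
    by (simp add: fun_eq_iff P_def spec_row_def ev.hom_power comm_ring_hom_const_poly)
  with 0 assms show False
    by (simp add: hom_d4[OF ev.comm_ring_hom_axioms])
qed

lemma X_power_eq_iff: "([:0, 1:] :: 'a::comm_ring_1 poly) ^ m = [:0, 1:] ^ n \<longleftrightarrow> m = n"
proof
  assume "([:0, 1:] :: 'a poly) ^ m = [:0, 1:] ^ n"
  then have "monom (1::'a) m = monom 1 n" by (simp add: monom_altdef)
  then show "m = n" by (metis degree_monom_eq one_neq_zero)
qed simp

lemma d4_vandermonde:
  "d4 (\<lambda>j. if j = 1 then 1 else if j = 2 then t0 else if j = 3 then t0^2 else t0^3)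
      (\<lambda>j. if j = 1 then 1 else if j = 2 then t1 else if j = 3 then t1^2 else t1^3)
      (\<lambda>j. if j = 1 then 1 else if j = 2 then t2 else if j = 3 then t2^2 else t2^3)
      (\<lambda>j. if j = 1 then 1 else if j = 2 then t3 else if j = 3 then t3^2 else t3^3)
   = (t1 - t0) * (t2 - t0) * (t3 - t0) * (t2 - t1) * (t3 - t1) * (t3 - t2)"
  by (simp add: d4_def algebra_simps power2_eq_square power3_eq_cube)

text \<open>Specialising \<open>x\<^sub>1\<^sub>j\<close> to \<open>T\<^sup>j\<^sup>-\<^sup>1\<close> turns the minor into a Vandermonde determinant in powers of \<open>T\<close>.\<close>

lemma gam_1357_nonzero: "gam 1 3 5 7 \<noteq> (0 :: 'p::prime_card genfield)"
proof -
  define p where "p = CARD('p)"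
  have p: "p > 1" unfolding p_def using prime_gt_1_nat[OF prime_card] .
  define T :: "'p mod_ring poly" where "T = [:0, 1:]"
  define h where "h v = (case v of Entry i j \<Rightarrow> if j = 1 then 1 else if j = 2 then T else if j = 3 then T^2 else T^3)" for v
  have row: "spec_row h r = (\<lambda>j. if j = 1 then 1 else if j = 2 then T^(p^n) else if j = 3 then (T^(p^n))^2 else (T^(p^n))^3)"
    if "odd r" "(r - 1) div 2 = n" for r n
    using that by (simp add: fun_eq_iff spec_row_def h_def power_mult[symmetric] mult.commute p_def)
  have rows: "spec_row h 1 = (\<lambda>j. if j = 1 then 1 else if j = 2 then T^(p^0) else if j = 3 then (T^(p^0))^2 else (T^(p^0))^3)"
    "spec_row h 3 = (\<lambda>j. if j = 1 then 1 else if j = 2 then T^(p^1) else if j = 3 then (T^(p^1))^2 else (T^(p^1))^3)"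
    "spec_row h 5 = (\<lambda>j. if j = 1 then 1 else if j = 2 then T^(p^2) else if j = 3 then (T^(p^2))^2 else (T^(p^2))^3)"
    "spec_row h 7 = (\<lambda>j. if j = 1 then 1 else if j = 2 then T^(p^3) else if j = 3 then (T^(p^3))^2 else (T^(p^3))^3)"
    by (rule row; simp)+
  have ne: "T^(p^m) - T^(p^n) \<noteq> 0" if "m \<noteq> n" for m n
    using that p by (simp add: T_def X_power_eq_iff)
  then have "d4 (spec_row h 1) (spec_row h 3) (spec_row h 5) (spec_row h 7) \<noteq> 0"
    unfolding rows d4_vandermonde
    using ne[of 1 0] ne[of 2 0] ne[of 3 0] ne[of 2 1] ne[of 3 1] ne[of 3 2] by simp
  then show ?thesis by (rule gam_nonzero)
qed

lemma gam_1235_nonzero: "gam 1 2 3 5 \<noteq> (0 :: 'p::prime_card genfield)"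
proof -
  define p where "p = CARD('p)"
  have p: "p > 1" unfolding p_def using prime_gt_1_nat[OF prime_card] .
  define T :: "'p mod_ring poly" where "T = [:0, 1:]"
  \<comment> \<open>Row 2 becomes a unit vector whose column is zero in the other rows, leaving a 3
    by 3 Vandermonde determinant in T, T^p, T^(p^2).\<close>
  define h where "h v = (case v of Entry i j \<Rightarrow>
    if i = 1 then (if j = 1 then 1 else if j = 2 then 0 else if j = 3 then T else T^2)
    else (if j = 2 then 1 else 0))" for v
  have row: "spec_row h r = (\<lambda>j. if j = 1 then 1 else if j = 2 then 0 else if j = 3 then T^(p^n) else (T^(p^n))^2)"
    if "odd r" "(r - 1) div 2 = n" for r n
    using that by (simp add: fun_eq_iff spec_row_def h_def power_mult[symmetric] mult.commute p_def)
  have rows: "spec_row h 1 = (\<lambda>j. if j = 1 then 1 else if j = 2 then 0 else if j = 3 then T^(p^0) else (T^(p^0))^2)"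
    "spec_row h 3 = (\<lambda>j. if j = 1 then 1 else if j = 2 then 0 else if j = 3 then T^(p^1) else (T^(p^1))^2)"
    "spec_row h 5 = (\<lambda>j. if j = 1 then 1 else if j = 2 then 0 else if j = 3 then T^(p^2) else (T^(p^2))^2)"
    by (rule row; simp)+
  have row2: "spec_row h 2 = (\<lambda>j. if j = 2 then 1 else 0)"
    by (simp add: fun_eq_iff spec_row_def h_def)
  have vandermonde: "d4 (\<lambda>j. if j = 1 then 1 else if j = 2 then 0 else if j = 3 then t0 else t0^2)
     (\<lambda>j. if j = 2 then 1 else 0)
     (\<lambda>j. if j = 1 then 1 else if j = 2 then 0 else if j = 3 then t1 else t1^2)
     (\<lambda>j. if j = 1 then 1 else if j = 2 then 0 else if j = 3 then t2 else t2^2)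
     = (t1 - t0) * (t2 - t0) * (t2 - t1)" for t0 t1 t2 :: "'p mod_ring poly"
    by (simp add: d4_def algebra_simps power2_eq_square)
  have ne: "T^(p^m) - T^(p^n) \<noteq> 0" if "m \<noteq> n" for m n
    using that p by (simp add: T_def X_power_eq_iff)
  then have "d4 (spec_row h 1) (spec_row h 2) (spec_row h 3) (spec_row h 5) \<noteq> 0"
    unfolding rows row2 vandermonde using ne[of 1 0] ne[of 2 0] ne[of 2 1] by simp
  then show ?thesis by (rule gam_nonzero)
qed

lemma gam_1234_nonzero: "gam 1 2 3 4 \<noteq> (0 :: 'p::prime_card genfield)"
proof -
  define p where "p = CARD('p)"
  have p: "p > 1" unfolding p_def using prime_gt_1_nat[OF prime_card] .
  define T :: "'p mod_ring poly" where "T = [:0, 1:]"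
  \<comment> \<open>Odd rows live in columns 1, 3 and even rows in columns 2, 4, so the determinant
    splits into two 2 by 2 blocks, each T^p - T.\<close>
  define h where "h v = (case v of Entry i j \<Rightarrow>
    if i = 1 then (if j = 1 then 1 else if j = 3 then T else 0)
    else (if j = 2 then 1 else if j = 4 then T else 0))" for v
  have row: "spec_row h 1 = (\<lambda>j. if j = 1 then 1 else if j = 3 then T else 0)"
    "spec_row h 2 = (\<lambda>j. if j = 2 then 1 else if j = 4 then T else 0)"
    "spec_row h 3 = (\<lambda>j. if j = 1 then 1 else if j = 3 then T^p else 0)"
    "spec_row h 4 = (\<lambda>j. if j = 2 then 1 else if j = 4 then T^p else 0)"
    by (simp_all add: fun_eq_iff spec_row_def h_def p_def)
  have "d4 (spec_row h 1) (spec_row h 2) (spec_row h 3) (spec_row h 4) = (T^p - T) * (T^p - T)"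
    unfolding row by (simp add: d4_def algebra_simps)
  moreover have "T^p - T \<noteq> 0"
    using p X_power_eq_iff[of p 1, where ?'a = "'p mod_ring"] by (simp add: T_def)
  ultimately show ?thesis
    by (intro gam_nonzero[of h]) simp
qed

section \<open>The invariants of the generic representation\<close>

text \<open>In a domain the quotient is unique, so an explicit witness evaluates the definite
  description.\<close>

lemma exact_quot_eq: "d \<noteq> 0 \<Longrightarrow> g * d = f \<Longrightarrow> exact_quot f d = (g :: 'a::idom)"
  unfolding exact_quot_def by (rule the_equality) auto

lemma gen_act_invariant:
  assumes "\<And>j. gen_act j f = f"
  shows "f \<in> invariants"
proof -
  have "(gen_act j ^^ n) f = f" for j n
    by (induction n) (simp_all add: assms)
  then show ?thesis by (simp add: invariants_def act_def Let_def)
qed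

context
  assumes p_gt: "CARD('p::prime_card) > 5"
begin

abbreviation (input) "ga \<equiv> gam 1 2 3 4 :: 'p genfield"
abbreviation (input) "gb \<equiv> gam 1 2 3 5 :: 'p genfield"

interpretation S: shift_group "shifts :: ('p genfield \<times> 'p genfield) set"
  by (rule shift_group_shifts[OF odd_card[OF p_gt]])

interpretation F: frobenius_ring "CARD('p)" "Var Vx :: 'p gring" "Var Vy" "Var Vz"
  "Const ga" "Const gb" "Const (gam 1 2 4 5)" "Const (gam 1 3 4 5)"
  "Const (gam 2 3 4 5)" "Const (gam 1 2 3 6)" "Const (gam 1 2 4 6)" "Const (gam 1 3 4 6)"
  "Const (gam 2 3 4 6)"
  using frobenius_add[OF of_nat_card_eq_0(3)] odd_card[OF p_gt] p_gt by unfold_locales auto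

section \<open>Invariance, degree and lead term of \<open>f1\<close> and its companion\<close>

lemma dlt_eq: "dlt = F.\<delta>"
  by (simp add: dlt_def F.\<delta>_def)

lemma f1_eq: "f1 = F.g1"
  unfolding f1_def Let_def dlt_eq F.g1_eq ..

lemma f12346_eq: "f12346 = F.g"
  unfolding f12346_def Let_def dlt_eq F.g_eq ..

lemma shift_dlt: "shift s t F.\<delta> = F.\<delta> - Const t * Var Vx ^ 2"
  by (simp add: F.\<delta>_def shift.hom_minus shift.hom_power shift.hom_mult shift_y shift_z
      Const.hom_add Const.hom_mult Const.hom_power algebra_simps power2_eq_square)

lemma invariants_S: "(f :: 'p gring) \<in> invariants \<longleftrightarrow> S.invariant f"
  by (simp add: invariants_eq[OF odd_card[OF p_gt]])

lemma Gam_numerals: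
  "Gam 1 j = (xm 1 j :: 'p genfield)" "Gam 2 j = (xm 2 j :: 'p genfield)"
  "Gam 3 j = (xm 1 j ^ CARD('p) :: 'p genfield)" "Gam 4 j = (xm 2 j ^ CARD('p) :: 'p genfield)"
  "Gam 5 j = (xm 1 j ^ (CARD('p)^2) :: 'p genfield)" "Gam 6 j = (xm 2 j ^ (CARD('p)^2) :: 'p genfield)"
  by (simp_all add: Gam_def)

lemma invariant_f1: "S.invariant (f1 :: 'p gring)"
  unfolding invariants_S[symmetric]
proof (rule gen_act_invariant)
  fix j
  let ?s = "xm 1 j :: 'p genfield" and ?t = "xm 2 j :: 'p genfield"
  \<comment> \<open>The j-th coordinates of rows 1 to 5 are s, t and their powers, so this is the
    Cramer relation for those rows.\<close>
  have coeff: "gam 2 3 4 5 * ?s - gam 1 3 4 5 * ?t + gam 1 2 4 5 * ?s ^ CARD('p)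
      - gb * ?t ^ CARD('p) + ga * ?s ^ (CARD('p)^2) = 0"
    using d4_cramer[where ?v1.0 = "Gam 1" and ?v2.0 = "Gam 2" and ?v3.0 = "Gam 3" and ?v4.0 = "Gam 4"
      and ?v5.0 = "Gam 5 :: 4 \<Rightarrow> 'p genfield" and j = j]
    unfolding gam_eq_d4 Gam_numerals .
  have "gen_act j f1 = F.g1 + (Const (gam 2 3 4 5) * Const ?s - Const (gam 1 3 4 5) * Const ?t
      + Const (gam 1 2 4 5) * Const ?s ^ CARD('p) - Const gb * Const ?t ^ CARD('p)
      + Const ga * Const ?s ^ (CARD('p)^2)) * Var Vx ^ (CARD('p)^2)"
    unfolding F.g1_shift[symmetric]
    by (simp add: f1_def Let_def gen_act_eq_shift dlt_eq shift.hom_add shift.hom_mult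
        shift.hom_power shift_dlt shift_y)
  also have "\<dots> = F.g1 + Const 0 * Var Vx ^ (CARD('p)^2)"
    unfolding coeff[symmetric]
    by (simp add: Const.hom_add Const.hom_minus Const.hom_mult Const.hom_power)
  finally show "gen_act j f1 = (f1 :: 'p gring)" by (simp add: f1_eq)
qed

lemma invariant_f12346: "S.invariant (f12346 :: 'p gring)"
  unfolding invariants_S[symmetric]
proof (rule gen_act_invariant)
  fix j
  let ?s = "xm 1 j :: 'p genfield" and ?t = "xm 2 j :: 'p genfield"
  \<comment> \<open>Row 6 replaces row 5, so the last term carries the p^2-th power of t instead of
    s.\<close>
  have coeff: "gam 2 3 4 6 * ?s - gam 1 3 4 6 * ?t + gam 1 2 4 6 * ?s ^ CARD('p)
      - gam 1 2 3 6 * ?t ^ CARD('p) + ga * ?t ^ (CARD('p)^2) = 0"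
    using d4_cramer[where ?v1.0 = "Gam 1" and ?v2.0 = "Gam 2" and ?v3.0 = "Gam 3" and ?v4.0 = "Gam 4"
      and ?v5.0 = "Gam 6 :: 4 \<Rightarrow> 'p genfield" and j = j]
    unfolding gam_eq_d4 Gam_numerals .
  have "gen_act j f12346 = F.g + (Const (gam 2 3 4 6) * Const ?s - Const (gam 1 3 4 6) * Const ?t
      + Const (gam 1 2 4 6) * Const ?s ^ CARD('p) - Const (gam 1 2 3 6) * Const ?t ^ CARD('p)
      + Const ga * Const ?t ^ (CARD('p)^2)) * Var Vx ^ (2 * CARD('p)^2)"
    unfolding F.g_shift[symmetric]
    by (simp add: f12346_def Let_def gen_act_eq_shift dlt_eq shift.hom_add shift.hom_mult
        shift.hom_power shift_dlt shift_y shift.hom_minus shift.hom_uminus)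
  also have "\<dots> = F.g + Const 0 * Var Vx ^ (2 * CARD('p)^2)"
    unfolding coeff[symmetric]
    by (simp add: Const.hom_add Const.hom_minus Const.hom_mult Const.hom_power)
  finally show "gen_act j f12346 = (f12346 :: 'p gring)" by (simp add: f12346_eq)
qed

lemma homog_dlt: "homog 2 F.\<delta>"
proof -
  have "homog (2 * 1) (Var Vy ^ 2 :: 'p gring)" "homog (1 + 1) (Var Vx * Var Vz :: 'p gring)"
    by (intro homog_power homog_mult homog_Var)+
  then show ?thesis unfolding F.\<delta>_def by (intro homog_diff) (simp_all add: numeral_2_eq_2)
qed

lemma homog_term:
  "i + j + 2 * k = n \<Longrightarrow> homog n (Const c * (Var Vx ^ i * Var Vy ^ j * F.\<delta> ^ k))"
proof -
  assume "i + j + 2 * k = n"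
  moreover have "homog (i * 1 + j * 1 + k * 2) (Var Vx ^ i * Var Vy ^ j * F.\<delta> ^ k)"
    by (intro homog_mult homog_power homog_Var homog_dlt)
  ultimately show ?thesis by (intro homog_Const_mult) (simp add: mult.commute)
qed

lemma homog_f1: "homog (CARD('p)^2) (f1 :: 'p gring)"
proof -
  let ?p = "CARD('p)"
  have "f1 = Const ga * (Var Vx ^ 0 * Var Vy ^ (?p^2) * F.\<delta> ^ 0)
    + Const gb * (Var Vx ^ (?p^2 - 2*?p) * Var Vy ^ 0 * F.\<delta> ^ ?p)
    + Const (gam 1 2 4 5) * (Var Vx ^ (?p^2 - ?p) * Var Vy ^ ?p * F.\<delta> ^ 0)
    + Const (gam 1 3 4 5) * (Var Vx ^ (?p^2 - 2) * Var Vy ^ 0 * F.\<delta> ^ 1)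
    + Const (gam 2 3 4 5) * (Var Vx ^ (?p^2 - 1) * Var Vy ^ 1 * F.\<delta> ^ 0)"
    by (simp add: f1_def Let_def dlt_eq mult_ac)
  also have "homog (?p^2) \<dots>"
    using F.p_sq_ge p_gt by (intro homog_add homog_term) simp_all
  finally show ?thesis .
qed

lemma homog_f12346: "homog (2 * CARD('p)^2) (f12346 :: 'p gring)"
proof -
  let ?p = "CARD('p)"
  have "f12346 = Const (- ga) * (Var Vx ^ 0 * Var Vy ^ 0 * F.\<delta> ^ (?p^2))
    + Const (gam 1 2 3 6) * (Var Vx ^ (2*?p^2 - 2*?p) * Var Vy ^ 0 * F.\<delta> ^ ?p)
    + Const (gam 1 2 4 6) * (Var Vx ^ (2*?p^2 - ?p) * Var Vy ^ ?p * F.\<delta> ^ 0)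
    + Const (gam 1 3 4 6) * (Var Vx ^ (2*?p^2 - 2) * Var Vy ^ 0 * F.\<delta> ^ 1)
    + Const (gam 2 3 4 6) * (Var Vx ^ (2*?p^2 - 1) * Var Vy ^ 1 * F.\<delta> ^ 0)"
    by (simp add: f12346_def Let_def dlt_eq mult_ac Const.hom_uminus)
  also have "homog (2 * ?p^2) \<dots>"
    using F.p_sq_ge p_gt by (intro homog_add homog_term) simp_all
  finally show ?thesis .
qed

lemma lead_f1: "grevlex.lead (f1 :: 'p gring) (single Vy (CARD('p)^2)) ga"
proof -
  let ?p = "CARD('p)"
  have "Var Vx ^ (?p^2 - 2*?p) = Var Vx * (Var Vx ^ (?p^2 - 2*?p - 1) :: 'p gring)"
    unfolding power_Suc[symmetric] using F.p_sq_ge p_gt by (intro arg_cong[where f = "\<lambda>n. Var Vx ^ n"]) simp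
  then have "f1 = Const ga * Var Vy ^ (?p^2) + Var Vx * (Var Vx ^ (?p^2 - 2*?p - 1) * F.t)"
    unfolding f1_eq F.g1_def by (simp only: mult.assoc)
  then show ?thesis
    using homog_f1 lead_homog_mod_x gam_1234_nonzero by metis
qed

section \<open>Invariance, degree and lead term of \<open>f2\<close>\<close>

definition half :: "'p gring" where
  "half = Const (1 / 2)"

lemma two_half: "2 * half = 1"
proof -
  have "2 * half = Const (2 * (1 / 2))"
    unfolding half_def by (simp only: Const.hom_mult Const_numeral)
  also have "(2 :: 'p genfield) * (1 / 2) = 1" using S.two_nonzero by simp
  finally show ?thesis by simp
qed

lemma two_gring_nonzero: "(2 :: 'p gring) \<noteq> 0"
  by (rule two_nonzero_of_CHAR[OF of_nat_card_eq_0(3) odd_card[OF p_gt]])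

lemma Var_nonzero: "Var v \<noteq> (0 :: 'p gring)"
  using grevlex.lead_nonzero(2)[OF lead_Var] .

lemma f2_mult: "f2 * (2 * Var Vx ^ (CARD('p)^2 - 2 * CARD('p))) = f1^2 + Const ga * (f12346 :: 'p gring)"
  and f2_eq: "(f2 :: 'p gring) = F.g2 half"
proof -
  have eq: "F.g2 half * (2 * Var Vx ^ (CARD('p)^2 - 2 * CARD('p))) = f1^2 + Const ga * f12346"
    using F.g2_eq[OF two_half] by (simp add: f1_eq f12346_eq)
  show "f2 = F.g2 half"
    unfolding f2_def Let_def
    by (rule exact_quot_eq[OF _ eq]) (simp add: two_gring_nonzero Var_nonzero)
  with eq show "f2 * (2 * Var Vx ^ (CARD('p)^2 - 2 * CARD('p))) = f1^2 + Const ga * f12346" by simp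
qed

text \<open>The product with the nonzero invariant divisor is invariant, and the ring is a
  domain.\<close>

lemma invariant_f2: "S.invariant (f2 :: 'p gring)"
proof (rule S.inv_cancel)
  show "S.invariant (2 * Var Vx ^ (CARD('p)^2 - 2 * CARD('p)) * f2)"
    using f2_mult by (simp add: mult.commute S.inv_add S.inv_mult S.inv_power S.inv_Const invariant_f1 invariant_f12346)
  show "S.invariant (2 * Var Vx ^ (CARD('p)^2 - 2 * CARD('p)))"
    using S.inv_mult[OF S.inv_Const[of 2] S.inv_power[OF S.inv_x]] by simp
  show "2 * Var Vx ^ (CARD('p)^2 - 2 * CARD('p)) \<noteq> (0 :: 'p gring)"
    by (simp add: two_gring_nonzero Var_nonzero)
qed

lemma homog_f2: "homog (CARD('p)^2 + 2 * CARD('p)) (f2 :: 'p gring)"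
proof (rule homog_cancel)
  let ?n = "CARD('p)^2 - 2 * CARD('p)"
  have "homog (0 + ?n * 1) (Const 2 * Var Vx ^ ?n :: 'p gring)"
    by (intro homog_mult homog_power homog_Var homog_Const)
  then show "homog ?n (2 * Var Vx ^ ?n :: 'p gring)" by simp
  show "2 * Var Vx ^ ?n \<noteq> (0 :: 'p gring)"
    by (simp add: two_gring_nonzero Var_nonzero)
  have "homog (2 * CARD('p)^2) (f1^2 + Const ga * (f12346 :: 'p gring))"
    by (intro homog_add homog_power homog_Const_mult homog_f1 homog_f12346)
  moreover have "?n + (CARD('p)^2 + 2 * CARD('p)) = 2 * CARD('p)^2"
    using F.p_sq_ge by simp
  ultimately show "homog (?n + (CARD('p)^2 + 2 * CARD('p))) (2 * Var Vx ^ ?n * (f2 :: 'p gring))"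
    using f2_mult by (simp add: mult.commute)
qed

lemma lead_f2: "grevlex.lead (f2 :: 'p gring) (single Vy (CARD('p)^2 + 2 * CARD('p))) (ga * gb)"
proof -
  obtain w where "F.g2 half = Const ga * Const gb * Var Vy ^ (CARD('p)^2 + 2 * CARD('p)) + Var Vx * w"
    using F.g2_form[OF two_half] .
  then have "f2 = Const (ga * gb) * Var Vy ^ (CARD('p)^2 + 2 * CARD('p)) + Var Vx * w"
    by (simp add: f2_eq Const.hom_mult)
  moreover have "ga * gb \<noteq> 0" using gam_1234_nonzero[where ?'p = 'p] gam_1235_nonzero[where ?'p = 'p] by simp
  ultimately show ?thesis
    using homog_f2 lead_homog_mod_x by metis
qed

section \<open>Invariance, degree and lead term of \<open>f3\<close>\<close>

abbreviation (input) "x3 \<equiv> Const (ga ^ (2 * CARD('p) + 2)) * Var Vx ^ (2 * CARD('p)^2 - 2) :: 'p gring"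

lemma x3_nonzero: "x3 \<noteq> 0"
  using gam_1234_nonzero[where ?'p = 'p] by (simp add: Var_nonzero)

text \<open>The first claim is the residue of \<open>f3\<close> modulo x and yields the lead term;
  the second says that the division is exact and transfers invariance and degree.\<close>

lemma f3_form:
  obtains w where "f3 = Const (gam 1 3 5 7) * Var Vy ^ (CARD('p)^3 + 2) + Var Vx * (w :: 'p gring)"
    "f3 * x3 = - f3_tilde * Const gb"
proof -
  have alpha3: "Const gb * Const alpha3 = Const ga ^ (CARD('p) + 1) * Const (gam 1 2 3 7 :: 'p genfield)"
    unfolding Const.hom_mult[symmetric] Const.hom_power[symmetric] alpha3_def
    using gam_1235_nonzero[where ?'p = 'p] by simp
  \<comment> \<open>Splits the denominator of \<alpha>4 into one factor for clearing and the power
    that comes from \<open>f2\<close>.\<close>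
  have n: "Suc ((CARD('p) + 1) div 2) = (CARD('p) + 3) div 2"
    by presburger
  have alpha4: "Const gb * Const alpha4 * Const gb ^ ((CARD('p) + 1) div 2)
      = Const ga ^ (CARD('p) + 3) * Const (gam 1 2 5 7 :: 'p genfield)"
  proof -
    have "gb * alpha4 * gb ^ ((CARD('p) + 1) div 2) = alpha4 * gb ^ ((CARD('p) + 3) div 2)"
      unfolding n[symmetric] power_Suc by (simp add: mult_ac)
    also have "\<dots> = ga ^ (CARD('p) + 3) * gam 1 2 5 7"
      using gam_1235_nonzero[where ?'p = 'p] by (simp add: alpha4_def)
    finally show ?thesis
      by (simp add: Const.hom_mult[symmetric] Const.hom_power[symmetric])
  qed
  have alpha12: "Const alpha1 = - 2 * Const gb ^ CARD('p)"
    "Const alpha2 = Const ga * Const (gam 1 2 4 5 :: 'p genfield) ^ CARD('p)"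
    by (simp_all add: alpha1_def alpha2_def Const.hom_mult Const.hom_power Const.hom_uminus)
  note pl = arg_cong[OF plucker1[where ?'p = 'p], of Const] arg_cong[OF plucker2[where ?'p = 'p], of Const]
    arg_cong[OF plucker3[where ?'p = 'p], of Const] arg_cong[OF plucker4[where ?'p = 'p], of Const]
    arg_cong[OF plucker5[where ?'p = 'p], of Const] arg_cong[OF plucker6[where ?'p = 'p], of Const]
  note pl = pl[unfolded Const.hom_minus Const.hom_add Const.hom_uminus Const.hom_mult Const.hom_power]
  note g3t_def = F.g3t_def[OF two_half pl alpha12 alpha3 alpha4]
  obtain w where w: "- (Const gb * f3_tilde) = Const ga ^ (2 * CARD('p) + 2) * Var Vx ^ (2 * CARD('p)^2 - 2)
      * (Const (gam 1 3 5 7) * Var Vy ^ (CARD('p)^3 + 2)) + Var Vx ^ (2 * CARD('p)^2 - 2) * (Var Vx * w)"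
  proof (rule F.g3t_form[OF two_half pl alpha12 alpha3 alpha4])
    fix w
    assume *: "- (Const gb * F.g3t half (Const alpha1) (Const alpha2) (Const alpha3) (Const alpha4))
      = Const ga ^ (2 * CARD('p) + 2) * Var Vx ^ (2 * CARD('p)^2 - 2)
      * (Const (gam 1 3 5 7) * Var Vy ^ (CARD('p)^3 + 2)) + Var Vx ^ (2 * CARD('p)^2 - 2) * (Var Vx * w)"
    have eq: "f3_tilde = F.g3t half (Const alpha1) (Const alpha2) (Const alpha3) (Const alpha4)"
      unfolding f3_tilde_def Let_def g3t_def f1_eq f2_eq Const.hom_power ..
    from *[folded eq] show ?thesis by (rule that)
  qed
  define c where "c = ga ^ (2 * CARD('p) + 2)"
  have c: "c \<noteq> 0" using gam_1234_nonzero[where ?'p = 'p] by (simp add: c_def)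
  \<comment> \<open>The remainder w carries no factor c, but c is a unit of the coefficient
    field.\<close>
  define f where "f = Const (gam 1 3 5 7) * Var Vy ^ (CARD('p)^3 + 2) + Var Vx * (Const (1 / c) * w)"
  have "Const c * Const (1 / c) = (1 :: 'p gring)"
    unfolding Const.hom_mult[symmetric] using c by simp
  then have "f * x3 = Const c * Var Vx ^ (2 * CARD('p)^2 - 2) * (Const (gam 1 3 5 7) * Var Vy ^ (CARD('p)^3 + 2))
     + Var Vx ^ (2 * CARD('p)^2 - 2) * (Var Vx * w)"
    unfolding f_def c_def[symmetric] by (simp add: algebra_simps)
  also have "\<dots> = - f3_tilde * Const gb"
    unfolding c_def Const.hom_power unfolding w[symmetric] by (simp only: mult.commute mult_minus_left)
  finally have eq: "f * x3 = - f3_tilde * Const gb" .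
  have "f3 = f"
    unfolding f3_def Let_def by (rule exact_quot_eq[OF x3_nonzero eq])
  then show ?thesis using that eq unfolding f_def by metis
qed

lemma f3_mult: "x3 * f3 = - f3_tilde * Const gb"
  using f3_form by (metis mult.commute)

lemma invariant_f3: "S.invariant (f3 :: 'p gring)"
proof (rule S.inv_cancel[OF _ _ x3_nonzero])
  show "S.invariant (x3 * f3)"
    unfolding f3_mult f3_tilde_def Let_def diff_conv_add_uminus
    by (intro S.inv_mult S.inv_uminus S.inv_add S.inv_power S.inv_Const S.inv_x invariant_f1 invariant_f2)
  show "S.invariant x3"
    by (intro S.inv_mult S.inv_power S.inv_Const S.inv_x)
qed

lemma homog_f3_tilde: "homog (CARD('p)^3 + 2 * CARD('p)^2) (f3_tilde :: 'p gring)"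
proof -
  let ?p = "CARD('p)"
  have mon: "homog (?p^3 + 2 * ?p^2) (Const c * Var Vx ^ i * f1 ^ j * (f2 :: 'p gring) ^ k)"
    if "i + j * ?p^2 + k * (?p^2 + 2 * ?p) = ?p^3 + 2 * ?p^2" for c i j k
  proof -
    have "homog (0 + i * 1 + j * ?p^2 + k * (?p^2 + 2 * ?p)) (Const c * Var Vx ^ i * f1 ^ j * (f2 :: 'p gring) ^ k)"
      by (intro homog_mult homog_power homog_Const homog_Var homog_f1 homog_f2)
    then show ?thesis using that by simp
  qed
  \<comment> \<open>Since p is odd and exceeds 5, this turns halved exponents and truncated
    differences into polynomials in r, on which the degrees can be compared.\<close>
  obtain r where r: "?p = 2 * r + 7"
  proof -
    have "odd ?p" "?p \<ge> 7" using odd_card[OF p_gt] p_gt by presburger+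
    then have "?p = 2 * ((?p - 7) div 2) + 7" by presburger
    then show ?thesis by (rule that)
  qed
  have sq: "?p^2 - 2 * ?p = (2*r+5) * ?p" "2 * ?p^2 - 2 * ?p = (4*r+12) * ?p" "2 * ?p^2 - ?p = (4*r+13) * ?p"
    by (simp_all add: r power2_eq_square algebra_simps)
  have half: "(?p - 3) div 2 = r + 2" "(?p + 1) div 2 = r + 4"
    by (simp_all add: r)
  have eqs: "0 + (?p + 2) * ?p^2 + 0 * (?p^2 + 2 * ?p) = ?p^3 + 2 * ?p^2"
    "0 + 0 * ?p^2 + ?p * (?p^2 + 2 * ?p) = ?p^3 + 2 * ?p^2"
    "(?p^2 - 2 * ?p) + ?p * ?p^2 + 1 * (?p^2 + 2 * ?p) = ?p^3 + 2 * ?p^2"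
    "?p^2 + (?p + 1) * ?p^2 + 0 * (?p^2 + 2 * ?p) = ?p^3 + 2 * ?p^2"
    "(2 * ?p^2 - 2 * ?p) + (?p - 1) * ?p^2 + 1 * (?p^2 + 2 * ?p) = ?p^3 + 2 * ?p^2"
    "(2 * ?p^2 - ?p) + ((?p - 3) div 2) * ?p^2 + ((?p + 1) div 2) * (?p^2 + 2 * ?p) = ?p^3 + 2 * ?p^2"
    unfolding sq half by (simp_all add: r power2_eq_square power3_eq_cube algebra_simps)
  have "f3_tilde = Const (gb ^ ?p) * Var Vx ^ 0 * f1 ^ (?p + 2) * f2 ^ 0
     - Const (ga ^ 2) * Var Vx ^ 0 * f1 ^ 0 * f2 ^ ?p
     + Const alpha1 * Var Vx ^ (?p^2 - 2 * ?p) * f1 ^ ?p * f2 ^ 1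
     + Const alpha2 * Var Vx ^ (?p^2) * f1 ^ (?p + 1) * f2 ^ 0
     + Const alpha3 * Var Vx ^ (2 * ?p^2 - 2 * ?p) * f1 ^ (?p - 1) * f2 ^ 1
     + Const alpha4 * Var Vx ^ (2 * ?p^2 - ?p) * f1 ^ ((?p - 3) div 2) * f2 ^ ((?p + 1) div 2)"
    by (simp add: f3_tilde_def Let_def)
  also have "homog (?p^3 + 2 * ?p^2) \<dots>"
    by (intro homog_add homog_diff mon eqs)
  finally show ?thesis .
qed

lemma homog_f3: "homog (CARD('p)^3 + 2) (f3 :: 'p gring)"
proof (rule homog_cancel[OF _ x3_nonzero])
  let ?n = "2 * CARD('p)^2 - 2"
  have "homog (?n * 1) (Var Vx ^ ?n :: 'p gring)"
    by (intro homog_power homog_Var)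
  then show "homog ?n x3" by (intro homog_Const_mult) simp
  have "homog (CARD('p)^3 + 2 * CARD('p)^2 + 0) (- f3_tilde * Const gb :: 'p gring)"
    by (intro homog_mult homog_uminus homog_f3_tilde homog_Const)
  moreover have "CARD('p)^3 + 2 * CARD('p)^2 + 0 = ?n + (CARD('p)^3 + 2)"
    using F.p_sq_ge p_gt by simp
  ultimately show "homog (?n + (CARD('p)^3 + 2)) (x3 * f3)"
    unfolding f3_mult by simp
qed

lemma lead_f3: "grevlex.lead (f3 :: 'p gring) (single Vy (CARD('p)^3 + 2)) (gam 1 3 5 7)"
proof -
  obtain w where "f3 = Const (gam 1 3 5 7) * Var Vy ^ (CARD('p)^3 + 2) + Var Vx * (w :: 'p gring)"
    using f3_form by blast
  then show ?thesis
    using homog_f3 lead_homog_mod_x gam_1357_nonzero by metis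
qed

lemma sagbi_generators_gens:
  "sagbi_generators (shifts :: ('p genfield \<times> 'p genfield) set) CARD('p) f1 f2 f3 ga (ga * gb) (gam 1 3 5 7)"
  using odd_card[OF p_gt] p_gt card_shifts invariant_f1 invariant_f2 invariant_f3
    homog_f1 homog_f2 homog_f3 lead_f1 lead_f2 lead_f3
  by unfold_locales auto

end

theorem theorem2p3:
  fixes p :: nat
  assumes "p = CARD('p::prime_card)" and "p > 5"
  shows
    "sagbi_basis (set gens) (invariants :: 'p gring set)
     \<and> is_subalgebra hull (set gens) = (invariants :: 'p gring set)
     \<and> complete_intersection (invariants :: 'p gring set)
     \<and> (let B = (gens :: 'p gring list);
            subd1 = subduction_relation B
              (Poly_Mapping.single 2 p) (Poly_Mapping.single 1 (p + 2));
            subd2 = subduction_relation B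
              (Poly_Mapping.single 3 p)
              (Poly_Mapping.single 2 1 + Poly_Mapping.single 1 (p^2 - 1))
        in (\<exists>R1. subd1 R1) \<and> (\<exists>R2. subd2 R2)
         \<and> (\<forall>R1 R2. subd1 R1 \<longrightarrow> subd2 R2 \<longrightarrow>
              relations B = ideal_gen (poly_ring (length B)) [R1, R2]))"
proof -
  have p: "CARD('p) > 5" using assms by simp
  interpret sagbi_generators "shifts :: ('p genfield \<times> 'p genfield) set" "CARD('p)" f1 f2 f3
    "gam 1 2 3 4" "gam 1 2 3 4 * gam 1 2 3 5" "gam 1 3 5 7"
    by (rule sagbi_generators_gens[OF p])
  have gens: "gens = B"
    by (simp add: gens_def B_def norm_z_eq[OF odd_card[OF p]])
  have inv: "invariants = A"
    by (rule invariants_eq[OF odd_card[OF p]])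
  show ?thesis
    unfolding assms(1) gens inv Let_def using presentation by blast
qed

end
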